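(* Let $G$ be a connected Lie group with Lie algebra $\mathfrak{g}=T_eG$, endowed with a left invariant spray structure $\mathbf{G}$ with spray vector field $\eta$. Let $c(t)$ be a geodesic on $G$ for $\mathbf{G}$ and let $y(t)=(L_{c(t)^{-1}})_*(\dot c(t))$ be the corresponding integral curve of $-\eta$ on $\mathfrak{g}\backslash\{0\}$. Let $W(t)$ be a linearly parallel vector field along $c(t)$ and let $w(t)=(L_{c(t)^{-1}})_*(W(t))$, regarded as a vector field along $y(t)$. Then $N(t)=N(y(t),w(t))$ and $R(t)=R_{y(t)}(w(t))$, where $N(\cdot,\cdot)$ is the connection operator and $R_{\cdot}(\cdot)$ is the Riemann curvature of $\mathbf{G}$ (at $e$), are vector fields along $y(t)$ determined by $$N(t)=-[\eta,w(t)]\quad\text{and}\quad R(t)=[\eta,N(t)]=-[\eta,[\eta,w(t)]].$$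
   Context: Summation convention is used. A spray structure on a smooth manifold $M$ is a smooth vector field $\mathbf{G}$ on the slit tangent bundle $TM\backslash 0$ which, in every standard local coordinate system $(x^i,y^i)$ of $TM$ (i.e. $x=(x^i)\in M$, $y=y^i\partial_{x^i}\in T_xM$), has the form $\mathbf{G}=y^i\partial_{x^i}-2\mathbf{G}^i\partial_{y^i}$ with $\mathbf{G}^i=\mathbf{G}^i(x,y)$ positively 2-homogeneous in $y$. Put $N^i_j=\partial\mathbf{G}^i/\partial y^j$. A geodesic is a smooth curve $c(t)$ with nowhere vanishing $\dot c(t)$ such that $(c(t),\dot c(t))$ is an integral curve of $\mathbf{G}$. Linear parallelism: for a smooth curve $c(t)$ with nowhere vanishing $\dot c(t)$ and a smooth vector field $W(t)=z^i(t)\partial_{x^i}|_{c(t)}$ along it, $D_{\dot c(t)}W(t)=\big(\tfrac{\mathrm{d}z^i(t)}{\mathrm{d}t}+z^j(t)N^i_j(c(t),\dot c(t))\big)\partial_{x^i}|_{c(t)}$, and $W(t)$ is linearly parallel along $c(t)$ if $D_{\dot c(t)}W(t)\equiv 0$. Riemann curvature of a spray: for $y\in T_xM\backslash\{0\}$, $R_y:T_xM\to T_xM$ is the linear map $R_y(w)=R^i_k(x,y)\,w^k\partial_{x^i}$ with $R^i_k=2\tfrac{\partial \mathbf{G}^i}{\partial x^k}-y^j\tfrac{\partial^2\mathbf{G}^i}{\partial x^j\partial y^k}+2\mathbf{G}^j\tfrac{\partial^2\mathbf{G}^i}{\partial y^j\partial y^k}-\tfrac{\partial\mathbf{G}^i}{\partial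 y^j}\tfrac{\partial\mathbf{G}^j}{\partial y^k}$. In the claim it is taken at $x=e$, so $R_y:\mathfrak{g}\to\mathfrak{g}$ for $y\in\mathfrak{g}\backslash\{0\}$. Lie group notation: $L_g(g')=gg'$; $[\cdot,\cdot]_{\mathfrak{g}}$ is the Lie bracket of $\mathfrak{g}$ (defined through left invariant vector fields), while $[\cdot,\cdot]$ without subscript is the bracket of vector fields. Fix a basis $e_1,\dots,e_n$ of $\mathfrak{g}$ and let $U_i(g)=(L_g)_*(e_i)$. Let $\widetilde U_i$ be the complete lift of $U_i$ to $TG$ (the complete lift of $X=X^i\partial_{x^i}$ is $X^i\partial_{x^i}+y^j\tfrac{\partial X^i}{\partial x^j}\partial_{y^i}$). Writing $y=u^iU_i(g)\in T_gG$ defines functions $u^i$ on $TG$, and $\partial_{u^i}$ denotes the vector field on $TG$ tangent to each $T_gG$ and equal there to the coordinate field of the linear coordinate $u^i$. Left invariant sprays: $\mathbf{G}$ on $G$ is left invariant if it is preserved by (the maps on $TG\backslash 0$ induced by) all left translations. Put $\mathbf{G}_0=u^i\widetilde U_i$. Every left invariant spray structure can be written $\mathbf{G}=\mathbf{G}_0-\mathbf{H}^i\partial_{u^i}$, where the $\mathbf{H}^i$ are left invariant smooth functions on $TG\backslash 0$, positively 2-homogeneous on each $T_gG$. The spray vector field is $\eta:\mathfrak{g}\backslash\{0\}\to\mathfrak{g}$, $\eta(y)=\mathbf{H}^i(e,y)e_i$, also viewed as a vector field on $\mathfrak{g}\backslash\{0\}$. It is known that if $c(t)$ is a geodesic of $\mathbf{G}$,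 then $y(t)=(L_{c(t)^{-1}})_*(\dot c(t))$ is an integral curve of $-\eta$. The connection operator is $N(y,w)=\tfrac12D\eta(y,w)-\tfrac12[y,w]_{\mathfrak{g}}$ for $y\in\mathfrak{g}\backslash\{0\}$, $w\in\mathfrak{g}$, where $D\eta(y,w)$ is the derivative of $\eta$ at $y$ in the direction $w$. Bracket with a vector field along an integral curve: if $X=X^i\partial_{x^i}$ is a smooth vector field on a manifold and $Y(t)=Y^i(t)\partial_{x^i}|_{\gamma(t)}$ is a smooth vector field along an integral curve $\gamma(t)$ of $X$, then $[X,Y(t)]$ is the vector field along $\gamma(t)$ given by $[X,Y(t)]=\big(\tfrac{\mathrm{d}Y^i(t)}{\mathrm{d}t}\partial_{x^i}-Y^i(t)\tfrac{\partial X^j}{\partial x^i}\partial_{x^j}\big)|_{\gamma(t)}$ (independent of coordinates). For a vector field $v(t)$ along the integral curve $y(t)$ of $-\eta$, one sets $[\eta,v(t)]=-[-\eta,v(t)]$, the bracket on the right being of this kind with $X=-\eta$. Tangent spaces of $\mathfrak{g}\backslash\{0\}$ are identified with $\mathfrak{g}$. *)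

theory Defs
  imports "HOL-Analysis.Analysis" "HOL-Algebra.Group"
begin

section \<open>Smooth maps between open subsets of Euclidean spaces\<close>

text \<open>\<open>Ck_on k S f\<close> is the usual notion of class \<open>C\<^sup>k\<close> for an open set \<open>S\<close>; all directional
  derivatives are required to be of class \<open>C\<^sup>k\<close> in the recursive step.\<close>

primrec Ck_on :: "nat \<Rightarrow> 'a::euclidean_space set \<Rightarrow> ('a \<Rightarrow> 'b::real_normed_vector) \<Rightarrow> bool" where
  "Ck_on 0 S f \<longleftrightarrow> continuous_on S f"
| "Ck_on (Suc k) S f \<longleftrightarrow>
     (\<forall>x\<in>S. f differentiable (at x)) \<and> (\<forall>v. Ck_on k S (\<lambda>x. frechet_derivative f (at x) v))"

definition smooth_on :: "'a::euclidean_space set \<Rightarrow> ('a \<Rightarrow> 'b::real_normed_vector) \<Rightarrow> bool" where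
  "smooth_on S f \<longleftrightarrow> (\<forall>k. Ck_on k S f)"


section \<open>Manifolds\<close>

text \<open>A chart is a pair \<open>(U, \<phi>)\<close>; the values of \<open>\<phi>\<close> outside \<open>U\<close> are irrelevant.  Smooth structures
  are given by an arbitrary (possibly, but not necessarily, maximal) atlas.\<close>

type_synonym ('m, 'e) chart = "'m set \<times> ('m \<Rightarrow> 'e)"

definition chart_inv :: "('m, 'e) chart \<Rightarrow> 'e \<Rightarrow> 'm" where
  "chart_inv c = the_inv_into (fst c) (snd c)"

definition charts_at :: "('m, 'e) chart set \<Rightarrow> 'm \<Rightarrow> ('m, 'e) chart set" where
  "charts_at A p = {c \<in> A. p \<in> fst c}"

definition smooth_atlas :: "'m set \<Rightarrow> ('m, 'e::euclidean_space) chart set \<Rightarrow> bool" where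
  "smooth_atlas M A \<longleftrightarrow>
     (\<Union>c\<in>A. fst c) = M \<and>
     (\<forall>c\<in>A. inj_on (snd c) (fst c)) \<and>
     (\<forall>c\<in>A. \<forall>d\<in>A. open (snd c ` (fst c \<inter> fst d)) \<and>
        smooth_on (snd c ` (fst c \<inter> fst d)) (\<lambda>a. snd d (chart_inv c a)))"

definition manifold_topology :: "('m, 'e::euclidean_space) chart set \<Rightarrow> 'm topology" where
  "manifold_topology A =
     topology (\<lambda>V. V \<subseteq> (\<Union>c\<in>A. fst c) \<and> (\<forall>c\<in>A. open (snd c ` (V \<inter> fst c))))"

lemma openin_manifold_topology:
  assumes "smooth_atlas M A"
  shows "openin (manifold_topology A) V \<longleftrightarrow> V \<subseteq> M \<and> (\<forall>c\<in>A. open (snd c ` (V \<inter> fst c)))"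
proof -
  have U: "(\<Union>c\<in>A. fst c) = M" and inj: "\<And>c. c \<in> A \<Longrightarrow> inj_on (snd c) (fst c)"
    using assms by (auto simp: smooth_atlas_def)
  have "istopology (\<lambda>V. V \<subseteq> (\<Union>c\<in>A. fst c) \<and> (\<forall>c\<in>A. open (snd c ` (V \<inter> fst c))))"
    unfolding istopology_def
  proof (intro conjI allI impI ballI)
    fix S T c
    assume S: "S \<subseteq> (\<Union>c\<in>A. fst c) \<and> (\<forall>c\<in>A. open (snd c ` (S \<inter> fst c)))"
      and T: "T \<subseteq> (\<Union>c\<in>A. fst c) \<and> (\<forall>c\<in>A. open (snd c ` (T \<inter> fst c)))"
    show "S \<inter> T \<subseteq> (\<Union>c\<in>A. fst c)" using S by blast
    assume c: "c \<in> A"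
    have "snd c ` (S \<inter> T \<inter> fst c) = snd c ` (S \<inter> fst c) \<inter> snd c ` (T \<inter> fst c)"
      using inj_on_image_Int[OF inj[OF c], of "S \<inter> fst c" "T \<inter> fst c"]
      by (simp add: Int_ac Int_left_commute)
    then show "open (snd c ` (S \<inter> T \<inter> fst c))" using S T c by auto
  next
    fix \<K> c
    assume K: "\<forall>K\<in>\<K>. K \<subseteq> (\<Union>c\<in>A. fst c) \<and> (\<forall>c\<in>A. open (snd c ` (K \<inter> fst c)))"
    show "\<Union>\<K> \<subseteq> (\<Union>c\<in>A. fst c)" using K by blast
    assume c: "c \<in> A"
    have "snd c ` (\<Union>\<K> \<inter> fst c) = (\<Union>K\<in>\<K>. snd c ` (K \<inter> fst c))" by blast
    then show "open (snd c ` (\<Union>\<K> \<inter> fst c))" using K c by auto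
  qed
  then show ?thesis
    unfolding manifold_topology_def by (simp add: topology_inverse' U)
qed

definition smooth_manifold :: "'m set \<Rightarrow> ('m, 'e::euclidean_space) chart set \<Rightarrow> bool" where
  "smooth_manifold M A \<longleftrightarrow> smooth_atlas M A \<and>
     Hausdorff_space (manifold_topology A) \<and> second_countable (manifold_topology A)"

text \<open>Continuity is part of this definition, since preimages of chart domains are required to be
  open.\<close>

definition smooth_map ::
  "('m, 'e::euclidean_space) chart set \<Rightarrow> ('n, 'f::euclidean_space) chart set \<Rightarrow> ('m \<Rightarrow> 'n) \<Rightarrow> bool" where
  "smooth_map A B f \<longleftrightarrow>
     f ` (\<Union>c\<in>A. fst c) \<subseteq> (\<Union>d\<in>B. fst d) \<and>
     (\<forall>c\<in>A. \<forall>d\<in>B. open (snd c ` (fst c \<inter> f -` fst d)) \<and>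
        smooth_on (snd c ` (fst c \<inter> f -` fst d)) (\<lambda>a. snd d (f (chart_inv c a))))"

definition prod_atlas ::
  "('m, 'e) chart set \<Rightarrow> ('n, 'f) chart set \<Rightarrow> ('m \<times> 'n, 'e \<times> 'f) chart set" where
  "prod_atlas A B = {(fst c \<times> fst d, map_prod (snd c) (snd d)) | c d. c \<in> A \<and> d \<in> B}"


section \<open>Tangent vectors, tangent bundle, vector fields\<close>

text \<open>A tangent vector at \<open>p\<close> is a family of coordinate vectors, one for each chart at \<open>p\<close>,
  transforming by the Jacobians of the coordinate changes (and \<open>0\<close> at the other charts, so that equality
  of functions is equality of tangent vectors).  Thus \<open>v c\<close> is the coordinate vector
  of \<open>v\<close> in the chart \<open>c\<close>, and the vector space operations are pointwise.\<close>

type_synonym ('m, 'e) tvec = "('m, 'e) chart \<Rightarrow> 'e"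

definition tangent_space :: "('m, 'e::euclidean_space) chart set \<Rightarrow> 'm \<Rightarrow> ('m, 'e) tvec set" where
  "tangent_space A p =
     {v. (\<forall>c. c \<notin> charts_at A p \<longrightarrow> v c = 0) \<and>
         (\<forall>c\<in>charts_at A p. \<forall>d\<in>charts_at A p.
            v d = frechet_derivative (\<lambda>a. snd d (chart_inv c a)) (at (snd c p)) (v c))}"

definition zero_tvec :: "('m, 'e::euclidean_space) tvec" where
  "zero_tvec = (\<lambda>_. 0)"

definition tangent_bundle :: "('m, 'e::euclidean_space) chart set \<Rightarrow> ('m \<times> ('m, 'e) tvec) set" where
  "tangent_bundle A = {(p, v). p \<in> (\<Union>c\<in>A. fst c) \<and> v \<in> tangent_space A p}"

definition slit_tangent_bundle ::
  "('m, 'e::euclidean_space) chart set \<Rightarrow> ('m \<times> ('m, 'e) tvec) set" where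
  "slit_tangent_bundle A = {(p, v). (p, v) \<in> tangent_bundle A \<and> v \<noteq> zero_tvec}"

text \<open>The standard local coordinates \<open>(x, y)\<close> of the tangent bundle; \<open>tangent_atlas A\<close> makes it a
  manifold, so that the notions for manifolds also apply to it.\<close>

definition tangent_chart ::
  "('m, 'e::euclidean_space) chart set \<Rightarrow> ('m, 'e) chart \<Rightarrow> ('m \<times> ('m, 'e) tvec, 'e \<times> 'e) chart" where
  "tangent_chart A c =
     ({(p, v). p \<in> fst c \<and> v \<in> tangent_space A p}, (\<lambda>(p, v). (snd c p, v c)))"

definition tangent_atlas ::
  "('m, 'e::euclidean_space) chart set \<Rightarrow> ('m \<times> ('m, 'e) tvec, 'e \<times> 'e) chart set" where
  "tangent_atlas A = tangent_chart A ` A"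

lemma inj_tangent_chart: "inj (tangent_chart (A :: ('m, 'e::euclidean_space) chart set))"
proof (rule injI, rule ccontr)
  fix c d :: "('m, 'e) chart"
  assume eq: "tangent_chart A c = tangent_chart A d" and ne: "c \<noteq> d"
  obtain b :: 'e where b: "b \<in> Basis" using nonempty_Basis by blast
  have "(\<lambda>(p, v). (snd c p, v c)) = (\<lambda>(p, v::('m, 'e) tvec). (snd d p, v d))"
    using eq by (simp add: tangent_chart_def)
  from fun_cong[OF this, of "(undefined, (\<lambda>x. if x = c then b else 0))"]
  have "b = 0" using ne by simp
  then show False using b nonzero_Basis by blast
qed

definition smooth_vector_field ::
  "('m, 'e::euclidean_space) chart set \<Rightarrow> 'm set \<Rightarrow> ('m \<Rightarrow> ('m, 'e) tvec) \<Rightarrow> bool" where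
  "smooth_vector_field A V X \<longleftrightarrow>
     (\<forall>p\<in>V. X p \<in> tangent_space A p) \<and>
     (\<forall>c\<in>A. smooth_on (snd c ` (fst c \<inter> V)) (\<lambda>a. X (chart_inv c a) c))"

text \<open>The differential of \<open>f\<close> at \<open>p\<close>; for smooth \<open>f\<close> it does not depend on the chosen chart \<open>c\<close>.\<close>

definition pushforward ::
  "('m, 'e::euclidean_space) chart set \<Rightarrow> ('n, 'f::euclidean_space) chart set \<Rightarrow> ('m \<Rightarrow> 'n) \<Rightarrow>
   'm \<Rightarrow> ('m, 'e) tvec \<Rightarrow> ('n, 'f) tvec" where
  "pushforward A B f p v = (\<lambda>d. if d \<in> charts_at B (f p)
     then (let c = (SOME c. c \<in> charts_at A p)
           in frechet_derivative (\<lambda>a. snd d (f (chart_inv c a))) (at (snd c p)) (v c))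
     else 0)"

definition tangent_map ::
  "('m, 'e::euclidean_space) chart set \<Rightarrow> ('n, 'f::euclidean_space) chart set \<Rightarrow> ('m \<Rightarrow> 'n) \<Rightarrow>
   'm \<times> ('m, 'e) tvec \<Rightarrow> 'n \<times> ('n, 'f) tvec" where
  "tangent_map A B f = (\<lambda>(p, v). (f p, pushforward A B f p v))"

text \<open>\<open>[X, Y]\<^sup>i = X\<^sup>j \<partial>\<^sub>j Y\<^sup>i - Y\<^sup>j \<partial>\<^sub>j X\<^sup>i\<close>\<close>

definition vf_bracket ::
  "('m, 'e::euclidean_space) chart set \<Rightarrow> ('m \<Rightarrow> ('m, 'e) tvec) \<Rightarrow> ('m \<Rightarrow> ('m, 'e) tvec) \<Rightarrow>
   'm \<Rightarrow> ('m, 'e) tvec" where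
  "vf_bracket A X Y p = (\<lambda>c. if c \<in> charts_at A p
     then frechet_derivative (\<lambda>a. Y (chart_inv c a) c) (at (snd c p)) (X p c)
        - frechet_derivative (\<lambda>a. X (chart_inv c a) c) (at (snd c p)) (Y p c)
     else 0)"

text \<open>\<open>tangent_lift A \<xi> f\<close> is the tangent vector of the tangent bundle at \<open>\<xi>\<close> whose coordinates in
  \<open>tangent_chart A c\<close> are \<open>f c\<close>.\<close>

definition tangent_lift ::
  "('m, 'e::euclidean_space) chart set \<Rightarrow> 'm \<times> ('m, 'e) tvec \<Rightarrow> (('m, 'e) chart \<Rightarrow> 'e \<times> 'e) \<Rightarrow>
   ('m \<times> ('m, 'e) tvec, 'e \<times> 'e) tvec" where
  "tangent_lift A \<xi> f = (\<lambda>d. if d \<in> charts_at (tangent_atlas A) \<xi>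
     then f (inv_into A (tangent_chart A) d) else 0)"

definition complete_lift ::
  "('m, 'e::euclidean_space) chart set \<Rightarrow> ('m \<Rightarrow> ('m, 'e) tvec) \<Rightarrow> 'm \<times> ('m, 'e) tvec \<Rightarrow>
   ('m \<times> ('m, 'e) tvec, 'e \<times> 'e) tvec" where
  "complete_lift A X = (\<lambda>(p, v). tangent_lift A (p, v)
     (\<lambda>c. (X p c, frechet_derivative (\<lambda>a. X (chart_inv c a) c) (at (snd c p)) (v c))))"


section \<open>Curves\<close>

text \<open>Curves are parametrised by an open interval \<open>I\<close>.\<close>

definition smooth_curve ::
  "('m, 'e::euclidean_space) chart set \<Rightarrow> real set \<Rightarrow> (real \<Rightarrow> 'm) \<Rightarrow> bool" where
  "smooth_curve A I \<gamma> \<longleftrightarrow> \<gamma> ` I \<subseteq> (\<Union>c\<in>A. fst c) \<and>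
     (\<forall>c\<in>A. open (I \<inter> \<gamma> -` fst c) \<and> smooth_on (I \<inter> \<gamma> -` fst c) (\<lambda>t. snd c (\<gamma> t)))"

definition velocity ::
  "('m, 'e::euclidean_space) chart set \<Rightarrow> (real \<Rightarrow> 'm) \<Rightarrow> real \<Rightarrow> ('m, 'e) tvec" where
  "velocity A \<gamma> t = (\<lambda>c. if c \<in> charts_at A (\<gamma> t)
     then vector_derivative (\<lambda>s. snd c (\<gamma> s)) (at t) else 0)"

definition smooth_field_along ::
  "('m, 'e::euclidean_space) chart set \<Rightarrow> real set \<Rightarrow> (real \<Rightarrow> 'm) \<Rightarrow> (real \<Rightarrow> ('m, 'e) tvec) \<Rightarrow> bool" where
  "smooth_field_along A I \<gamma> W \<longleftrightarrow>
     (\<forall>t\<in>I. W t \<in> tangent_space A (\<gamma> t)) \<and>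
     (\<forall>c\<in>A. smooth_on (I \<inter> \<gamma> -` fst c) (\<lambda>t. W t c))"

definition integral_curve ::
  "('m, 'e::euclidean_space) chart set \<Rightarrow> ('m \<Rightarrow> ('m, 'e) tvec) \<Rightarrow> real set \<Rightarrow> (real \<Rightarrow> 'm) \<Rightarrow> bool" where
  "integral_curve A X I \<gamma> \<longleftrightarrow> smooth_curve A I \<gamma> \<and> (\<forall>t\<in>I. velocity A \<gamma> t = X (\<gamma> t))"


section \<open>Sprays\<close>

text \<open>The spray coefficients \<open>G\<^sup>i(x, y)\<close> in the standard coordinates induced by the chart \<open>c\<close>:
  minus one half of the \<open>\<partial>\<^sub>y\<close>-components of the spray.\<close>

definition spray_coeff ::
  "('m, 'e::euclidean_space) chart set \<Rightarrow>
   ('m \<times> ('m, 'e) tvec \<Rightarrow> ('m \<times> ('m, 'e) tvec, 'e \<times> 'e) tvec) \<Rightarrow>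
   ('m, 'e) chart \<Rightarrow> 'e \<Rightarrow> 'e \<Rightarrow> 'e" where
  "spray_coeff A S c x y =
     - (1/2) *\<^sub>R snd (S (chart_inv (tangent_chart A c) (x, y)) (tangent_chart A c))"

definition spray_structure ::
  "('m, 'e::euclidean_space) chart set \<Rightarrow>
   ('m \<times> ('m, 'e) tvec \<Rightarrow> ('m \<times> ('m, 'e) tvec, 'e \<times> 'e) tvec) \<Rightarrow> bool" where
  "spray_structure A S \<longleftrightarrow>
     smooth_vector_field (tangent_atlas A) (slit_tangent_bundle A) S \<and>
     (\<forall>c\<in>A. \<forall>x\<in>snd c ` fst c. \<forall>y. y \<noteq> 0 \<longrightarrow>
        S (chart_inv (tangent_chart A c) (x, y)) (tangent_chart A c)
          = (y, - 2 *\<^sub>R spray_coeff A S c x y) \<and>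
        (\<forall>r>0. spray_coeff A S c x (r *\<^sub>R y) = r\<^sup>2 *\<^sub>R spray_coeff A S c x y))"

definition geodesic ::
  "('m, 'e::euclidean_space) chart set \<Rightarrow>
   ('m \<times> ('m, 'e) tvec \<Rightarrow> ('m \<times> ('m, 'e) tvec, 'e \<times> 'e) tvec) \<Rightarrow> real set \<Rightarrow> (real \<Rightarrow> 'm) \<Rightarrow> bool" where
  "geodesic A S I \<gamma> \<longleftrightarrow>
     smooth_curve A I \<gamma> \<and> (\<forall>t\<in>I. velocity A \<gamma> t \<noteq> zero_tvec) \<and>
     integral_curve (tangent_atlas A) S I (\<lambda>t. (\<gamma> t, velocity A \<gamma> t))"

text \<open>Partial derivatives of functions of \<open>(x, y)\<close> with respect to \<open>x\<^sup>k\<close> and \<open>y\<^sup>k\<close>.\<close>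

definition pd_x ::
  "'n::finite \<Rightarrow> (real^'n \<Rightarrow> real^'n \<Rightarrow> real) \<Rightarrow> real^'n \<Rightarrow> real^'n \<Rightarrow> real" where
  "pd_x k F x y = frechet_derivative (\<lambda>x'. F x' y) (at x) (axis k 1)"

definition pd_y ::
  "'n::finite \<Rightarrow> (real^'n \<Rightarrow> real^'n \<Rightarrow> real) \<Rightarrow> real^'n \<Rightarrow> real^'n \<Rightarrow> real" where
  "pd_y k F x y = frechet_derivative (\<lambda>y'. F x y') (at y) (axis k 1)"

context
  fixes A :: "('m, real^'n::finite) chart set"
    and S :: "'m \<times> ('m, real^'n) tvec \<Rightarrow> ('m \<times> ('m, real^'n) tvec, (real^'n) \<times> (real^'n)) tvec"
begin

definition spray_comp :: "('m, real^'n) chart \<Rightarrow> 'n \<Rightarrow> real^'n \<Rightarrow> real^'n \<Rightarrow> real" where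
  "spray_comp c i x y = spray_coeff A S c x y $ i"

definition spray_N :: "('m, real^'n) chart \<Rightarrow> 'n \<Rightarrow> 'n \<Rightarrow> real^'n \<Rightarrow> real^'n \<Rightarrow> real" where
  "spray_N c i j = pd_y j (spray_comp c i)"

definition covariant_derivative ::
  "(real \<Rightarrow> 'm) \<Rightarrow> (real \<Rightarrow> ('m, real^'n) tvec) \<Rightarrow> real \<Rightarrow> ('m, real^'n) tvec" where
  "covariant_derivative \<gamma> W t = (\<lambda>c. if c \<in> charts_at A (\<gamma> t)
     then vector_derivative (\<lambda>s. W s c) (at t)
        + (\<chi> i. \<Sum>j\<in>UNIV. W t c $ j * spray_N c i j (snd c (\<gamma> t)) (velocity A \<gamma> t c))
     else 0)"

definition linearly_parallel ::
  "real set \<Rightarrow> (real \<Rightarrow> 'm) \<Rightarrow> (real \<Rightarrow> ('m, real^'n) tvec) \<Rightarrow> bool" where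
  "linearly_parallel I \<gamma> W \<longleftrightarrow> smooth_field_along A I \<gamma> W \<and>
     (\<forall>t\<in>I. covariant_derivative \<gamma> W t = zero_tvec)"

definition riemann_comp :: "('m, real^'n) chart \<Rightarrow> 'n \<Rightarrow> 'n \<Rightarrow> real^'n \<Rightarrow> real^'n \<Rightarrow> real" where
  "riemann_comp c i k x y =
     2 * pd_x k (spray_comp c i) x y
     - (\<Sum>j\<in>UNIV. y $ j * pd_x j (pd_y k (spray_comp c i)) x y)
     + 2 * (\<Sum>j\<in>UNIV. spray_comp c j x y * pd_y j (pd_y k (spray_comp c i)) x y)
     - (\<Sum>j\<in>UNIV. pd_y j (spray_comp c i) x y * pd_y k (spray_comp c j) x y)"

definition riemann_curvature ::
  "'m \<Rightarrow> ('m, real^'n) tvec \<Rightarrow> ('m, real^'n) tvec \<Rightarrow> ('m, real^'n) tvec" where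
  "riemann_curvature p y w = (\<lambda>c. if c \<in> charts_at A p
     then (\<chi> i. \<Sum>k\<in>UNIV. riemann_comp c i k (snd c p) (y c) * w c $ k) else 0)"

end


section \<open>Lie groups and left invariant sprays\<close>

definition lie_group ::
  "('g, 'b) monoid_scheme \<Rightarrow> ('g, 'e::euclidean_space) chart set \<Rightarrow> bool" where
  "lie_group G A \<longleftrightarrow> Group.group G \<and> smooth_manifold (carrier G) A \<and>
     smooth_map (prod_atlas A A) A (\<lambda>(g, h). g \<otimes>\<^bsub>G\<^esub> h) \<and>
     smooth_map A A (\<lambda>g. inv\<^bsub>G\<^esub> g)"

definition left_translation :: "('g, 'b) monoid_scheme \<Rightarrow> 'g \<Rightarrow> 'g \<Rightarrow> 'g" where
  "left_translation G g h = g \<otimes>\<^bsub>G\<^esub> h"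

definition lie_algebra ::
  "('g, 'b) monoid_scheme \<Rightarrow> ('g, 'e::euclidean_space) chart set \<Rightarrow> ('g, 'e) tvec set" where
  "lie_algebra G A = tangent_space A \<one>\<^bsub>G\<^esub>"

definition left_invariant_field ::
  "('g, 'b) monoid_scheme \<Rightarrow> ('g, 'e::euclidean_space) chart set \<Rightarrow> ('g, 'e) tvec \<Rightarrow>
   'g \<Rightarrow> ('g, 'e) tvec" where
  "left_invariant_field G A v g = pushforward A A (left_translation G g) \<one>\<^bsub>G\<^esub> v"

definition lie_bracket ::
  "('g, 'b) monoid_scheme \<Rightarrow> ('g, 'e::euclidean_space) chart set \<Rightarrow>
   ('g, 'e) tvec \<Rightarrow> ('g, 'e) tvec \<Rightarrow> ('g, 'e) tvec" where
  "lie_bracket G A u v =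
     vf_bracket A (left_invariant_field G A u) (left_invariant_field G A v) \<one>\<^bsub>G\<^esub>"

definition left_invariant_spray ::
  "('g, 'b) monoid_scheme \<Rightarrow> ('g, 'e::euclidean_space) chart set \<Rightarrow>
   ('g \<times> ('g, 'e) tvec \<Rightarrow> ('g \<times> ('g, 'e) tvec, 'e \<times> 'e) tvec) \<Rightarrow> bool" where
  "left_invariant_spray G A S \<longleftrightarrow> spray_structure A S \<and>
     (\<forall>g\<in>carrier G. \<forall>\<xi>\<in>slit_tangent_bundle A.
        let F = tangent_map A A (left_translation G g)
        in pushforward (tangent_atlas A) (tangent_atlas A) F \<xi> (S \<xi>) = S (F \<xi>))"

definition lie_algebra_basis ::
  "('g, 'b) monoid_scheme \<Rightarrow> ('g, real^'n) chart set \<Rightarrow> ('n::finite \<Rightarrow> ('g, real^'n) tvec) \<Rightarrow> bool" where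
  "lie_algebra_basis G A e \<longleftrightarrow> (\<forall>i. e i \<in> lie_algebra G A) \<and>
     (\<forall>v\<in>lie_algebra G A. \<exists>!u::real^'n. v = (\<lambda>c. \<Sum>i\<in>UNIV. u $ i *\<^sub>R e i c))"

context
  fixes G :: "('g, 'b) monoid_scheme" and A :: "('g, real^'n::finite) chart set"
    and e :: "'n \<Rightarrow> ('g, real^'n) tvec"
begin

definition frame_field :: "'n \<Rightarrow> 'g \<Rightarrow> ('g, real^'n) tvec" where
  "frame_field i = left_invariant_field G A (e i)"

text \<open>The functions \<open>u\<^sup>i\<close> on \<open>TG\<close>, collected into a vector.\<close>

definition frame_coords :: "'g \<times> ('g, real^'n) tvec \<Rightarrow> real^'n" where
  "frame_coords = (\<lambda>(g, y). THE u. y = (\<lambda>c. \<Sum>i\<in>UNIV. u $ i *\<^sub>R frame_field i g c))"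

text \<open>\<open>\<partial>\<close>/\<open>\<partial>u\<^sup>i\<close>: since \<open>y = u\<^sup>i U\<^sub>i(g)\<close>, its \<open>y\<close>-coordinates are those of \<open>U\<^sub>i(g)\<close>.\<close>

definition partial_u ::
  "'n \<Rightarrow> 'g \<times> ('g, real^'n) tvec \<Rightarrow> ('g \<times> ('g, real^'n) tvec, (real^'n) \<times> (real^'n)) tvec" where
  "partial_u i = (\<lambda>(g, y). tangent_lift A (g, y) (\<lambda>c. (0, frame_field i g c)))"

definition spray_G0 ::
  "'g \<times> ('g, real^'n) tvec \<Rightarrow> ('g \<times> ('g, real^'n) tvec, (real^'n) \<times> (real^'n)) tvec" where
  "spray_G0 \<xi> = (\<lambda>d. \<Sum>i\<in>UNIV. frame_coords \<xi> $ i *\<^sub>R complete_lift A (frame_field i) \<xi> d)"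

text \<open>The functions \<open>H\<^sup>i\<close>, collected into a vector: the coefficients in
  \<open>S = G\<^sub>0 - H\<^sup>i \<partial>\<close>/\<open>\<partial>u\<^sup>i\<close>.\<close>

definition spray_H ::
  "('g \<times> ('g, real^'n) tvec \<Rightarrow> ('g \<times> ('g, real^'n) tvec, (real^'n) \<times> (real^'n)) tvec) \<Rightarrow>
   'g \<times> ('g, real^'n) tvec \<Rightarrow> real^'n" where
  "spray_H S \<xi> = (THE h. S \<xi> = (\<lambda>d. spray_G0 \<xi> d - (\<Sum>i\<in>UNIV. h $ i *\<^sub>R partial_u i \<xi> d)))"

definition spray_vector_field ::
  "('g \<times> ('g, real^'n) tvec \<Rightarrow> ('g \<times> ('g, real^'n) tvec, (real^'n) \<times> (real^'n)) tvec) \<Rightarrow>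
   ('g, real^'n) tvec \<Rightarrow> ('g, real^'n) tvec" where
  "spray_vector_field S y = (\<lambda>c. \<Sum>i\<in>UNIV. spray_H S (\<one>\<^bsub>G\<^esub>, y) $ i *\<^sub>R e i c)"

end


section \<open>Calculus on the Lie algebra\<close>

text \<open>Tangent spaces of the Lie algebra are identified with it, and for each chart \<open>c\<close> at the unit,
  \<open>v \<mapsto> v c\<close> is a global linear coordinate system on the Lie algebra.  Derivatives are hence taken
  componentwise.\<close>

definition ddir :: "(('m, 'e::euclidean_space) tvec \<Rightarrow> ('m, 'e) tvec) \<Rightarrow>
   ('m, 'e) tvec \<Rightarrow> ('m, 'e) tvec \<Rightarrow> ('m, 'e) tvec" where
  "ddir X y w = (\<lambda>c. vector_derivative (\<lambda>s. X (\<lambda>d. y d + s *\<^sub>R w d) c) (at 0))"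

definition connection_operator ::
  "('g, 'b) monoid_scheme \<Rightarrow> ('g, 'e::euclidean_space) chart set \<Rightarrow>
   (('g, 'e) tvec \<Rightarrow> ('g, 'e) tvec) \<Rightarrow> ('g, 'e) tvec \<Rightarrow> ('g, 'e) tvec \<Rightarrow> ('g, 'e) tvec" where
  "connection_operator G A \<eta> y w =
     (\<lambda>c. (1/2) *\<^sub>R ddir \<eta> y w c - (1/2) *\<^sub>R lie_bracket G A y w c)"

text \<open>\<open>[X, Y(t)]\<close> for a vector field \<open>Y(t)\<close> along an integral curve \<open>\<gamma>\<close> of \<open>X\<close>.\<close>

definition bracket_along ::
  "(('m, 'e::euclidean_space) tvec \<Rightarrow> ('m, 'e) tvec) \<Rightarrow> (real \<Rightarrow> ('m, 'e) tvec) \<Rightarrow>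
   (real \<Rightarrow> ('m, 'e) tvec) \<Rightarrow> real \<Rightarrow> ('m, 'e) tvec" where
  "bracket_along X \<gamma> Y t =
     (\<lambda>c. vector_derivative (\<lambda>s. Y s c) (at t) - ddir X (\<gamma> t) (Y t) c)"

text \<open>\<open>[\<eta>, v(t)] = - [-\<eta>, v(t)]\<close> for \<open>v(t)\<close> along an integral curve \<open>y\<close> of \<open>-\<eta>\<close>.\<close>

definition eta_bracket ::
  "(('m, 'e::euclidean_space) tvec \<Rightarrow> ('m, 'e) tvec) \<Rightarrow> (real \<Rightarrow> ('m, 'e) tvec) \<Rightarrow>
   (real \<Rightarrow> ('m, 'e) tvec) \<Rightarrow> real \<Rightarrow> ('m, 'e) tvec" where
  "eta_bracket \<eta> y v t = (\<lambda>c. - bracket_along (\<lambda>z d. - \<eta> z d) y v t c)"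

text \<open>A vector field along a curve in the Lie algebra is a smooth Lie algebra valued function of the
  parameter.\<close>

definition lie_algebra_field ::
  "('g, 'b) monoid_scheme \<Rightarrow> ('g, 'e::euclidean_space) chart set \<Rightarrow> real set \<Rightarrow>
   (real \<Rightarrow> ('g, 'e) tvec) \<Rightarrow> bool" where
  "lie_algebra_field G A I v \<longleftrightarrow>
     (\<forall>t\<in>I. v t \<in> lie_algebra G A) \<and> (\<forall>c\<in>charts_at A \<one>\<^bsub>G\<^esub>. smooth_on I (\<lambda>t. v t c))"

end

theory Submission
  imports Defs
begin

text \<open>
  In a chart, let \<open>U(x) u = u\<^sup>i U\<^sub>i(x)\<close> be the left invariant frame, \<open>h\<close> the spray vector field and \<open>B\<close> the Lie
  bracket in frame components. Left invariance of the spray and of the bracket of left invariant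
  fields says that, with the same \<open>h\<close> and \<open>B\<close> at all points and in all charts,
  \<open>2G(x, Uu) = U h(u) - DU[Uu]u\<close> and \<open>DU[Uu]v - DU[Uv]u = U B(u, v)\<close>.
  Differentiating the first identity in \<open>u\<close> gives \<open>\<Gamma>(Uw) = U M(u)w - DU[Uu]w\<close> for the matrix \<open>\<Gamma>\<close> of the
  \<open>\<partial>G\<^sup>i/\<partial>y\<^sup>j\<close>, where \<open>M(u)w = (Dh(u)w + B(u, w))/2\<close>. Hence geodesics \<open>x' = Uu\<close> satisfy \<open>u' = -h(u)\<close>
  and parallel fields \<open>Uw\<close> satisfy \<open>w' = -M(u)w\<close>, so that \<open>w' + Dh(u)w = Dh(u)w - M(u)w\<close> is the connection
  operator. The curvature is \<open>2D\<^sub>xG - D\<Gamma>[(y, -2G)] - \<Gamma>\<Gamma>\<close>. Differentiating the three identities once more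
  (both sides of the bracket identity along \<open>Uu\<close>, and using that \<open>D\<^sup>2U\<close> is symmetric) all derivatives
  of \<open>U\<close> cancel, and what remains is \<open>-(N' + Dh(u)N)\<close> along the geodesic, evaluated at the unit.
\<close>

section \<open>Calculus of smooth maps\<close>

text \<open>Under a smooth map both the spray coefficients and the derivative of the frame transform
  with an extra term, the second derivative of the map. In \<open>2G + DU[Uu]u\<close> the two extra
  terms cancel; in \<open>DU[Uu]v - DU[Uv]u\<close> they cancel because a second derivative is
  symmetric. This is why the frame components \<open>h\<close> and \<open>B\<close> of these
  expressions do not vary over the group. A change of coordinates is handled as left translation by
  the unit, so one computation gives independence of both the point and the chart. The geometry is
  then contained in two identities, and \<open>framed_spray\<close> works on an open set of a
  Euclidean space with no group in sight. The factor 1/2 in \<open>M\<close> arises because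
  differentiating \<open>2G\<close> produces both \<open>DU[Uw]u\<close> and \<open>DU[Uu]w\<close>;
  the bracket identity turns the former into the latter at the cost of one \<open>U B(u, w)\<close>.
  Flipping the sign of \<open>B\<close> in \<open>M\<close> gives the connection operator, so the
  two add up to \<open>Dh\<close>, and \<open>w' = -M(u)w\<close> becomes the first claim at
  once.\<close>

lemma frechet_derivative_eqI:
  "(f has_derivative f') (at x) \<Longrightarrow> frechet_derivative f (at x) v = f' v"
  using frechet_derivative_at[of f f' x] by simp

section \<open>Closure properties of \<open>Ck_on\<close>\<close>

lemma Ck_on_SucD: "Ck_on (Suc k) S f \<Longrightarrow> Ck_on k S f"
proof (induction k arbitrary: f)
  case 0
  then show ?case
    by (simp add: continuous_at_imp_continuous_on differentiable_imp_continuous_within)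
next
  case (Suc k)
  have "\<forall>x\<in>S. f differentiable at x" "\<And>v. Ck_on (Suc k) S (\<lambda>x. frechet_derivative f (at x) v)"
    using Suc.prems unfolding Ck_on.simps(2)[of "Suc k"] by blast+
  with Suc.IH show ?case unfolding Ck_on.simps(2)[of k S f] by blast
qed

lemma Ck_on_cong:
  assumes "Ck_on k S f" "open S" "\<And>x. x \<in> S \<Longrightarrow> f x = g x"
  shows "Ck_on k S g"
  using assms
proof (induction k arbitrary: f g)
  case 0
  then show ?case by (simp cong: continuous_on_cong)
next
  case (Suc k)
  have "g differentiable at x" if "x \<in> S" for x
  proof -
    have "(f has_derivative frechet_derivative f (at x)) (at x)"
      using Suc.prems(1) that frechet_derivative_works by auto
    then show ?thesis
      using has_derivative_transform_within_open[OF _ Suc.prems(2) that, of f _ UNIV g] Suc.prems(3)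
      unfolding differentiable_def by auto
  qed
  moreover have "Ck_on k S (\<lambda>x. frechet_derivative g (at x) v)" for v
  proof (rule Suc.IH)
    show "Ck_on k S (\<lambda>x. frechet_derivative f (at x) v)" using Suc.prems by simp
    show "frechet_derivative f (at x) v = frechet_derivative g (at x) v" if "x \<in> S" for x
      using frechet_derivative_transform_within_open[of f x S g] Suc.prems that by simp
  qed (rule Suc.prems)
  ultimately show ?case by simp
qed

text \<open>Used at the end to glue: frame components along a curve are first found smooth only
  while the curve stays in one chart.\<close>

lemma Ck_on_local:
  assumes "\<And>x. x \<in> S \<Longrightarrow> \<exists>T. open T \<and> x \<in> T \<and> Ck_on k T f"
  shows "Ck_on k S f"
  using assms
proof (induction k arbitrary: f)
  case 0
  then show ?case
    unfolding Ck_on.simps by (metis continuous_at_imp_continuous_on continuous_on_eq_continuous_at)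
next
  case (Suc k)
  have "f differentiable at x" if "x \<in> S" for x
    using Suc.prems[OF that] by auto
  moreover have "Ck_on k S (\<lambda>x. frechet_derivative f (at x) v)" for v
  proof (rule Suc.IH)
    show "\<exists>T. open T \<and> x \<in> T \<and> Ck_on k T (\<lambda>x. frechet_derivative f (at x) v)" if "x \<in> S" for x
      using Suc.prems[OF that] by auto
  qed
  ultimately show ?case by simp
qed

lemma Ck_on_const: "Ck_on k S (\<lambda>x. c)"
  by (induction k arbitrary: c) auto

lemma Ck_on_linear:
  assumes "bounded_linear L" shows "Ck_on k S L"
proof (cases k)
  case 0
  then show ?thesis using assms by (simp add: linear_continuous_on)
next
  case (Suc m)
  have L: "(L has_derivative L) (at x)" for x
    using assms by (rule bounded_linear_imp_has_derivative)
  then show ?thesis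
    unfolding Suc
    by (auto simp: differentiable_def frechet_derivative_at[OF L, symmetric] Ck_on_const)
qed

lemma Ck_on_bounded_linear:
  assumes "bounded_linear L" "open S" "Ck_on k S f"
  shows "Ck_on k S (\<lambda>x. L (f x))"
  using assms(3)
proof (induction k arbitrary: f)
  case 0
  then show ?case using bounded_linear.continuous_on[OF assms(1)] by auto
next
  case (Suc k)
  have D: "((\<lambda>x. L (f x)) has_derivative (\<lambda>v. L (frechet_derivative f (at x) v))) (at x)"
    if "x \<in> S" for x
    using Suc.prems that
    by (auto intro!: bounded_linear.has_derivative[OF assms(1)] simp: frechet_derivative_works[symmetric])
  have "Ck_on k S (\<lambda>x. frechet_derivative (\<lambda>x. L (f x)) (at x) v)" for v
  proof (rule Ck_on_cong)
    show "Ck_on k S (\<lambda>x. L (frechet_derivative f (at x) v))" using Suc by auto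
  qed (use assms in \<open>simp_all add: frechet_derivative_eqI[OF D]\<close>)
  then show ?case using D unfolding differentiable_def Ck_on.simps by blast
qed

lemma Ck_on_add:
  assumes "open S" "Ck_on k S f" "Ck_on k S g"
  shows "Ck_on k S (\<lambda>x. f x + g x)"
  using assms(2,3)
proof (induction k arbitrary: f g)
  case 0
  then show ?case by (auto intro: continuous_on_add)
next
  case (Suc k)
  have D: "((\<lambda>x. f x + g x) has_derivative
      (\<lambda>v. frechet_derivative f (at x) v + frechet_derivative g (at x) v)) (at x)"
    if "x \<in> S" for x
    using Suc.prems that
    by (auto intro!: has_derivative_add simp: frechet_derivative_works[symmetric])
  have "Ck_on k S (\<lambda>x. frechet_derivative (\<lambda>x. f x + g x) (at x) v)" for v
  proof (rule Ck_on_cong)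
    show "Ck_on k S (\<lambda>x. frechet_derivative f (at x) v + frechet_derivative g (at x) v)"
      using Suc by auto
  qed (use assms in \<open>simp_all add: frechet_derivative_eqI[OF D]\<close>)
  then show ?case using D unfolding differentiable_def Ck_on.simps by blast
qed

lemma Ck_on_bilinear:
  assumes "bounded_bilinear pr" "open S" "Ck_on k S f" "Ck_on k S g"
  shows "Ck_on k S (\<lambda>x. pr (f x) (g x))"
  using assms(3,4)
proof (induction k arbitrary: f g)
  case 0
  then show ?case using bounded_bilinear.continuous_on[OF assms(1)] by auto
next
  case (Suc k)
  have D: "((\<lambda>x. pr (f x) (g x)) has_derivative (\<lambda>v. pr (f x) (frechet_derivative g (at x) v)
      + pr (frechet_derivative f (at x) v) (g x))) (at x)"
    if "x \<in> S" for x
    using Suc.prems that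
    by (auto intro!: bounded_bilinear.FDERIV[OF assms(1)] simp: frechet_derivative_works[symmetric])
  have fg: "Ck_on k S f" "Ck_on k S g" using Suc.prems Ck_on_SucD by blast+
  have dfg: "Ck_on k S (\<lambda>x. frechet_derivative f (at x) v)"
    "Ck_on k S (\<lambda>x. frechet_derivative g (at x) v)" for v
    using Suc.prems by auto
  have "Ck_on k S (\<lambda>x. frechet_derivative (\<lambda>x. pr (f x) (g x)) (at x) v)" for v
  proof (rule Ck_on_cong)
    show "Ck_on k S (\<lambda>x. pr (f x) (frechet_derivative g (at x) v)
      + pr (frechet_derivative f (at x) v) (g x))"
      by (intro Ck_on_add[OF assms(2)] Suc.IH[OF fg(1) dfg(2)] Suc.IH[OF dfg(1) fg(2)])
  qed (use assms in \<open>simp_all add: frechet_derivative_eqI[OF D]\<close>)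
  then show ?case using D unfolding differentiable_def Ck_on.simps by blast
qed

lemma Ck_on_sum:
  assumes "open S" "\<And>i. i \<in> J \<Longrightarrow> Ck_on k S (f i)"
  shows "Ck_on k S (\<lambda>x. \<Sum>i\<in>J. f i x)"
  using assms(2)
  by (induction J rule: infinite_finite_induct) (auto intro!: Ck_on_add Ck_on_const assms(1))

text \<open>\<open>Ck_on\<close> controls derivatives in fixed directions only. When the direction
  varies with the point, this reduces to finitely many fixed directions.\<close>

lemma frechet_derivative_expand:
  fixes f :: "'a::euclidean_space \<Rightarrow> 'b::real_normed_vector"
  assumes "f differentiable at x"
  shows "frechet_derivative f (at x) v = (\<Sum>b\<in>Basis. (v \<bullet> b) *\<^sub>R frechet_derivative f (at x) b)"
proof -
  interpret linear "frechet_derivative f (at x)" by (rule linear_frechet_derivative[OF assms])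
  have "frechet_derivative f (at x) v = frechet_derivative f (at x) (\<Sum>b\<in>Basis. (v \<bullet> b) *\<^sub>R b)"
    by (simp add: euclidean_representation)
  then show ?thesis by (simp add: sum scaleR)
qed

text \<open>The chain rule differentiates \<open>f\<close> in a moving direction; expanded over
  \<open>Basis\<close> this becomes a sum of products. The factors that contain the derivative of
  \<open>f\<close> are again compositions with \<open>g\<close>, so the induction has to generalise
  over \<open>f\<close>.\<close>

lemma Ck_on_compose:
  fixes f :: "'b::euclidean_space \<Rightarrow> 'c::real_normed_vector" and g :: "'a::euclidean_space \<Rightarrow> 'b"
  assumes "open S" "Ck_on k S g" "Ck_on k T f" "g ` S \<subseteq> T"
  shows "Ck_on k S (\<lambda>x. f (g x))"
  using assms(2,3)
proof (induction k arbitrary: f)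
  case 0
  then show ?case using continuous_on_compose2[of T f S g] assms(4) by auto
next
  case (Suc k)
  have df: "f differentiable at (g x)" and dg: "g differentiable at x" if "x \<in> S" for x
    using Suc.prems that assms(4) by auto
  have D: "((\<lambda>x. f (g x)) has_derivative
      (\<lambda>v. frechet_derivative f (at (g x)) (frechet_derivative g (at x) v))) (at x)"
    if "x \<in> S" for x
    using has_derivative_compose df[OF that] dg[OF that] unfolding frechet_derivative_works
    by blast
  have "Ck_on k S (\<lambda>x. frechet_derivative (\<lambda>x. f (g x)) (at x) v)" for v
  proof (rule Ck_on_cong)
    have g: "Ck_on k S g" and dg': "Ck_on k S (\<lambda>x. frechet_derivative g (at x) v)"
      using Suc.prems Ck_on_SucD by auto
    have *: "Ck_on k S (\<lambda>x. frechet_derivative f (at (g x)) b)" for b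
      using Suc.prems by (intro Suc.IH[OF g]) auto
    show "Ck_on k S (\<lambda>x. \<Sum>b\<in>Basis. (frechet_derivative g (at x) v \<bullet> b) *\<^sub>R
        frechet_derivative f (at (g x)) b)"
      by (intro Ck_on_sum Ck_on_bilinear[OF bounded_bilinear_scaleR] assms(1) * dg'
          Ck_on_bounded_linear[OF bounded_linear_inner_left])
    show "(\<Sum>b\<in>Basis. (frechet_derivative g (at x) v \<bullet> b) *\<^sub>R frechet_derivative f (at (g x)) b)
      = frechet_derivative (\<lambda>x. f (g x)) (at x) v" if "x \<in> S" for x
      using frechet_derivative_at[OF D[OF that]] frechet_derivative_expand[OF df[OF that]]
      by metis
  qed (rule assms)
  then show ?case using D unfolding differentiable_def Ck_on.simps by blast
qed

text \<open>The derivative is a product of copies of \<open>inverse\<close> and a constant, so each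
  order of differentiability yields the next.\<close>

lemma Ck_on_inverse: "Ck_on k (- {0}) (inverse :: real \<Rightarrow> real)"
proof (induction k)
  case 0
  then show ?case by (auto intro!: continuous_intros)
next
  case (Suc k)
  have D: "(inverse has_derivative (\<lambda>v. - (inverse x * v * inverse x))) (at x)" if "x \<noteq> 0" for x :: real
    using has_derivative_inverse'[of x UNIV] that by simp
  have "Ck_on k (- {0}) (\<lambda>x. frechet_derivative inverse (at x) v)" for v :: real
  proof (rule Ck_on_cong)
    show "Ck_on k (- {0}) (\<lambda>x. - (inverse x * v * inverse x))"
      by (intro Ck_on_bounded_linear[OF bounded_linear_minus[OF bounded_linear_ident]]
          Ck_on_bilinear[OF bounded_bilinear_mult] Suc Ck_on_const) auto
  qed (simp_all add: frechet_derivative_eqI[OF D] open_Compl)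
  then show ?case using D unfolding differentiable_def Ck_on.simps by blast
qed

section \<open>Smooth maps and smooth solutions of linear systems\<close>

lemma smooth_onD_Ck: "smooth_on S f \<Longrightarrow> Ck_on k S f"
  by (simp add: smooth_on_def)

lemma smooth_on_differentiable: "smooth_on S f \<Longrightarrow> x \<in> S \<Longrightarrow> f differentiable at x"
  using smooth_onD_Ck[of S f "Suc 0"] by simp

lemma smooth_on_has_derivative:
  "smooth_on S f \<Longrightarrow> x \<in> S \<Longrightarrow> (f has_derivative frechet_derivative f (at x)) (at x)"
  using smooth_on_differentiable frechet_derivative_works by blast

lemma smooth_on_frechet_derivative:
  "smooth_on S f \<Longrightarrow> smooth_on S (\<lambda>x. frechet_derivative f (at x) v)"
  using smooth_onD_Ck[of S f] unfolding smooth_on_def by (metis Ck_on.simps(2))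

lemma smooth_on_cong:
  "smooth_on S f \<Longrightarrow> open S \<Longrightarrow> (\<And>x. x \<in> S \<Longrightarrow> f x = g x) \<Longrightarrow> smooth_on S g"
  unfolding smooth_on_def by (blast intro: Ck_on_cong)

lemma smooth_on_local:
  "(\<And>x. x \<in> S \<Longrightarrow> \<exists>T. open T \<and> x \<in> T \<and> smooth_on T f) \<Longrightarrow> smooth_on S f"
  unfolding smooth_on_def by (meson Ck_on_local)

lemma smooth_on_const: "smooth_on S (\<lambda>x. c)"
  by (simp add: smooth_on_def Ck_on_const)

lemma smooth_on_linear: "bounded_linear L \<Longrightarrow> smooth_on S L"
  by (simp add: smooth_on_def Ck_on_linear)

lemma smooth_on_bounded_linear:
  "bounded_linear L \<Longrightarrow> open S \<Longrightarrow> smooth_on S f \<Longrightarrow> smooth_on S (\<lambda>x. L (f x))"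
  by (simp add: smooth_on_def Ck_on_bounded_linear)

lemma smooth_on_bilinear:
  "bounded_bilinear pr \<Longrightarrow> open S \<Longrightarrow> smooth_on S f \<Longrightarrow> smooth_on S g \<Longrightarrow>
    smooth_on S (\<lambda>x. pr (f x) (g x))"
  by (simp add: smooth_on_def Ck_on_bilinear)

lemmas smooth_on_scaleR = smooth_on_bilinear[OF bounded_bilinear_scaleR]
  and smooth_on_mult = smooth_on_bilinear[OF bounded_bilinear_mult]
  and smooth_on_vec_nth = smooth_on_bounded_linear[OF bounded_linear_vec_nth]
  and smooth_on_uminus = smooth_on_bounded_linear[OF bounded_linear_minus[OF bounded_linear_ident]]
  and smooth_on_cmul = smooth_on_bounded_linear[OF bounded_linear_scaleR_right]

lemma smooth_on_add:
  "open S \<Longrightarrow> smooth_on S f \<Longrightarrow> smooth_on S g \<Longrightarrow> smooth_on S (\<lambda>x. f x + g x)"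
  by (simp add: smooth_on_def Ck_on_add)

lemma smooth_on_diff:
  "open S \<Longrightarrow> smooth_on S f \<Longrightarrow> smooth_on S g \<Longrightarrow> smooth_on S (\<lambda>x. f x - g x)"
  using smooth_on_add[of S f "\<lambda>x. - g x"] smooth_on_uminus[of S g] by simp

lemma smooth_on_sum:
  "open S \<Longrightarrow> (\<And>i. i \<in> J \<Longrightarrow> smooth_on S (f i)) \<Longrightarrow> smooth_on S (\<lambda>x. \<Sum>i\<in>J. f i x)"
  by (simp add: smooth_on_def Ck_on_sum)

lemma smooth_on_prod:
  fixes f :: "'i \<Rightarrow> 'a::euclidean_space \<Rightarrow> real"
  assumes "open S" "\<And>i. i \<in> J \<Longrightarrow> smooth_on S (f i)"
  shows "smooth_on S (\<lambda>x. \<Prod>i\<in>J. f i x)"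
  using assms(2)
  by (induction J rule: infinite_finite_induct) (auto intro!: smooth_on_mult smooth_on_const assms(1))

lemma smooth_on_compose:
  fixes f :: "'b::euclidean_space \<Rightarrow> 'c::real_normed_vector" and g :: "'a::euclidean_space \<Rightarrow> 'b"
  shows "smooth_on T f \<Longrightarrow> smooth_on S g \<Longrightarrow> open S \<Longrightarrow> g ` S \<subseteq> T \<Longrightarrow> smooth_on S (\<lambda>x. f (g x))"
  unfolding smooth_on_def by (blast intro: Ck_on_compose)

lemma smooth_on_divide:
  fixes f g :: "'a::euclidean_space \<Rightarrow> real"
  assumes "open S" "smooth_on S f" "smooth_on S g" "\<And>x. x \<in> S \<Longrightarrow> g x \<noteq> 0"
  shows "smooth_on S (\<lambda>x. f x / g x)"
proof -
  have "smooth_on (- {0}) (inverse :: real \<Rightarrow> real)"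
    by (simp add: smooth_on_def Ck_on_inverse)
  moreover have "g ` S \<subseteq> - {0}" using assms(4) by auto
  ultimately have "smooth_on S (\<lambda>x. inverse (g x))"
    by (rule smooth_on_compose[OF _ assms(3,1)])
  from smooth_on_mult[OF assms(1,2) this] show ?thesis by (simp add: divide_inverse)
qed

lemma smooth_on_Pair:
  assumes "open S" "smooth_on S f" "smooth_on S g"
  shows "smooth_on S (\<lambda>x. (f x, g x))"
proof -
  have "smooth_on S (\<lambda>x. (f x, 0) + (0, g x))"
    by (intro smooth_on_add smooth_on_bounded_linear[of "\<lambda>u. (u, 0)"]
        smooth_on_bounded_linear[of "\<lambda>u. (0, u)"] assms bounded_linear_Pair
        bounded_linear_ident bounded_linear_zero)
  then show ?thesis by simp
qed

lemma smooth_on_vec_lambda: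
  fixes f :: "'a::euclidean_space \<Rightarrow> 'i::finite \<Rightarrow> real"
  assumes "open S" "\<And>i. smooth_on S (\<lambda>x. f x i)"
  shows "smooth_on S (\<lambda>x. \<chi> i. f x i)"
proof -
  have "smooth_on S (\<lambda>x. \<Sum>i\<in>UNIV. f x i *\<^sub>R (axis i 1 :: real^'i))"
    by (intro smooth_on_sum smooth_on_scaleR assms smooth_on_const)
  moreover have "(\<Sum>i\<in>UNIV. f x i *\<^sub>R axis i 1) = (\<chi> i. f x i)" for x
    by (simp add: vec_eq_iff axis_def if_distrib sum.delta cong: if_cong)
  ultimately show ?thesis by (simp only:)
qed

lemma smooth_on_det:
  fixes M :: "'a::euclidean_space \<Rightarrow> real^'n^'n"
  assumes "open S" "\<And>i j. smooth_on S (\<lambda>x. M x $ i $ j)"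
  shows "smooth_on S (\<lambda>x. det (M x))"
  unfolding det_def
  by (intro smooth_on_sum smooth_on_mult smooth_on_const smooth_on_prod assms)

text \<open>Cramer's rule writes the solution as a quotient of determinants, so \<open>u\<close> is
  smooth although nothing but the pointwise equation is known about it. The frame components of
  curves and of the spray become smooth in this way.\<close>

lemma smooth_on_linear_solve:
  fixes M :: "'a::euclidean_space \<Rightarrow> real^'n^'n" and u :: "'a \<Rightarrow> real^'n"
  assumes "open S" "\<And>i j. smooth_on S (\<lambda>x. M x $ i $ j)" "smooth_on S b"
    and "\<And>x. x \<in> S \<Longrightarrow> det (M x) \<noteq> 0" "\<And>x. x \<in> S \<Longrightarrow> M x *v u x = b x"
  shows "smooth_on S u"
proof (rule smooth_on_cong)
  show "smooth_on S (\<lambda>x. \<chi> k. det (\<chi> i j. if j = k then b x $ i else M x $ i $ j) / det (M x))"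
  proof (intro smooth_on_vec_lambda smooth_on_divide smooth_on_det assms(1,2,4), simp_all)
    fix k i j
    show "smooth_on S (\<lambda>x. if j = k then b x $ i else M x $ i $ j)"
      by (cases "j = k") (auto intro: assms smooth_on_vec_nth)
  qed
  show "(\<chi> k. det (\<chi> i j. if j = k then b x $ i else M x $ i $ j) / det (M x)) = u x" if "x \<in> S" for x
    using cramer[OF assms(4)[OF that], THEN iffD1, OF assms(5)[OF that]] by (rule sym)
qed (rule assms)

lemma smooth_on_frechet_derivative_apply:
  fixes f :: "'b::euclidean_space \<Rightarrow> 'c::real_normed_vector" and g v :: "'a::euclidean_space \<Rightarrow> 'b"
  assumes "smooth_on T f" "open S" "smooth_on S g" "smooth_on S v" "g ` S \<subseteq> T"
  shows "smooth_on S (\<lambda>x. frechet_derivative f (at (g x)) (v x))"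
proof (rule smooth_on_cong)
  show "smooth_on S (\<lambda>x. \<Sum>b\<in>Basis. (v x \<bullet> b) *\<^sub>R frechet_derivative f (at (g x)) b)"
    by (intro smooth_on_sum smooth_on_scaleR smooth_on_bounded_linear[OF bounded_linear_inner_left]
        smooth_on_compose[OF smooth_on_frechet_derivative[OF assms(1)] assms(3,2,5)] assms)
  show "(\<Sum>b\<in>Basis. (v x \<bullet> b) *\<^sub>R frechet_derivative f (at (g x)) b)
    = frechet_derivative f (at (g x)) (v x)" if "x \<in> S" for x
    using frechet_derivative_expand[of f "g x" "v x"] smooth_on_differentiable[OF assms(1)] assms(5) that
    by auto
qed (rule assms)

section \<open>Differentiation along curves and symmetry of second derivatives\<close>

lemma has_vector_derivative_frechet:
  assumes "f differentiable at (x t)" "(x has_vector_derivative x') (at t)"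
  shows "((\<lambda>s. f (x s)) has_vector_derivative frechet_derivative f (at (x t)) x') (at t)"
  using vector_derivative_diff_chain_within[of x x' t UNIV f "frechet_derivative f (at (x t))"]
    assms frechet_derivative_works[of f "at (x t)"] by (auto simp: o_def intro: has_derivative_at_withinI)

text \<open>The second difference of \<open>f\<close> over a small parallelogram equals, by two
  applications of the mean value theorem, either mixed derivative at some point of it. The mean
  value theorem is for real functions, hence the passage to a component \<open>b\<close>. The two
  points obtained are different, so the proof refutes an inequality that continuity extends to
  independent nearby points.\<close>

lemma frechet_derivative_symmetric:
  fixes f :: "'a::euclidean_space \<Rightarrow> 'b::euclidean_space"
  assumes f: "smooth_on S f" and "open S" "a \<in> S"
  shows "frechet_derivative (\<lambda>x. frechet_derivative f (at x) v) (at a) w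
    = frechet_derivative (\<lambda>x. frechet_derivative f (at x) w) (at a) v"
proof (rule euclidean_eqI, rule ccontr)
  fix b :: 'b assume "b \<in> Basis"
  define D where "D v x = frechet_derivative f (at x) v" for v x
  define p where "p v w x = frechet_derivative (D v) (at x) w \<bullet> b" for v w x
  assume "frechet_derivative (\<lambda>x. frechet_derivative f (at x) v) (at a) w \<bullet> b
    \<noteq> frechet_derivative (\<lambda>x. frechet_derivative f (at x) w) (at a) v \<bullet> b"
  then have ne: "p v w a \<noteq> p w v a" by (simp add: p_def D_def[abs_def])
  have smD: "smooth_on S (D v)" for v
    unfolding D_def by (rule smooth_on_frechet_derivative[OF f])
  have "isCont (p v w) a" for v w
  proof -
    have "continuous_on S (\<lambda>x. frechet_derivative (D v) (at x) w)"
      using smooth_onD_Ck[OF smooth_on_frechet_derivative[OF smD], of 0] by simp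
    then have "continuous_on S (p v w)"
      unfolding p_def by (intro continuous_intros)
    then show ?thesis using assms continuous_on_eq_continuous_at by blast
  qed
  \<comment> \<open>Continuity at the diagonal point \<open>(a, a)\<close> of the product makes the
    inequality survive with two separate arguments.\<close>
  then have "isCont (\<lambda>z. p v w (fst z) - p w v (snd z)) (a, a)"
    by (intro continuous_intros isCont_o2[of "(a,a)" fst "p v w"] isCont_o2[of "(a,a)" snd "p w v"]) auto
  then have "\<forall>\<^sub>F z in nhds (a, a). p v w (fst z) - p w v (snd z) \<noteq> 0"
    using ne by (intro tendsto_imp_eventually_ne[where c = "p v w a - p w v a"])
      (auto simp: isCont_def tendsto_at_iff_tendsto_nhds[of "\<lambda>z. p v w (fst z) - p w v (snd z)" "(a, a)", simplified])
  then obtain P Q where PQ: "eventually P (nhds a)" "eventually Q (nhds a)"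
    "\<And>x y. P x \<Longrightarrow> Q y \<Longrightarrow> p v w x \<noteq> p w v y"
    unfolding nhds_prod eventually_prod_filter by auto
  have "\<forall>\<^sub>F x in nhds a. x \<in> S \<and> P x \<and> Q x"
    using assms PQ by (auto intro: eventually_conj eventually_nhds_in_open)
  then obtain r where r: "r > 0" "\<And>x. dist x a < r \<Longrightarrow> x \<in> S \<and> P x \<and> Q x"
    unfolding eventually_nhds_metric by auto
  \<comment> \<open>With this \<open>n\<close> the parallelogram of side factor \<open>s\<close> has
    all its points within \<open>s * n = r / 2\<close> of \<open>a\<close>; the summand 1 keeps
    \<open>n\<close> positive when \<open>v\<close> and \<open>w\<close> both vanish.\<close>
  define n where "n = norm v + norm w + 1"
  define s where "s = r / (2 * n)"
  have n0: "n > 0" unfolding n_def by (smt (verit) norm_ge_zero)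
  have s: "s > 0" unfolding s_def using r n0 by simp
  have dist_lt: "dist (a + \<alpha> *\<^sub>R v + \<beta> *\<^sub>R w) a < r" if "0 \<le> \<alpha>" "\<alpha> \<le> s" "0 \<le> \<beta>" "\<beta> \<le> s" for \<alpha> \<beta>
  proof -
    have "dist (a + \<alpha> *\<^sub>R v + \<beta> *\<^sub>R w) a \<le> \<alpha> * norm v + \<beta> * norm w"
      using norm_triangle_ineq[of "\<alpha> *\<^sub>R v" "\<beta> *\<^sub>R w"] that by (simp add: dist_norm)
    also have "\<dots> \<le> s * norm v + s * norm w" using that by (intro add_mono mult_right_mono) auto
    also have "\<dots> \<le> s * n" using s by (simp add: n_def algebra_simps)
    also have "\<dots> < r" unfolding s_def using r n0 by (simp add: field_simps)
    finally show ?thesis .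
  qed
  text \<open>Both mixed derivatives are, at suitable points, the same second difference divided by \<open>s\<^sup>2\<close>.\<close>
  have key: "\<exists>\<alpha> \<beta>. 0 \<le> \<alpha> \<and> \<alpha> \<le> s \<and> 0 \<le> \<beta> \<and> \<beta> \<le> s \<and>
     s * (s * p v w (a + \<alpha> *\<^sub>R v + \<beta> *\<^sub>R w)) =
      (f (a + s *\<^sub>R v + s *\<^sub>R w) - f (a + s *\<^sub>R v) - f (a + s *\<^sub>R w) + f a) \<bullet> b"
    if dist_lt: "\<And>\<alpha> \<beta>. 0 \<le> \<alpha> \<Longrightarrow> \<alpha> \<le> s \<Longrightarrow> 0 \<le> \<beta> \<Longrightarrow> \<beta> \<le> s \<Longrightarrow> a + \<alpha> *\<^sub>R v + \<beta> *\<^sub>R w \<in> S" for v w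
  proof -
    have df: "((\<lambda>t. f (z + t *\<^sub>R v) \<bullet> b) has_real_derivative D v (z + t *\<^sub>R v) \<bullet> b) (at t)"
      if "z + t *\<^sub>R v \<in> S" for z t
    proof -
      have "((\<lambda>t. f (z + t *\<^sub>R v)) has_vector_derivative D v (z + t *\<^sub>R v)) (at t)"
        unfolding D_def by (rule has_vector_derivative_frechet[where x = "\<lambda>t. z + t *\<^sub>R v",
              OF smooth_on_differentiable[OF f that]])
          (auto intro!: derivative_eq_intros)
      then show ?thesis
        using bounded_linear.has_vector_derivative[OF bounded_linear_inner_left]
        by (fastforce simp: has_real_derivative_iff_has_vector_derivative)
    qed
    have dD: "((\<lambda>t. D v (z + t *\<^sub>R w) \<bullet> b) has_real_derivative p v w (z + t *\<^sub>R w)) (at t)"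
      if "z + t *\<^sub>R w \<in> S" for z t
    proof -
      have "((\<lambda>t. D v (z + t *\<^sub>R w)) has_vector_derivative
          frechet_derivative (D v) (at (z + t *\<^sub>R w)) w) (at t)"
        by (rule has_vector_derivative_frechet[where x = "\<lambda>t. z + t *\<^sub>R w",
              OF smooth_on_differentiable[OF smD that]])
          (auto intro!: derivative_eq_intros)
      then show ?thesis
        using bounded_linear.has_vector_derivative[OF bounded_linear_inner_left]
        unfolding p_def by (fastforce simp: has_real_derivative_iff_has_vector_derivative)
    qed
    let ?F = "\<lambda>t. f (a + s *\<^sub>R w + t *\<^sub>R v) \<bullet> b - f (a + t *\<^sub>R v) \<bullet> b"
    have "(?F has_real_derivative (D v (a + s *\<^sub>R w + t *\<^sub>R v) \<bullet> b - D v (a + t *\<^sub>R v) \<bullet> b)) (at t)"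
      if "0 \<le> t" "t \<le> s" for t
    proof (intro DERIV_diff df)
      show "a + s *\<^sub>R w + t *\<^sub>R v \<in> S" using dist_lt[of t s] that s by (simp add: ac_simps)
      show "a + t *\<^sub>R v \<in> S" using dist_lt[of t 0] that s by simp
    qed
    from MVT2[of 0 s ?F, OF s this] obtain \<alpha> where \<alpha>: "0 < \<alpha>" "\<alpha> < s"
      and 1: "?F s - ?F 0 = s * (D v (a + s *\<^sub>R w + \<alpha> *\<^sub>R v) \<bullet> b - D v (a + \<alpha> *\<^sub>R v) \<bullet> b)"
      by auto
    let ?H = "\<lambda>t. D v (a + \<alpha> *\<^sub>R v + t *\<^sub>R w) \<bullet> b"
    have "(?H has_real_derivative p v w (a + \<alpha> *\<^sub>R v + t *\<^sub>R w)) (at t)" if "0 \<le> t" "t \<le> s" for t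
      using dist_lt[of \<alpha> t] \<alpha> that by (intro dD) auto
    from MVT2[of 0 s ?H, OF s this] obtain \<beta> where \<beta>: "0 < \<beta>" "\<beta> < s"
      and 2: "?H s - ?H 0 = s * p v w (a + \<alpha> *\<^sub>R v + \<beta> *\<^sub>R w)"
      by auto
    show ?thesis
      using \<alpha> \<beta> 1 2
      by (intro exI[of _ \<alpha>] exI[of _ \<beta>]) (simp add: algebra_simps inner_diff_left inner_add_left)
  qed
  from key[of v w] dist_lt r obtain \<alpha> \<beta> where 1: "0 \<le> \<alpha>" "\<alpha> \<le> s" "0 \<le> \<beta>" "\<beta> \<le> s"
     "s * (s * p v w (a + \<alpha> *\<^sub>R v + \<beta> *\<^sub>R w)) =
      (f (a + s *\<^sub>R v + s *\<^sub>R w) - f (a + s *\<^sub>R v) - f (a + s *\<^sub>R w) + f a) \<bullet> b"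
    by blast
  \<comment> \<open>The second use of \<open>key\<close> exchanges \<open>v\<close> and
    \<open>w\<close>, which describes the same parallelogram with the two coefficients
    swapped.\<close>
  have "a + \<alpha> *\<^sub>R w + \<beta> *\<^sub>R v \<in> S" if "0 \<le> \<alpha>" "\<alpha> \<le> s" "0 \<le> \<beta>" "\<beta> \<le> s" for \<alpha> \<beta>
    using dist_lt[of \<beta> \<alpha>] that r by (metis add.assoc add.commute)
  from key[of w v] this obtain \<gamma> \<delta> where 2: "0 \<le> \<gamma>" "\<gamma> \<le> s" "0 \<le> \<delta>" "\<delta> \<le> s"
     "s * (s * p w v (a + \<gamma> *\<^sub>R w + \<delta> *\<^sub>R v)) =
      (f (a + s *\<^sub>R w + s *\<^sub>R v) - f (a + s *\<^sub>R w) - f (a + s *\<^sub>R v) + f a) \<bullet> b"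
    by blast
  have "s * (s * p v w (a + \<alpha> *\<^sub>R v + \<beta> *\<^sub>R w)) = s * (s * p w v (a + \<delta> *\<^sub>R v + \<gamma> *\<^sub>R w))"
    unfolding 1(5) using 2(5) by (simp add: ac_simps diff_diff_eq)
  then have "p v w (a + \<alpha> *\<^sub>R v + \<beta> *\<^sub>R w) = p w v (a + \<delta> *\<^sub>R v + \<gamma> *\<^sub>R w)"
    using s by simp
  moreover have "P (a + \<alpha> *\<^sub>R v + \<beta> *\<^sub>R w)" "Q (a + \<delta> *\<^sub>R v + \<gamma> *\<^sub>R w)"
    using dist_lt r(2) 1 2 by blast+
  ultimately show False using PQ(3) by blast
qed

text \<open>A product rule that needs the derivative of \<open>L s\<close> only on fixed vectors:
  expand the moving vector over \<open>Basis\<close>. Linearity is required just near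
  \<open>t\<close>, because a Frechet derivative is known to be linear only where the map is
  differentiable. Linearity of \<open>L'\<close> follows from uniqueness of derivatives.\<close>

lemma has_vector_derivative_linear_family:
  fixes L :: "real \<Rightarrow> 'a::euclidean_space \<Rightarrow> 'b::real_normed_vector"
  assumes lin: "\<forall>\<^sub>F s in nhds t. linear (L s)"
    and L': "\<And>b. ((\<lambda>s. L s b) has_vector_derivative L' b) (at t)"
    and v: "(v has_vector_derivative v') (at t)"
  shows "((\<lambda>s. L s (v s)) has_vector_derivative (L' (v t) + L t v')) (at t)"
proof -
  have expand: "L s x = (\<Sum>b\<in>Basis. (x \<bullet> b) *\<^sub>R L s b)" if "linear (L s)" for s x
  proof -
    have "L s x = L s (\<Sum>b\<in>Basis. (x \<bullet> b) *\<^sub>R b)" by (simp add: euclidean_representation)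
    then show ?thesis by (simp only: linear_sum[OF that] linear_scale[OF that])
  qed
  have L'expand: "L' x = (\<Sum>b\<in>Basis. (x \<bullet> b) *\<^sub>R L' b)" for x
  proof (rule vector_derivative_unique_at[OF L'])
    have "((\<lambda>s. \<Sum>b\<in>Basis. (x \<bullet> b) *\<^sub>R L s b) has_vector_derivative (\<Sum>b\<in>Basis. (x \<bullet> b) *\<^sub>R L' b)) (at t)"
      by (intro has_vector_derivative_sum bounded_linear.has_vector_derivative[OF bounded_linear_scaleR_right] L')
    then show "((\<lambda>s. L s x) has_vector_derivative (\<Sum>b\<in>Basis. (x \<bullet> b) *\<^sub>R L' b)) (at t)"
      unfolding has_vector_derivative_def
      by (rule has_derivative_transform_eventually)
        (use lin expand in \<open>auto simp: eventually_at_filter elim!: eventually_mono dest: eventually_nhds_x_imp_x\<close>)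
  qed
  have "((\<lambda>s. \<Sum>b\<in>Basis. (v s \<bullet> b) *\<^sub>R L s b) has_vector_derivative
      (\<Sum>b\<in>Basis. (v t \<bullet> b) *\<^sub>R L' b + (v' \<bullet> b) *\<^sub>R L t b)) (at t)"
    by (intro has_vector_derivative_sum has_vector_derivative_scaleR L'
        bounded_linear.has_vector_derivative[OF bounded_linear_inner_left, folded has_real_derivative_iff_has_vector_derivative] v)
  moreover have "(\<Sum>b\<in>Basis. (v t \<bullet> b) *\<^sub>R L' b + (v' \<bullet> b) *\<^sub>R L t b) = L' (v t) + L t v'"
    using L'expand[of "v t"] expand[of t v'] eventually_nhds_x_imp_x[OF lin]
    by (simp add: sum.distrib)
  ultimately have "((\<lambda>s. \<Sum>b\<in>Basis. (v s \<bullet> b) *\<^sub>R L s b) has_vector_derivative (L' (v t) + L t v')) (at t)"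
    by simp
  then show ?thesis
    unfolding has_vector_derivative_def
    by (rule has_derivative_transform_eventually)
      (use lin expand in \<open>auto simp: eventually_at_filter elim!: eventually_mono dest: eventually_nhds_x_imp_x\<close>)
qed

lemma linear_expand: "linear L \<Longrightarrow> L (v :: real^'n) = (\<Sum>j\<in>UNIV. v $ j *\<^sub>R L (axis j 1))"
  using linear_sum[of L "\<lambda>i. v $ i *\<^sub>R axis i 1" UNIV]
  by (simp add: linear_scale basis_expansion[of v, unfolded scalar_mult_eq_scaleR])

text \<open>Relates the joint derivative, in which the curvature is computed, to the partial
  derivatives \<open>pd_x\<close> and \<open>pd_y\<close> of single components.\<close>

lemma partial_has_derivative:
  fixes F :: "'a::euclidean_space \<times> 'b::euclidean_space \<Rightarrow> real^'n"
  assumes "smooth_on S F" "(x, y) \<in> S"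
  shows "((\<lambda>x. F (x, y) $ i) has_derivative (\<lambda>v. frechet_derivative F (at (x, y)) (v, 0) $ i)) (at x)"
    and "((\<lambda>y. F (x, y) $ i) has_derivative (\<lambda>v. frechet_derivative F (at (x, y)) (0, v) $ i)) (at y)"
proof -
  have D: "(F has_derivative frechet_derivative F (at (x, y))) (at (x, y))"
    using assms by (rule smooth_on_has_derivative)
  show "((\<lambda>x. F (x, y) $ i) has_derivative (\<lambda>v. frechet_derivative F (at (x, y)) (v, 0) $ i)) (at x)"
    by (rule bounded_linear.has_derivative[OF bounded_linear_vec_nth],
        rule has_derivative_compose[where f = "\<lambda>x. (x, y)" and f' = "\<lambda>v. (v, 0)" and g = F, OF _ D])
      (auto intro!: derivative_eq_intros)
  show "((\<lambda>y. F (x, y) $ i) has_derivative (\<lambda>v. frechet_derivative F (at (x, y)) (0, v) $ i)) (at y)"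
    by (rule bounded_linear.has_derivative[OF bounded_linear_vec_nth],
        rule has_derivative_compose[where f = "\<lambda>y. (x, y)" and f' = "\<lambda>v. (0, v)" and g = F, OF _ D])
      (auto intro!: derivative_eq_intros)
qed

section \<open>Curvature in a frame\<close>

lemma eventually_curve_in_open:
  assumes "(x has_vector_derivative x') (at t)" "open S" "x t \<in> S"
  shows "\<forall>\<^sub>F s in nhds t. x s \<in> S"
proof -
  have "isCont x t" using assms(1) by (rule has_vector_derivative_continuous)
  then have "\<forall>\<^sub>F s in at t. x s \<in> S"
    using assms(2,3) by (auto simp: isCont_def tendsto_def)
  then show ?thesis using assms(3) by (auto simp: eventually_at_filter elim: eventually_mono)
qed

text \<open>Every identity below is differentiated through this: compute the derivative of each side
  along a curve on which the identity holds near \<open>t\<close>.\<close>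

lemma has_vector_derivative_unique_eventually:
  assumes "(f has_vector_derivative f') (at t)" "(g has_vector_derivative g') (at t)"
    and "\<forall>\<^sub>F s in nhds t. f s = g s"
  shows "f' = g'"
proof -
  have "(g has_vector_derivative f') (at t)"
    using assms(1) unfolding has_vector_derivative_def
    by (rule has_derivative_transform_eventually)
      (use assms(3) in \<open>auto simp: eventually_at_filter elim: eventually_mono dest: eventually_nhds_x_imp_x\<close>)
  then show ?thesis using assms(2) vector_derivative_unique_at by blast
qed

lemma has_vector_derivative_line:
  fixes a b :: "'a::real_normed_vector"
  shows "((\<lambda>s. a + s *\<^sub>R b) has_vector_derivative b) (at t)"
  by (auto intro!: derivative_eq_intros)

lemma eventually_line:
  fixes a b :: "'a::real_normed_vector"
  assumes "open S" "a \<in> S" shows "\<forall>\<^sub>F s in nhds 0. a + s *\<^sub>R b \<in> S"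
  by (rule eventually_curve_in_open[OF has_vector_derivative_line assms(1)]) (use assms in simp)

text \<open>In the application, \<open>\<Omega>\<close> is the image of a chart, \<open>U a\<close> is the matrix of the left invariant frame,
  \<open>h\<close> and \<open>B\<close> are the spray vector field and the Lie bracket in frame components, and \<open>\<Gamma>\<close> is the matrix
  of the \<open>\<partial>G\<^sup>i/\<partial>y\<^sup>j\<close>.\<close>

locale framed_spray =
  fixes \<Omega> :: "'v::euclidean_space set" and U :: "'v \<Rightarrow> 'v \<Rightarrow> 'v" and h :: "'v \<Rightarrow> 'v"
    and B G :: "'v \<Rightarrow> 'v \<Rightarrow> 'v"
    and P :: "'v \<Rightarrow> 'v \<Rightarrow> 'v \<Rightarrow> 'v"
  assumes P_def: "\<And>a \<xi> u. P a \<xi> u = frechet_derivative (\<lambda>a. U a u) (at a) \<xi>"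
    and open_\<Omega>: "open \<Omega>"
    and linear_U: "\<And>a. linear (U a)"
    and inj_U: "\<And>a u. a \<in> \<Omega> \<Longrightarrow> U a u = 0 \<Longrightarrow> u = 0"
    and smooth_U: "\<And>u. smooth_on \<Omega> (\<lambda>a. U a u)"
    and smooth_h: "smooth_on (- {0}) h"
    and smooth_G: "smooth_on (\<Omega> \<times> - {0}) (\<lambda>z. G (fst z) (snd z))"
    and bilinear_B: "bounded_bilinear B"
    and spray_eq: "\<And>a u. a \<in> \<Omega> \<Longrightarrow> u \<noteq> 0 \<Longrightarrow>
      2 *\<^sub>R G a (U a u) = U a (h u) - P a (U a u) u"
    and bracket_eq: "\<And>a u v. a \<in> \<Omega> \<Longrightarrow> P a (U a u) v - P a (U a v) u = U a (B u v)"
begin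

text \<open>The second derivative of the frame; \<open>\<xi>\<close> is the direction of the inner
  derivative and \<open>\<zeta>\<close> that of the outer one.\<close>

definition Q :: "'v \<Rightarrow> 'v \<Rightarrow> 'v \<Rightarrow> 'v \<Rightarrow> 'v" where
  "Q a \<xi> \<zeta> u = frechet_derivative (\<lambda>a. P a \<xi> u) (at a) \<zeta>"

definition DG :: "'v \<times> 'v \<Rightarrow> 'v \<times> 'v \<Rightarrow> 'v" where
  "DG z = frechet_derivative (\<lambda>z. G (fst z) (snd z)) (at z)"

definition \<Gamma> :: "'v \<times> 'v \<Rightarrow> 'v \<Rightarrow> 'v" where
  "\<Gamma> z v = DG z (0, v)"

definition dh :: "'v \<Rightarrow> 'v \<Rightarrow> 'v" where
  "dh u = frechet_derivative h (at u)"

definition ddh :: "'v \<Rightarrow> 'v \<Rightarrow> 'v \<Rightarrow> 'v" where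
  "ddh u z w = frechet_derivative (\<lambda>u. dh u w) (at u) z"

definition M :: "'v \<Rightarrow> 'v \<Rightarrow> 'v" where
  "M u w = (1/2) *\<^sub>R (dh u w + B u w)"

lemma linear_P: "a \<in> \<Omega> \<Longrightarrow> linear (\<lambda>\<xi>. P a \<xi> u)"
  unfolding P_def by (rule linear_frechet_derivative[OF smooth_on_differentiable[OF smooth_U]])

lemma linear_P_right:
  assumes "a \<in> \<Omega>" shows "linear (P a \<xi>)"
proof
  have D: "((\<lambda>a. U a u) has_derivative (\<lambda>\<xi>. P a \<xi> u)) (at a)" for u
    unfolding P_def by (rule smooth_on_has_derivative[OF smooth_U assms])
  show "P a \<xi> (u + v) = P a \<xi> u + P a \<xi> v" for u v
    using frechet_derivative_eqI[OF has_derivative_add[OF D[of u] D[of v]]]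
    by (simp add: P_def linear_add[OF linear_U])
  show "P a \<xi> (r *\<^sub>R u) = r *\<^sub>R P a \<xi> u" for r u
    using frechet_derivative_eqI[OF has_derivative_scaleR_right[OF D[of u], of r]]
    by (simp add: P_def linear_scale[OF linear_U])
qed

lemma smooth_P: "smooth_on \<Omega> (\<lambda>a. P a \<xi> u)"
  unfolding P_def by (rule smooth_on_frechet_derivative[OF smooth_U])

lemma Q_symmetric: "a \<in> \<Omega> \<Longrightarrow> Q a \<xi> \<zeta> u = Q a \<zeta> \<xi> u"
  unfolding Q_def P_def by (rule frechet_derivative_symmetric[OF smooth_U open_\<Omega>])

lemma linear_dh: "u \<noteq> 0 \<Longrightarrow> linear (dh u)"
  unfolding dh_def by (rule linear_frechet_derivative[OF smooth_on_differentiable[OF smooth_h]]) simp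

lemma smooth_dh: "smooth_on (- {0}) (\<lambda>u. dh u w)"
  unfolding dh_def by (rule smooth_on_frechet_derivative[OF smooth_h])

lemma linear_ddh: "u \<noteq> 0 \<Longrightarrow> linear (\<lambda>z. ddh u z w)"
  unfolding ddh_def by (rule linear_frechet_derivative[OF smooth_on_differentiable[OF smooth_dh]]) simp

lemma linear_DG: "a \<in> \<Omega> \<Longrightarrow> y \<noteq> 0 \<Longrightarrow> linear (DG (a, y))"
  unfolding DG_def by (rule linear_frechet_derivative[OF smooth_on_differentiable[OF smooth_G]]) simp

lemma smooth_DG: "smooth_on (\<Omega> \<times> - {0}) (\<lambda>z. DG z v)"
  unfolding DG_def by (rule smooth_on_frechet_derivative[OF smooth_G])

lemma linear_\<Gamma>: 
  assumes "a \<in> \<Omega>" "y \<noteq> 0" shows "linear (\<Gamma> (a, y))"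
proof -
  have "linear (DG (a, y) \<circ> Pair 0)"
    by (intro linear_compose linear_DG assms) (auto intro: linearI)
  then show ?thesis by (simp add: o_def \<Gamma>_def[abs_def])
qed

lemma smooth_\<Gamma>: "smooth_on (\<Omega> \<times> - {0}) (\<lambda>z. \<Gamma> z v)"
  unfolding \<Gamma>_def by (rule smooth_DG)

lemma DG_split: "a \<in> \<Omega> \<Longrightarrow> y \<noteq> 0 \<Longrightarrow> DG (a, y) (\<xi>, \<zeta>) = DG (a, y) (\<xi>, 0) + \<Gamma> (a, y) \<zeta>"
  unfolding \<Gamma>_def using linear_add[OF linear_DG, of a y "(\<xi>, 0)" "(0, \<zeta>)"] by simp

lemma linear_B: "linear (B u)" and linear_B_left: "linear (\<lambda>u. B u v)"
  using bilinear_B bounded_bilinear.bounded_linear_left bounded_bilinear.bounded_linear_right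
    bounded_linear.linear by blast+

context
  fixes x v \<xi> :: "real \<Rightarrow> 'v" and x' v' \<xi>' :: 'v and t :: real
  assumes x: "(x has_vector_derivative x') (at t)" and xt: "x t \<in> \<Omega>"
    and v: "(v has_vector_derivative v') (at t)"
begin

lemma has_vector_derivative_U:
  "((\<lambda>s. U (x s) (v s)) has_vector_derivative P (x t) x' (v t) + U (x t) v') (at t)"
proof (rule has_vector_derivative_linear_family[OF _ _ v])
  show "((\<lambda>s. U (x s) b) has_vector_derivative P (x t) x' b) (at t)" for b
    unfolding P_def
    by (rule has_vector_derivative_frechet[where f = "\<lambda>a. U a b", OF smooth_on_differentiable[OF smooth_U xt] x])
qed (simp add: linear_U)

text \<open>Base point, direction and frame components all move, giving three terms. The rule for
  linear families is used for the frame components and, inside, for the direction.\<close>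

lemma has_vector_derivative_P:
  assumes \<xi>: "(\<xi> has_vector_derivative \<xi>') (at t)"
  shows "((\<lambda>s. P (x s) (\<xi> s) (v s)) has_vector_derivative
    Q (x t) (\<xi> t) x' (v t) + P (x t) \<xi>' (v t) + P (x t) (\<xi> t) v') (at t)"
proof (rule has_vector_derivative_linear_family[OF _ _ v])
  have ev: "\<forall>\<^sub>F s in nhds t. x s \<in> \<Omega>"
    by (rule eventually_curve_in_open[OF x open_\<Omega> xt])
  show "((\<lambda>s. P (x s) (\<xi> s) b) has_vector_derivative Q (x t) (\<xi> t) x' b + P (x t) \<xi>' b) (at t)" for b
  proof (rule has_vector_derivative_linear_family[OF _ _ \<xi>])
    show "((\<lambda>s. P (x s) d b) has_vector_derivative Q (x t) d x' b) (at t)" for d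
      unfolding Q_def
      by (rule has_vector_derivative_frechet[where f = "\<lambda>a. P a d b", OF smooth_on_differentiable[OF smooth_P xt] x])
    show "\<forall>\<^sub>F s in nhds t. linear (\<lambda>\<xi>. P (x s) \<xi> b)"
      using ev by (rule eventually_mono) (rule linear_P)
  qed
  show "\<forall>\<^sub>F s in nhds t. linear (P (x s) (\<xi> s))"
    using ev by (rule eventually_mono) (rule linear_P_right)
qed

lemma has_vector_derivative_DG:
  assumes "v t \<noteq> 0"
  shows "((\<lambda>s. G (x s) (v s)) has_vector_derivative DG (x t, v t) (x', v')) (at t)"
  unfolding DG_def
  using has_vector_derivative_frechet[where f = "\<lambda>z. G (fst z) (snd z)" and x = "\<lambda>s. (x s, v s)",
      OF smooth_on_differentiable[OF smooth_G] has_vector_derivative_Pair[OF x v]] xt assms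
  by simp

lemma has_vector_derivative_\<Gamma>:
  assumes "v t \<noteq> 0" and \<xi>: "(\<xi> has_vector_derivative \<xi>') (at t)"
  shows "((\<lambda>s. \<Gamma> (x s, v s) (\<xi> s)) has_vector_derivative
    frechet_derivative (\<lambda>z. \<Gamma> z (\<xi> t)) (at (x t, v t)) (x', v') + \<Gamma> (x t, v t) \<xi>') (at t)"
proof (rule has_vector_derivative_linear_family[OF _ _ \<xi>])
  show "((\<lambda>s. \<Gamma> (x s, v s) b) has_vector_derivative
      frechet_derivative (\<lambda>z. \<Gamma> z b) (at (x t, v t)) (x', v')) (at t)" for b
    using has_vector_derivative_frechet[where f = "\<lambda>z. \<Gamma> z b" and x = "\<lambda>s. (x s, v s)",
      OF smooth_on_differentiable[OF smooth_\<Gamma>] has_vector_derivative_Pair[OF x v]] xt assms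
    by simp
  have "\<forall>\<^sub>F s in nhds t. (x s, v s) \<in> \<Omega> \<times> - {0}"
    by (rule eventually_curve_in_open[OF has_vector_derivative_Pair[OF x v]])
      (use xt assms open_\<Omega> in \<open>auto intro: open_Times open_Compl\<close>)
  then show "\<forall>\<^sub>F s in nhds t. linear (\<Gamma> (x s, v s))"
    by (rule eventually_mono) (auto intro: linear_\<Gamma>)
qed

end

lemma has_vector_derivative_h:
  assumes u: "(u has_vector_derivative u') (at t)" and "u t \<noteq> 0"
  shows "((\<lambda>s. h (u s)) has_vector_derivative dh (u t) u') (at t)"
  unfolding dh_def
  by (rule has_vector_derivative_frechet[where f = h, OF smooth_on_differentiable[OF smooth_h] u])
    (use assms in simp)

lemma has_vector_derivative_dh:
  assumes u: "(u has_vector_derivative u') (at t)" and "u t \<noteq> 0"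
    and w: "(w has_vector_derivative w') (at t)"
  shows "((\<lambda>s. dh (u s) (w s)) has_vector_derivative ddh (u t) u' (w t) + dh (u t) w') (at t)"
proof (rule has_vector_derivative_linear_family[OF _ _ w])
  have "\<forall>\<^sub>F s in nhds t. u s \<in> - {0}"
    by (rule eventually_curve_in_open[OF u]) (use assms in \<open>auto simp: open_Compl\<close>)
  then show "\<forall>\<^sub>F s in nhds t. linear (dh (u s))"
    by (rule eventually_mono) (simp add: linear_dh)
  show "((\<lambda>s. dh (u s) b) has_vector_derivative ddh (u t) u' b) (at t)" for b
    unfolding ddh_def
    by (rule has_vector_derivative_frechet[where f = "\<lambda>u. dh u b", OF smooth_on_differentiable[OF smooth_dh] u])
      (use assms in simp)
qed

lemma U_nonzero: "a \<in> \<Omega> \<Longrightarrow> u \<noteq> 0 \<Longrightarrow> U a u \<noteq> 0"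
  using inj_U by blast

text \<open>With the base point fixed, moving \<open>u\<close> along \<open>w\<close> moves the
  fibre point \<open>U a u\<close> along \<open>U a w\<close>, so the left side of
  \<open>spray_eq\<close> yields \<open>\<Gamma>\<close>. This form, still without \<open>B\<close>,
  is the one differentiated again in \<open>double_D\<Gamma>\<close>.\<close>

lemma double_\<Gamma>:
  assumes a: "a \<in> \<Omega>" and u: "u \<noteq> 0"
  shows "2 *\<^sub>R \<Gamma> (a, U a u) (U a w) = U a (dh u w) - P a (U a w) u - P a (U a u) w"
proof -
  let ?u = "\<lambda>s::real. u + s *\<^sub>R w"
  have c: "((\<lambda>s. a) has_vector_derivative 0) (at 0)" by simp
  have l: "(?u has_vector_derivative w) (at 0)" by (rule has_vector_derivative_line)
  have Uu: "((\<lambda>s. U a (?u s)) has_vector_derivative U a w) (at 0)"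
    using has_vector_derivative_U[OF c a l] linear_0[OF linear_P[OF a]] by simp
  have "((\<lambda>s. 2 *\<^sub>R G a (U a (?u s))) has_vector_derivative 2 *\<^sub>R \<Gamma> (a, U a u) (U a w)) (at 0)"
    using has_vector_derivative_DG[OF c a Uu] U_nonzero[OF a u]
    by (auto intro: bounded_linear.has_vector_derivative[OF bounded_linear_scaleR_right] simp: \<Gamma>_def)
  moreover have "((\<lambda>s. U a (h (?u s)) - P a (U a (?u s)) (?u s)) has_vector_derivative
      U a (dh u w) - P a (U a w) u - P a (U a u) w) (at 0)"
    using has_vector_derivative_diff[OF
      has_vector_derivative_U[OF c a has_vector_derivative_h[OF l]]
      has_vector_derivative_P[OF c a l Uu]] u
    by (simp add: linear_0[OF linear_P[OF a]] Q_def diff_diff_eq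
        linear_0[OF linear_frechet_derivative[OF smooth_on_differentiable[OF smooth_P a]]])
  moreover have "\<forall>\<^sub>F s in nhds 0. 2 *\<^sub>R G a (U a (?u s)) = U a (h (?u s)) - P a (U a (?u s)) (?u s)"
    using eventually_line[of "- {0}" u w] u spray_eq[OF a]
    by (auto simp: open_Compl elim: eventually_mono)
  ultimately show ?thesis by (rule has_vector_derivative_unique_eventually)
qed

text \<open>\<open>bracket_eq\<close> replaces \<open>P a (U a w) u\<close> by
  \<open>P a (U a u) w - U a (B u w)\<close>. The two equal \<open>P\<close> terms then match the
  factor 2 on the left, and \<open>B\<close> is absorbed into \<open>M\<close>.\<close>

lemma \<Gamma>_U:
  assumes a: "a \<in> \<Omega>" and u: "u \<noteq> 0"
  shows "\<Gamma> (a, U a u) (U a w) = U a (M u w) - P a (U a u) w"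
proof -
  have "2 *\<^sub>R \<Gamma> (a, U a u) (U a w) = 2 *\<^sub>R (U a (M u w) - P a (U a u) w)"
    unfolding double_\<Gamma>[OF assms] using bracket_eq[OF a, of u w]
    by (simp add: M_def linear_scale[OF linear_U] linear_add[OF linear_U] algebra_simps
        scaleR_2)
  then show ?thesis by simp
qed

text \<open>The base point moves while the frame components \<open>u\<close> stay fixed. The fibre
  point \<open>U a u\<close> then moves too, with velocity \<open>P a \<xi> u\<close>; this is the
  source of the \<open>\<Gamma>\<close> term.\<close>

lemma double_DG_left:
  assumes a: "a \<in> \<Omega>" and u: "u \<noteq> 0"
  shows "2 *\<^sub>R DG (a, U a u) (\<xi>, 0) + 2 *\<^sub>R \<Gamma> (a, U a u) (P a \<xi> u)
    = P a \<xi> (h u) - Q a (U a u) \<xi> u - P a (P a \<xi> u) u"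
proof -
  let ?x = "\<lambda>s::real. a + s *\<^sub>R \<xi>"
  have c: "((\<lambda>s. b) has_vector_derivative 0) (at 0)" for b :: 'v by simp
  have l: "(?x has_vector_derivative \<xi>) (at 0)" by (rule has_vector_derivative_line)
  have a0: "?x 0 \<in> \<Omega>" using a by simp
  have Uu: "((\<lambda>s. U (?x s) u) has_vector_derivative P a \<xi> u) (at 0)"
    using has_vector_derivative_U[OF l a0 c] linear_0[OF linear_U] by simp
  have "((\<lambda>s. 2 *\<^sub>R G (?x s) (U (?x s) u)) has_vector_derivative
     2 *\<^sub>R DG (a, U a u) (\<xi>, P a \<xi> u)) (at 0)"
    using has_vector_derivative_DG[OF l a0 Uu] U_nonzero[OF a u]
    by (auto intro: bounded_linear.has_vector_derivative[OF bounded_linear_scaleR_right])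
  moreover have "((\<lambda>s. U (?x s) (h u) - P (?x s) (U (?x s) u) u) has_vector_derivative
      P a \<xi> (h u) - Q a (U a u) \<xi> u - P a (P a \<xi> u) u) (at 0)"
    using has_vector_derivative_diff[OF has_vector_derivative_U[OF l a0 c]
      has_vector_derivative_P[OF l a0 c Uu]]
    by (simp add: linear_0[OF linear_U] linear_0[OF linear_P_right[OF a]] diff_diff_eq)
  moreover have "\<forall>\<^sub>F s in nhds 0. 2 *\<^sub>R G (?x s) (U (?x s) u) = U (?x s) (h u) - P (?x s) (U (?x s) u) u"
    using eventually_line[of \<Omega> a \<xi>] a spray_eq[OF _ u] by (auto simp: open_\<Omega> elim: eventually_mono)
  ultimately have "2 *\<^sub>R DG (a, U a u) (\<xi>, P a \<xi> u) = P a \<xi> (h u) - Q a (U a u) \<xi> u - P a (P a \<xi> u) u"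
    by (rule has_vector_derivative_unique_eventually)
  then show ?thesis
    using DG_split[OF a U_nonzero[OF a u], of \<xi> "P a \<xi> u"] by (simp add: scaleR_add_right)
qed

text \<open>Differentiates \<open>double_\<Gamma>\<close> in the direction of the spray. Only first
  derivatives at 0 matter, so straight lines with the right velocities replace the geodesic. Since
  \<open>w\<close> is fixed in the frame, \<open>U w\<close> moves and contributes the extra
  \<open>\<Gamma>\<close> term on the left.\<close>

lemma double_D\<Gamma>:
  assumes a: "a \<in> \<Omega>" and u: "u \<noteq> 0"
  shows "2 *\<^sub>R frechet_derivative (\<lambda>z. \<Gamma> z (U a w)) (at (a, U a u)) (U a u, - 2 *\<^sub>R G a (U a u))
      + 2 *\<^sub>R \<Gamma> (a, U a u) (P a (U a u) w)
    = P a (U a u) (dh u w) - U a (ddh u (h u) w)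
      - (Q a (U a w) (U a u) u + P a (P a (U a u) w) u - P a (U a w) (h u))
      - (Q a (U a u) (U a u) w + P a (P a (U a u) u) w - P a (U a (h u)) w)"
proof -
  let ?x = "\<lambda>s::real. a + s *\<^sub>R U a u"
  \<comment> \<open>The velocity \<open>- h u\<close> is chosen so that, by \<open>spray_eq\<close>,
    the fibre point \<open>U x u\<close> has velocity
    \<open>- 2 *\<^sub>R G a (U a u)\<close>.\<close>
  let ?u = "\<lambda>s::real. u + s *\<^sub>R - h u"
  have c: "((\<lambda>s. b) has_vector_derivative 0) (at 0)" for b :: 'v by simp
  have lx: "(?x has_vector_derivative U a u) (at 0)" by (rule has_vector_derivative_line)
  have lu: "(?u has_vector_derivative - h u) (at 0)" by (rule has_vector_derivative_line)
  have a0: "?x 0 \<in> \<Omega>" and u0: "?u 0 \<noteq> 0" using a u by auto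
  have Uu: "((\<lambda>s. U (?x s) (?u s)) has_vector_derivative P a (U a u) u - U a (h u)) (at 0)"
    using has_vector_derivative_U[OF lx a0 lu] by (simp add: linear_neg[OF linear_U])
  have Uw: "((\<lambda>s. U (?x s) w) has_vector_derivative P a (U a u) w) (at 0)"
    using has_vector_derivative_U[OF lx a0 c] linear_0[OF linear_U] by simp
  have spray: "P a (U a u) u - U a (h u) = - 2 *\<^sub>R G a (U a u)"
    using spray_eq[OF a u] by simp
  have "((\<lambda>s. 2 *\<^sub>R \<Gamma> (?x s, U (?x s) (?u s)) (U (?x s) w)) has_vector_derivative
     2 *\<^sub>R (frechet_derivative (\<lambda>z. \<Gamma> z (U a w)) (at (a, U a u)) (U a u, - 2 *\<^sub>R G a (U a u))
       + \<Gamma> (a, U a u) (P a (U a u) w))) (at 0)"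
    using has_vector_derivative_\<Gamma>[OF lx a0 Uu _ Uw] U_nonzero[OF a u] spray
    by (intro bounded_linear.has_vector_derivative[OF bounded_linear_scaleR_right]) simp
  moreover have "((\<lambda>s. U (?x s) (dh (?u s) w) - P (?x s) (U (?x s) w) (?u s) - P (?x s) (U (?x s) (?u s)) w)
     has_vector_derivative
      P a (U a u) (dh u w) - U a (ddh u (h u) w)
      - (Q a (U a w) (U a u) u + P a (P a (U a u) w) u - P a (U a w) (h u))
      - (Q a (U a u) (U a u) w + P a (P a (U a u) u) w - P a (U a (h u)) w)) (at 0)"
  proof (intro has_vector_derivative_diff)
    show "((\<lambda>s. U (?x s) (dh (?u s) w)) has_vector_derivative
        P a (U a u) (dh u w) - U a (ddh u (h u) w)) (at 0)"
      using has_vector_derivative_U[OF lx a0 has_vector_derivative_dh[OF lu u0 c]] linear_0[OF linear_dh[OF u]]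
      by (simp add: linear_neg[OF linear_ddh[OF u]] linear_neg[OF linear_U])
    show "((\<lambda>s. P (?x s) (U (?x s) w) (?u s)) has_vector_derivative
        Q a (U a w) (U a u) u + P a (P a (U a u) w) u - P a (U a w) (h u)) (at 0)"
      using has_vector_derivative_P[OF lx a0 lu Uw] by (simp add: linear_neg[OF linear_P_right[OF a]])
    show "((\<lambda>s. P (?x s) (U (?x s) (?u s)) w) has_vector_derivative
        Q a (U a u) (U a u) w + P a (P a (U a u) u) w - P a (U a (h u)) w) (at 0)"
      using has_vector_derivative_P[OF lx a0 c Uu]
      by (simp add: linear_diff[OF linear_P[OF a]] linear_0[OF linear_P_right[OF a]] add_diff_eq)
  qed
  moreover have "\<forall>\<^sub>F s in nhds 0. 2 *\<^sub>R \<Gamma> (?x s, U (?x s) (?u s)) (U (?x s) w) =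
      U (?x s) (dh (?u s) w) - P (?x s) (U (?x s) w) (?u s) - P (?x s) (U (?x s) (?u s)) w"
  proof -
    have "\<forall>\<^sub>F s in nhds 0. ?x s \<in> \<Omega> \<and> ?u s \<in> - {0}"
      using eventually_line[of \<Omega> a "U a u"] eventually_line[of "- {0}" u "- h u"] a u
      by (intro eventually_conj) (auto simp: open_\<Omega> open_Compl)
    then show ?thesis by (rule eventually_mono) (intro double_\<Gamma>, auto)
  qed
  ultimately show ?thesis
    unfolding scaleR_add_right[symmetric] by (rule has_vector_derivative_unique_eventually)
qed

text \<open>The frame components are constant along the line, so the right side contributes only the
  derivative of \<open>U\<close>. This is the relation through which the second derivatives of the
  frame leave the curvature.\<close>

lemma bracket_derivative:
  assumes a: "a \<in> \<Omega>"
  shows "Q a (U a u) (U a u) w + P a (P a (U a u) u) w - (Q a (U a w) (U a u) u + P a (P a (U a u) w) u)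
    = P a (U a u) (B u w)"
proof -
  let ?x = "\<lambda>s::real. a + s *\<^sub>R U a u"
  have c: "((\<lambda>s. b) has_vector_derivative 0) (at 0)" for b :: 'v by simp
  have lx: "(?x has_vector_derivative U a u) (at 0)" by (rule has_vector_derivative_line)
  have a0: "?x 0 \<in> \<Omega>" using a by auto
  have Uv: "((\<lambda>s. U (?x s) v) has_vector_derivative P a (U a u) v) (at 0)" for v
    using has_vector_derivative_U[OF lx a0 c] linear_0[OF linear_U] by simp
  have PU: "((\<lambda>s. P (?x s) (U (?x s) v) w) has_vector_derivative
      Q a (U a v) (U a u) w + P a (P a (U a u) v) w) (at 0)" for v w
    using has_vector_derivative_P[OF lx a0 c Uv] by (simp add: linear_0[OF linear_P_right[OF a]])
  have "\<forall>\<^sub>F s in nhds 0. P (?x s) (U (?x s) u) w - P (?x s) (U (?x s) w) u = U (?x s) (B u w)"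
    using eventually_line[OF open_\<Omega> a] bracket_eq by (rule eventually_mono)
  then show ?thesis
    by (rule has_vector_derivative_unique_eventually[OF has_vector_derivative_diff[OF PU PU] Uv])
qed

text \<open>Write \<open>X\<close> for \<open>P a (U a u) w\<close>. The terms
  \<open>\<Gamma> X\<close> enter the left side with coefficients -2, 1 and 1 from its three
  summands and cancel. The remaining \<open>Q\<close> terms and the nested \<open>P\<close> terms
  combine to half of \<open>bracket_derivative\<close>.\<close>

theorem curvature_U:
  assumes a: "a \<in> \<Omega>" and u: "u \<noteq> 0"
  shows "2 *\<^sub>R DG (a, U a u) (U a w, 0)
      - frechet_derivative (\<lambda>z. \<Gamma> z (U a w)) (at (a, U a u)) (U a u, - 2 *\<^sub>R G a (U a u))
      - \<Gamma> (a, U a u) (\<Gamma> (a, U a u) (U a w))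
    = U a (dh u (B u w) + (1/2) *\<^sub>R (ddh u (h u) w - B (h u) w) - M u (M u w))" (is "?L = ?R")
proof -
  note U = linear_add[OF linear_U] linear_diff[OF linear_U] linear_scale[OF linear_U]
  note y = U_nonzero[OF a u]
  let ?b = "B u w"
  define X where "X = P a (U a u) w"
  have PUw: "P a (U a w) u = X - U a ?b"
    using bracket_eq[OF a, of u w] by (simp add: X_def algebra_simps)
  have 1: "2 *\<^sub>R DG (a, U a u) (U a w, 0) + 2 *\<^sub>R \<Gamma> (a, U a u) X
      - 2 *\<^sub>R (U a (M u ?b) - P a (U a u) ?b)
    = P a (U a w) (h u) - Q a (U a w) (U a u) u - P a X u + P a (U a ?b) u"
    \<comment> \<open>Here the derivatives of \<open>U\<close> are taken along \<open>U a u\<close>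
      and then \<open>U a w\<close>, in \<open>double_D\<Gamma>\<close> and
      \<open>bracket_derivative\<close> in the opposite order; \<open>Q_symmetric\<close> lets them
      match.\<close>
    using double_DG_left[OF a u, of "U a w"] Q_symmetric[OF a, of "U a u" "U a w" u]
    by (simp add: PUw linear_diff[OF linear_\<Gamma>[OF a y]] linear_diff[OF linear_P[OF a]] \<Gamma>_U[OF a u]
        scaleR_diff_right algebra_simps)
  have 2: "P a (U a ?b) u = P a (U a u) ?b - U a (B u ?b)"
    using bracket_eq[OF a, of u ?b] by (simp add: algebra_simps)
  have 3: "P a (U a (h u)) w = P a (U a w) (h u) + U a (B (h u) w)"
    using bracket_eq[OF a, of "h u" w] by (simp add: algebra_simps)
  have 4: "\<Gamma> (a, U a u) (\<Gamma> (a, U a u) (U a w))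
      = U a (M u (M u w)) - P a (U a u) (M u w) - \<Gamma> (a, U a u) X"
    by (simp add: \<Gamma>_U[OF a u] linear_diff[OF linear_\<Gamma>[OF a y]] X_def)
  have 5: "P a (U a u) (M u w) = (1/2) *\<^sub>R (P a (U a u) (dh u w) + P a (U a u) ?b)"
    by (simp add: M_def linear_add[OF linear_P_right[OF a]] linear_scale[OF linear_P_right[OF a]])
  have 6: "U a (M u ?b) = (1/2) *\<^sub>R (U a (dh u ?b) + U a (B u ?b))"
    by (simp add: M_def U)
  show ?thesis
  \<comment> \<open>All facts are now linear relations between the same finitely many vectors;
    taking a component turns the claim into linear real arithmetic.\<close>
  proof (rule euclidean_eqI)
    fix b :: 'v assume "b \<in> Basis"
    note I = arg_cong[where f = "\<lambda>z. z \<bullet> b"]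
    show "?L \<bullet> b = ?R \<bullet> b"
      using I[OF 1] I[OF 2] I[OF 3] I[OF 4] I[OF 5] I[OF 6] I[OF double_D\<Gamma>[OF a u, of w]]
        I[OF bracket_derivative[OF a, of u w]]
      unfolding X_def[symmetric] U inner_add_left inner_diff_left inner_scaleR_left
      by argo
  qed
qed

end

section \<open>Left translations in charts\<close>

lemma chart_inv_right:
  "inj_on (snd c) (fst c) \<Longrightarrow> p \<in> fst c \<Longrightarrow> chart_inv c (snd c p) = p"
  unfolding chart_inv_def by (rule the_inv_into_f_f)

lemma frechet_derivative_cong_open:
  assumes "open S" "x \<in> S" "\<And>z. z \<in> S \<Longrightarrow> f z = g z" "f differentiable at x"
  shows "frechet_derivative f (at x) = frechet_derivative g (at x)"
  using frechet_derivative_transform_within_open[OF assms(4,1,2)] assms(3) by blast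

locale lie_charts =
  fixes G :: "('g, 'b) monoid_scheme" (structure)
    and A :: "('g, 'e::euclidean_space) chart set"
  assumes lie: "lie_group G A"
begin

sublocale group G
  using lie by (simp add: lie_group_def)

lemma chart_inj: "c \<in> A \<Longrightarrow> inj_on (snd c) (fst c)"
  and chart_cover: "(\<Union>c\<in>A. fst c) = carrier G"
  using lie by (auto simp: lie_group_def smooth_manifold_def smooth_atlas_def)

lemma chart_subset: "c \<in> A \<Longrightarrow> p \<in> fst c \<Longrightarrow> p \<in> carrier G"
  using chart_cover by blast

lemma chart_exists: "p \<in> carrier G \<Longrightarrow> \<exists>c\<in>A. p \<in> fst c"
  using chart_cover by blast

lemma chart_inv_chart: "c \<in> A \<Longrightarrow> p \<in> fst c \<Longrightarrow> chart_inv c (snd c p) = p"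
  using chart_inv_right[OF chart_inj] .

lemma open_chart_image:
  assumes "c \<in> A" shows "open (snd c ` fst c)"
proof -
  have "open (snd c ` (fst c \<inter> fst c))"
    using lie assms unfolding lie_group_def smooth_manifold_def smooth_atlas_def by blast
  then show ?thesis by simp
qed

definition mult_dom :: "('g, 'e) chart \<Rightarrow> ('g, 'e) chart \<Rightarrow> ('g, 'e) chart \<Rightarrow> ('e \<times> 'e) set" where
  "mult_dom k c d = {(snd k g, snd c p) |g p. g \<in> fst k \<and> p \<in> fst c \<and> g \<otimes> p \<in> fst d}"

definition mult_rep :: "('g, 'e) chart \<Rightarrow> ('g, 'e) chart \<Rightarrow> ('g, 'e) chart \<Rightarrow> 'e \<times> 'e \<Rightarrow> 'e" where
  "mult_rep k c d = (\<lambda>(a, b). snd d (chart_inv k a \<otimes> chart_inv c b))"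

lemma mult_smooth:
  assumes k: "k \<in> A" and c: "c \<in> A" and d: "d \<in> A"
  shows "open (mult_dom k c d)" "smooth_on (mult_dom k c d) (mult_rep k c d)"
proof -
  let ?kc = "(fst k \<times> fst c, map_prod (snd k) (snd c))"
  let ?m = "\<lambda>(g, h). g \<otimes> h"
  have eq: "snd ?kc ` (fst ?kc \<inter> ?m -` fst d) = mult_dom k c d"
    unfolding mult_dom_def by (auto simp: image_iff)
  have kc: "?kc \<in> prod_atlas A A"
    using k c unfolding prod_atlas_def by blast
  have "\<forall>c\<in>prod_atlas A A. \<forall>d\<in>A. open (snd c ` (fst c \<inter> ?m -` fst d)) \<and>
      smooth_on (snd c ` (fst c \<inter> ?m -` fst d)) (\<lambda>a. snd d (?m (chart_inv c a)))"
    using lie unfolding lie_group_def smooth_map_def by (elim conjE)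
  from bspec[OF bspec[OF this kc] d]
  have op: "open (mult_dom k c d)"
    and sm: "smooth_on (mult_dom k c d) (\<lambda>a. snd d (?m (chart_inv ?kc a)))"
    unfolding eq by auto
  show "open (mult_dom k c d)" by (rule op)
  show "smooth_on (mult_dom k c d) (mult_rep k c d)"
  proof (rule smooth_on_cong[OF sm op])
    fix z assume "z \<in> mult_dom k c d"
    then obtain g p where z: "z = (snd k g, snd c p)" "g \<in> fst k" "p \<in> fst c"
      unfolding mult_dom_def by blast
    have "inj_on (snd ?kc) (fst ?kc)"
      using chart_inj[OF k] chart_inj[OF c] by (auto simp: inj_on_def)
    from chart_inv_right[OF this, of "(g, p)"] have "chart_inv ?kc z = (g, p)"
      using z by simp
    then show "snd d (?m (chart_inv ?kc z)) = mult_rep k c d z"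
      using z chart_inv_chart k c by (simp add: mult_rep_def)
  qed
qed

definition trans_dom :: "'g \<Rightarrow> ('g, 'e) chart \<Rightarrow> ('g, 'e) chart \<Rightarrow> 'e set" where
  "trans_dom g c d = {snd c p |p. p \<in> fst c \<and> g \<otimes> p \<in> fst d}"

text \<open>For \<open>g = \<one>\<close> this is the coordinate change from \<open>c\<close> to
  \<open>d\<close>, so everything proved about left translations also covers changes of
  chart.\<close>

definition trans_rep :: "'g \<Rightarrow> ('g, 'e) chart \<Rightarrow> ('g, 'e) chart \<Rightarrow> 'e \<Rightarrow> 'e" where
  "trans_rep g c d a = snd d (g \<otimes> chart_inv c a)"

lemma trans_domI: "p \<in> fst c \<Longrightarrow> g \<otimes> p \<in> fst d \<Longrightarrow> snd c p \<in> trans_dom g c d"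
  by (auto simp: trans_dom_def)

lemma trans_domE:
  assumes "a \<in> trans_dom g c d" "c \<in> A"
  obtains p where "p \<in> fst c" "g \<otimes> p \<in> fst d" "a = snd c p" "chart_inv c a = p"
  using assms chart_inv_chart by (auto simp: trans_dom_def)

text \<open>A left translation is the multiplication with its first argument frozen, so it is a
  slice of \<open>mult_rep\<close> in any chart around \<open>g\<close>.\<close>

lemma trans_rep_smooth:
  assumes g: "g \<in> carrier G" and c: "c \<in> A" and d: "d \<in> A"
  shows "open (trans_dom g c d)" "smooth_on (trans_dom g c d) (trans_rep g c d)"
proof -
  obtain k where k: "k \<in> A" "g \<in> fst k" using chart_exists[OF g] by blast
  have eq: "trans_dom g c d = Pair (snd k g) -` mult_dom k c d"
    using inj_onD[OF chart_inj[OF k(1)]] k(2) by (auto simp: trans_dom_def mult_dom_def; blast)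
  show op: "open (trans_dom g c d)"
    unfolding eq using mult_smooth(1)[OF k(1) c d] by (intro open_vimage continuous_intros)
  have "smooth_on (trans_dom g c d) (\<lambda>a. mult_rep k c d (snd k g, a))"
  proof (rule smooth_on_compose[OF mult_smooth(2)[OF k(1) c d]])
    show "smooth_on (trans_dom g c d) (Pair (snd k g))"
      using smooth_on_Pair[OF op smooth_on_const smooth_on_linear[OF bounded_linear_ident]] .
    show "Pair (snd k g) ` trans_dom g c d \<subseteq> mult_dom k c d" unfolding eq by blast
  qed (rule op)
  then show "smooth_on (trans_dom g c d) (trans_rep g c d)"
    by (simp add: mult_rep_def trans_rep_def[abs_def] chart_inv_chart[OF k])
qed

definition trans_deriv :: "'g \<Rightarrow> ('g, 'e) chart \<Rightarrow> ('g, 'e) chart \<Rightarrow> 'g \<Rightarrow> 'e \<Rightarrow> 'e" where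
  "trans_deriv g c d p = frechet_derivative (trans_rep g c d) (at (snd c p))"

lemma trans_rep_at: "c \<in> A \<Longrightarrow> p \<in> fst c \<Longrightarrow> trans_rep g c d (snd c p) = snd d (g \<otimes> p)"
  by (simp add: trans_rep_def chart_inv_chart)

lemma trans_rep_has_derivative:
  "g \<in> carrier G \<Longrightarrow> c \<in> A \<Longrightarrow> d \<in> A \<Longrightarrow> p \<in> fst c \<Longrightarrow> g \<otimes> p \<in> fst d \<Longrightarrow>
    (trans_rep g c d has_derivative trans_deriv g c d p) (at (snd c p))"
  unfolding trans_deriv_def by (rule smooth_on_has_derivative[OF trans_rep_smooth(2)]) (auto intro: trans_domI)

lemma linear_trans_deriv:
  "g \<in> carrier G \<Longrightarrow> c \<in> A \<Longrightarrow> d \<in> A \<Longrightarrow> p \<in> fst c \<Longrightarrow> g \<otimes> p \<in> fst d \<Longrightarrow> linear (trans_deriv g c d p)"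
  using trans_rep_has_derivative has_derivative_linear by blast

lemma trans_deriv_comp:
  assumes g: "g \<in> carrier G" "g' \<in> carrier G" and A: "c \<in> A" "d \<in> A" "f \<in> A"
    and p: "p \<in> fst c" "g \<otimes> p \<in> fst d" "g' \<otimes> (g \<otimes> p) \<in> fst f"
  shows "trans_deriv (g' \<otimes> g) c f p v = trans_deriv g' d f (g \<otimes> p) (trans_deriv g c d p v)"
proof -
  have pG: "p \<in> carrier G" using p A chart_subset by blast
  have D1: "(trans_rep g c d has_derivative trans_deriv g c d p) (at (snd c p))"
    using trans_rep_has_derivative g A p by blast
  have "(trans_rep g' d f has_derivative trans_deriv g' d f (g \<otimes> p)) (at (trans_rep g c d (snd c p)))"
    using trans_rep_has_derivative[of g' d f "g \<otimes> p"] g A p by (simp add: trans_rep_at)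
  from has_derivative_compose[OF D1 this]
  have D: "((\<lambda>a. trans_rep g' d f (trans_rep g c d a)) has_derivative
      (\<lambda>v. trans_deriv g' d f (g \<otimes> p) (trans_deriv g c d p v))) (at (snd c p))" .
  have "(trans_rep (g' \<otimes> g) c f has_derivative
      (\<lambda>v. trans_deriv g' d f (g \<otimes> p) (trans_deriv g c d p v))) (at (snd c p))"
  proof (rule has_derivative_transform_within_open[OF D])
    show "open (trans_dom g c d)" using trans_rep_smooth g A by blast
    show "snd c p \<in> trans_dom g c d" using p by (auto intro: trans_domI)
    fix a assume "a \<in> trans_dom g c d"
    then obtain q where q: "q \<in> fst c" "g \<otimes> q \<in> fst d" "a = snd c q"
      by (auto simp: trans_dom_def)
    then have "q \<in> carrier G" using A chart_subset by blast
    then show "trans_rep g' d f (trans_rep g c d a) = trans_rep (g' \<otimes> g) c f a"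
      using q A g by (simp add: trans_rep_at m_assoc)
  qed
  then show ?thesis unfolding trans_deriv_def by (rule frechet_derivative_eqI)
qed

lemma trans_deriv_one:
  assumes "c \<in> A" "p \<in> fst c" shows "trans_deriv \<one> c c p v = v"
proof -
  have "(trans_rep \<one> c c has_derivative (\<lambda>v. v)) (at (snd c p))"
  proof (rule has_derivative_transform_within_open[OF has_derivative_ident])
    show "open (snd c ` fst c)" using open_chart_image assms by blast
    fix a assume "a \<in> snd c ` fst c"
    then show "a = trans_rep \<one> c c a"
      using assms chart_subset[OF assms(1)] by (auto simp: trans_rep_at)
  qed (use assms in auto)
  then show ?thesis unfolding trans_deriv_def by (rule frechet_derivative_eqI)
qed

lemma trans_deriv_inverse:
  assumes g: "g \<in> carrier G" and A: "c \<in> A" "d \<in> A" and p: "p \<in> fst c" "g \<otimes> p \<in> fst d"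
  shows "trans_deriv (inv g) d c (g \<otimes> p) (trans_deriv g c d p v) = v"
proof -
  have pG: "p \<in> carrier G" using p A chart_subset by blast
  then have "inv g \<otimes> (g \<otimes> p) = p" using g by (simp flip: m_assoc)
  then show ?thesis
    using trans_deriv_comp[of g "inv g" c d c p v] trans_deriv_one[of c p v] g A p by simp
qed

lemma trans_deriv_one_comp:
  assumes g: "g \<in> carrier G" and A: "c \<in> A" "d \<in> A" "f \<in> A"
    and p: "p \<in> fst c" "p \<in> fst d" "g \<otimes> p \<in> fst f"
  shows "trans_deriv g d f p (trans_deriv \<one> c d p v) = trans_deriv g c f p v"
  using trans_deriv_comp[of \<one> g c d f p v] assms chart_subset[of c p] by simp

text \<open>The coordinate change in \<open>tangent_space\<close> and
  \<open>trans_rep \<one> c d\<close> are shown equal only on the overlap, where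
  \<open>chart_inv\<close> gives a group element; this suffices since the overlap is open.\<close>

lemma tangent_space_iff:
  "v \<in> tangent_space A p \<longleftrightarrow> (\<forall>c. c \<notin> charts_at A p \<longrightarrow> v c = 0) \<and>
    (\<forall>c\<in>charts_at A p. \<forall>d\<in>charts_at A p. v d = trans_deriv \<one> c d p (v c))"
proof -
  have "frechet_derivative (\<lambda>a. snd d (chart_inv c a)) (at (snd c p)) = trans_deriv \<one> c d p"
    if "c \<in> charts_at A p" "d \<in> charts_at A p" for c d
  proof -
    have cd: "c \<in> A" "d \<in> A" "p \<in> fst c" "p \<in> fst d" and pG: "p \<in> carrier G"
      using that chart_subset[of c p] by (auto simp: charts_at_def)
    have "trans_deriv \<one> c d p = frechet_derivative (\<lambda>a. snd d (chart_inv c a)) (at (snd c p))"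
      unfolding trans_deriv_def
    proof (rule frechet_derivative_cong_open)
      show "open (trans_dom \<one> c d)" using trans_rep_smooth cd by blast
      show "snd c p \<in> trans_dom \<one> c d" using cd pG by (auto intro: trans_domI)
      show "trans_rep \<one> c d differentiable at (snd c p)"
        using trans_rep_has_derivative[of \<one> c d p] cd pG by (auto simp: differentiable_def)
      show "trans_rep \<one> c d z = snd d (chart_inv c z)" if "z \<in> trans_dom \<one> c d" for z
        using that cd(1) chart_subset[OF cd(1)] by (auto elim!: trans_domE simp: trans_rep_def)
    qed
    then show ?thesis by simp
  qed
  then show ?thesis unfolding tangent_space_def by auto
qed

lemma tangent_space_chart:
  "v \<in> tangent_space A p \<Longrightarrow> c \<in> A \<Longrightarrow> d \<in> A \<Longrightarrow> p \<in> fst c \<Longrightarrow> p \<in> fst d \<Longrightarrow>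
    v d = trans_deriv \<one> c d p (v c)"
  unfolding tangent_space_iff charts_at_def by blast

lemma tangent_space_outside: "v \<in> tangent_space A p \<Longrightarrow> c \<notin> charts_at A p \<Longrightarrow> v c = 0"
  unfolding tangent_space_iff by blast

lemma tangent_space_eqI:
  assumes "v \<in> tangent_space A p" "w \<in> tangent_space A p" "c \<in> A" "p \<in> fst c" "v c = w c"
  shows "v = w"
proof
  fix d show "v d = w d"
  proof (cases "d \<in> charts_at A p")
    case True
    then have d: "d \<in> A" "p \<in> fst d" by (auto simp: charts_at_def)
    have "v d = trans_deriv \<one> c d p (v c)" "w d = trans_deriv \<one> c d p (w c)"
      by (rule tangent_space_chart[OF _ assms(3) d(1) assms(4) d(2)], rule assms)+
    then show ?thesis unfolding assms(5) by simp
  qed (simp add: assms(1,2)[THEN tangent_space_outside])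
qed

text \<open>Inverse of taking the coordinate vector in \<open>c\<close>. It describes the points
  returned by the inverse of a tangent bundle chart.\<close>

definition tvec_of :: "('g, 'e) chart \<Rightarrow> 'g \<Rightarrow> 'e \<Rightarrow> ('g, 'e) tvec" where
  "tvec_of c p x = (\<lambda>d. if d \<in> charts_at A p then trans_deriv \<one> c d p x else 0)"

lemma tvec_of_chart: "c \<in> A \<Longrightarrow> p \<in> fst c \<Longrightarrow> tvec_of c p x c = x"
  by (simp add: tvec_of_def charts_at_def trans_deriv_one)

lemma tvec_of_tangent: "c \<in> A \<Longrightarrow> p \<in> fst c \<Longrightarrow> tvec_of c p x \<in> tangent_space A p"
  unfolding tangent_space_iff tvec_of_def
  using trans_deriv_one_comp[of \<one>] chart_subset by (auto simp: charts_at_def)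

lemma tvec_of_self:
  "v \<in> tangent_space A p \<Longrightarrow> c \<in> A \<Longrightarrow> p \<in> fst c \<Longrightarrow> tvec_of c p (v c) = v"
  by (rule tangent_space_eqI[OF tvec_of_tangent]) (auto simp: tvec_of_chart)

lemma zero_tangent: "zero_tvec \<in> tangent_space A p"
  using linear_0[OF linear_trans_deriv, of \<one>] chart_subset
  unfolding tangent_space_iff zero_tvec_def charts_at_def by auto

lemma tvec_zero_iff:
  "v \<in> tangent_space A p \<Longrightarrow> c \<in> A \<Longrightarrow> p \<in> fst c \<Longrightarrow> v c = 0 \<longleftrightarrow> v = zero_tvec"
  using tangent_space_eqI[OF _ zero_tangent, of v p c] by (auto simp: zero_tvec_def)

text \<open>\<open>pushforward\<close> works in a chart picked by \<open>SOME\<close>. The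
  transformation rule of \<open>v\<close> and the chain rule make the result the same for every
  chart \<open>c\<close> at \<open>p\<close>.\<close>

lemma pushforward_translation:
  assumes g: "g \<in> carrier G" and v: "v \<in> tangent_space A p" and c: "c \<in> A" "p \<in> fst c"
  shows "pushforward A A (left_translation G g) p v =
    (\<lambda>d. if d \<in> charts_at A (g \<otimes> p) then trans_deriv g c d p (v c) else 0)"
proof
  fix d
  define k where "k = (SOME c. c \<in> charts_at A p)"
  have "k \<in> charts_at A p" unfolding k_def by (rule someI[of _ c]) (use c in \<open>simp add: charts_at_def\<close>)
  then have k: "k \<in> A" "p \<in> fst k" by (auto simp: charts_at_def)
  have "trans_deriv g k d p (v k) = trans_deriv g c d p (v c)" if "d \<in> charts_at A (g \<otimes> p)"
    using tangent_space_chart[OF v c(1) k(1) c(2) k(2)] trans_deriv_one_comp[OF g c(1) k(1) _ c(2) k(2)] that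
    by (auto simp: charts_at_def)
  then show "pushforward A A (left_translation G g) p v d =
      (if d \<in> charts_at A (g \<otimes> p) then trans_deriv g c d p (v c) else 0)"
    unfolding pushforward_def left_translation_def k_def[symmetric] Let_def trans_deriv_def trans_rep_def[abs_def]
    by simp
qed

lemma pushforward_tangent:
  assumes g: "g \<in> carrier G" and v: "v \<in> tangent_space A p" and p: "p \<in> carrier G"
  shows "pushforward A A (left_translation G g) p v \<in> tangent_space A (g \<otimes> p)"
proof -
  obtain c where c: "c \<in> A" "p \<in> fst c" using chart_exists[OF p] by blast
  show ?thesis
    unfolding pushforward_translation[OF g v c] tangent_space_iff
    using trans_deriv_comp[OF g one_closed c(1) _ _ c(2)] g p by (auto simp: charts_at_def)
qed

end

section \<open>The left invariant frame\<close>

locale lie_frame = lie_charts G A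
  for G :: "('g, 'b) monoid_scheme" (structure) and A :: "('g, real^'n::finite) chart set" +
  fixes e :: "'n \<Rightarrow> ('g, real^'n) tvec"
  assumes basis: "lie_algebra_basis G A e"
begin

text \<open>The isomorphism from \<open>real^'n\<close> onto the Lie algebra given by the basis.
  Calculus is carried over to \<open>real^'n\<close> through it, since the function type of tangent
  vectors is not a Euclidean space.\<close>

definition lin_comb :: "real^'n \<Rightarrow> ('g, real^'n) tvec" where
  "lin_comb u = (\<lambda>c. \<Sum>i\<in>UNIV. u $ i *\<^sub>R e i c)"

lemma linear_lin_comb: "linear (\<lambda>u. lin_comb u c)"
  unfolding lin_comb_def
  by (rule linearI) (simp_all add: scaleR_add_left sum.distrib scaleR_sum_right)

lemma bounded_linear_lin_comb: "bounded_linear (\<lambda>u. lin_comb u c)"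
  using linear_lin_comb by (rule linear_conv_bounded_linear[THEN iffD1])

lemma lin_comb_add: "lin_comb (u + v) = (\<lambda>c. lin_comb u c + lin_comb v c)"
  and lin_comb_scaleR: "lin_comb (r *\<^sub>R u) = (\<lambda>c. r *\<^sub>R lin_comb u c)"
  by (simp_all add: linear_add[OF linear_lin_comb] linear_scale[OF linear_lin_comb] fun_eq_iff)

lemma basis_tangent: "e i \<in> tangent_space A \<one>"
  using basis by (simp add: lie_algebra_basis_def lie_algebra_def)

lemma lin_comb_tangent: "lin_comb u \<in> tangent_space A \<one>"
  unfolding tangent_space_iff
proof (intro conjI allI impI ballI)
  fix c assume "c \<notin> charts_at A \<one>"
  then show "lin_comb u c = 0"
    using tangent_space_outside[OF basis_tangent] by (simp add: lin_comb_def)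
next
  fix c d assume "c \<in> charts_at A \<one>" "d \<in> charts_at A \<one>"
  then have cd: "c \<in> A" "d \<in> A" "\<one> \<in> fst c" "\<one> \<in> fst d" by (auto simp: charts_at_def)
  then have lin: "linear (trans_deriv \<one> c d \<one>)" by (intro linear_trans_deriv) auto
  show "lin_comb u d = trans_deriv \<one> c d \<one> (lin_comb u c)"
    using tangent_space_chart[OF basis_tangent cd]
    by (simp add: lin_comb_def linear_sum[OF lin] linear_scale[OF lin])
qed

lemma lin_comb_outside: "c \<notin> charts_at A \<one> \<Longrightarrow> lin_comb u c = 0"
  by (rule tangent_space_outside[OF lin_comb_tangent])

lemma lin_comb_unique: "v \<in> tangent_space A \<one> \<Longrightarrow> \<exists>!u. v = lin_comb u"
  using basis by (simp add: lie_algebra_basis_def lie_algebra_def lin_comb_def)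

lemma lin_comb_inject: "lin_comb u = lin_comb v \<longleftrightarrow> u = v"
  using lin_comb_unique[OF lin_comb_tangent[of u]] by auto

lemma lin_comb_inject_at: "c \<in> A \<Longrightarrow> \<one> \<in> fst c \<Longrightarrow> lin_comb u c = lin_comb v c \<longleftrightarrow> u = v"
  using lin_comb_inject[of u v] tangent_space_eqI[OF lin_comb_tangent[of u] lin_comb_tangent[of v], of c]
  by auto

definition base_chart :: "('g, real^'n) chart" where
  "base_chart = (SOME c. c \<in> charts_at A \<one>)"

lemma base_chart: "base_chart \<in> A" "\<one> \<in> fst base_chart"
proof -
  obtain c where "c \<in> A" "\<one> \<in> fst c" using chart_exists[OF one_closed] by blast
  then have "c \<in> charts_at A \<one>" by (simp add: charts_at_def)
  then have "base_chart \<in> charts_at A \<one>"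
    unfolding base_chart_def by (rule someI[of "\<lambda>c. c \<in> charts_at A \<one>"])
  then show "base_chart \<in> A" "\<one> \<in> fst base_chart" by (auto simp: charts_at_def)
qed

lemma left_invariant_field_chart:
  assumes "v \<in> tangent_space A \<one>" "c \<in> A" "p \<in> fst c" "k \<in> A" "\<one> \<in> fst k"
  shows "left_invariant_field G A v p c = trans_deriv p k c \<one> (v k)"
  using pushforward_translation[OF chart_subset assms(1,4,5)] assms chart_subset[of c p]
  by (simp add: left_invariant_field_def charts_at_def)

text \<open>The \<open>U(x) u\<close> of the overview, read in the chart \<open>c\<close>. It is
  linear in \<open>u\<close> at every \<open>a\<close>, even where \<open>chart_inv\<close> is
  unspecified.\<close>

definition frame_map :: "('g, real^'n) chart \<Rightarrow> real^'n \<Rightarrow> real^'n \<Rightarrow> real^'n" where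
  "frame_map c a u = (\<Sum>i\<in>UNIV. u $ i *\<^sub>R frame_field G A e i (chart_inv c a) c)"

lemma linear_frame_map: "linear (frame_map c a)"
  unfolding frame_map_def
  by (rule linearI) (simp_all add: scaleR_add_left sum.distrib scaleR_sum_right)

lemma frame_map_at:
  assumes c: "c \<in> A" "p \<in> fst c" and k: "k \<in> A" "\<one> \<in> fst k"
  shows "frame_map c (snd c p) u = trans_deriv p k c \<one> (lin_comb u k)"
proof -
  have "p \<in> carrier G" using c chart_subset by blast
  then have lin: "linear (trans_deriv p k c \<one>)" using c k by (intro linear_trans_deriv) auto
  show ?thesis
    using left_invariant_field_chart[OF basis_tangent c k]
    by (simp add: frame_map_def frame_field_def chart_inv_chart[OF c] lin_comb_def linear_sum[OF lin] linear_scale[OF lin])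
qed

lemma left_invariant_field_frame_map:
  "c \<in> A \<Longrightarrow> p \<in> fst c \<Longrightarrow> left_invariant_field G A (lin_comb u) p c = frame_map c (snd c p) u"
  using left_invariant_field_chart[OF lin_comb_tangent _ _ base_chart] frame_map_at[OF _ _ base_chart] by simp

lemma frame_map_one: "c \<in> A \<Longrightarrow> \<one> \<in> fst c \<Longrightarrow> frame_map c (snd c \<one>) u = lin_comb u c"
  by (simp add: frame_map_at[where k = c] trans_deriv_one)

text \<open>Translation by \<open>g \<otimes> p\<close> is translation by \<open>p\<close> followed
  by translation by \<open>g\<close>, so this is the chain rule at the unit.\<close>

lemma frame_map_equivariant:
  assumes "g \<in> carrier G" "c \<in> A" "d \<in> A" "p \<in> fst c" "g \<otimes> p \<in> fst d"
  shows "frame_map d (snd d (g \<otimes> p)) u = trans_deriv g c d p (frame_map c (snd c p) u)"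
  using trans_deriv_comp[of p g base_chart c d \<one> "lin_comb u base_chart"] assms base_chart chart_subset[of c p]
  by (simp add: frame_map_at[OF _ _ base_chart])

text \<open>Translating by \<open>inv p\<close> moves the claim to the unit, where the frame is the
  given basis.\<close>

lemma frame_map_inj:
  assumes "c \<in> A" "a \<in> snd c ` fst c" "frame_map c a u = 0"
  shows "u = 0"
proof -
  obtain p where p: "p \<in> fst c" "a = snd c p" using assms by blast
  have pG: "p \<in> carrier G" using p assms chart_subset by blast
  then have "frame_map base_chart (snd base_chart (inv p \<otimes> p)) u = trans_deriv (inv p) c base_chart p (frame_map c a u)"
    using frame_map_equivariant[of "inv p" c base_chart p u] p assms base_chart by simp
  also have "\<dots> = 0"
    using linear_0[OF linear_trans_deriv[of "inv p" c base_chart p]] pG p assms base_chart by simp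
  finally have "lin_comb u base_chart = lin_comb 0 base_chart"
    using pG frame_map_one[OF base_chart] linear_0[OF linear_lin_comb] by simp
  then show ?thesis using lin_comb_inject_at[OF base_chart] by blast
qed

lemma frame_map_inject:
  "c \<in> A \<Longrightarrow> a \<in> snd c ` fst c \<Longrightarrow> frame_map c a u = frame_map c a v \<longleftrightarrow> u = v"
  using frame_map_inj[of c a "u - v"] by (auto simp: linear_diff[OF linear_frame_map])

lemma frame_map_surj:
  assumes "c \<in> A" "a \<in> snd c ` fst c" shows "surj (frame_map c a)"
  using frame_map_inject[OF assms] by (intro linear_injective_imp_surjective linear_frame_map) (auto simp: inj_def)

text \<open>The differential of a translation at the unit is the partial derivative of the
  multiplication in its second argument. The multiplication is jointly smooth, so this derivative
  depends smoothly on the translating element.\<close>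

lemma frame_map_smooth:
  assumes c: "c \<in> A" shows "smooth_on (snd c ` fst c) (\<lambda>a. frame_map c a u)"
proof (rule smooth_on_cong)
  let ?k = base_chart
  let ?m = "mult_rep c ?k c" and ?b = "snd ?k \<one>"
  have dom: "(snd c p, ?b) \<in> mult_dom c ?k c" if "p \<in> fst c" for p
    unfolding mult_dom_def using that base_chart c chart_subset[of c p] by force
  show op: "open (snd c ` fst c)" by (rule open_chart_image[OF c])
  show "smooth_on (snd c ` fst c) (\<lambda>a. frechet_derivative ?m (at (a, ?b)) (0, lin_comb u ?k))"
    using dom
    by (intro smooth_on_frechet_derivative_apply[OF mult_smooth(2)[OF c base_chart(1) c]] op
        smooth_on_Pair smooth_on_const smooth_on_linear bounded_linear_ident) auto
  fix a assume "a \<in> snd c ` fst c"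
  then obtain p where p: "p \<in> fst c" "a = snd c p" by blast
  have "(?m has_derivative frechet_derivative ?m (at (a, ?b))) (at (a, ?b))"
    using dom p by (intro smooth_on_has_derivative[OF mult_smooth(2)[OF c base_chart(1) c]]) auto
  then have "((\<lambda>b. ?m (a, b)) has_derivative (\<lambda>v. frechet_derivative ?m (at (a, ?b)) (0, v))) (at ?b)"
    using has_derivative_compose[where f = "Pair a" and f' = "Pair 0" and x = ?b and s = UNIV and g = ?m]
      has_derivative_Pair[OF has_derivative_const has_derivative_ident] by blast
  moreover have "(\<lambda>b. ?m (a, b)) = trans_rep p ?k c"
    using p c by (simp add: mult_rep_def trans_rep_def fun_eq_iff chart_inv_chart)
  ultimately have "trans_deriv p ?k c \<one> v = frechet_derivative ?m (at (a, ?b)) (0, v)" for v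
    unfolding trans_deriv_def using frechet_derivative_eqI by fastforce
  then show "frechet_derivative ?m (at (a, ?b)) (0, lin_comb u ?k) = frame_map c a u"
    using frame_map_at[OF c p(1) base_chart] p by simp
qed

section \<open>Derivative of the frame and the Lie bracket in frame components\<close>

definition frame_deriv :: "('g, real^'n) chart \<Rightarrow> real^'n \<Rightarrow> real^'n \<Rightarrow> real^'n \<Rightarrow> real^'n" where
  "frame_deriv c a \<xi> u = frechet_derivative (\<lambda>a. frame_map c a u) (at a) \<xi>"

definition trans_deriv2 :: "'g \<Rightarrow> ('g, real^'n) chart \<Rightarrow> ('g, real^'n) chart \<Rightarrow> 'g \<Rightarrow>
    real^'n \<Rightarrow> real^'n \<Rightarrow> real^'n" where
  "trans_deriv2 g c d p \<xi> v =
    frechet_derivative (\<lambda>a. frechet_derivative (trans_rep g c d) (at a) v) (at (snd c p)) \<xi>"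

lemma trans_deriv2_symmetric:
  "g \<in> carrier G \<Longrightarrow> c \<in> A \<Longrightarrow> d \<in> A \<Longrightarrow> p \<in> fst c \<Longrightarrow> g \<otimes> p \<in> fst d \<Longrightarrow>
    trans_deriv2 g c d p \<xi> v = trans_deriv2 g c d p v \<xi>"
  unfolding trans_deriv2_def by (rule frechet_derivative_symmetric[OF trans_rep_smooth(2,1)]) (auto intro: trans_domI)

context
  fixes g c d p
  assumes g: "g \<in> carrier G" and c: "c \<in> A" and d: "d \<in> A" and p: "p \<in> fst c" "g \<otimes> p \<in> fst d"
begin

lemma has_vector_derivative_trans_deriv:
  assumes x: "(x has_vector_derivative x') (at t)" "x t = snd c p"
    and v: "(v has_vector_derivative v') (at t)"
  shows "((\<lambda>s. frechet_derivative (trans_rep g c d) (at (x s)) (v s)) has_vector_derivative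
    trans_deriv2 g c d p x' (v t) + trans_deriv g c d p v') (at t)"
  unfolding trans_deriv_def x(2)[symmetric]
proof (rule has_vector_derivative_linear_family[OF _ _ v])
  have p': "x t \<in> trans_dom g c d" using p x by (auto intro: trans_domI)
  show "((\<lambda>s. frechet_derivative (trans_rep g c d) (at (x s)) b) has_vector_derivative trans_deriv2 g c d p x' b) (at t)" for b
    unfolding trans_deriv2_def x(2)[symmetric]
    by (rule has_vector_derivative_frechet[where f = "\<lambda>a. frechet_derivative (trans_rep g c d) (at a) b",
          OF smooth_on_differentiable[OF smooth_on_frechet_derivative[OF trans_rep_smooth(2)]] x(1)])
      (use g c d p' in auto)
  have "\<forall>\<^sub>F s in nhds t. x s \<in> trans_dom g c d"
    by (rule eventually_curve_in_open[OF x(1) trans_rep_smooth(1)]) (use g c d p' in auto)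
  then show "\<forall>\<^sub>F s in nhds t. linear (frechet_derivative (trans_rep g c d) (at (x s)))"
    by (rule eventually_mono)
      (intro linear_frechet_derivative smooth_on_differentiable[OF trans_rep_smooth(2)] g c d)
qed

text \<open>Derivative of \<open>frame_map_equivariant\<close> along a line in the direction
  \<open>\<xi>\<close>. Since the differential of the translation itself varies, its second
  derivative appears; every later invariance statement has to dispose of this term.\<close>

lemma frame_deriv_equivariant:
  "frame_deriv d (snd d (g \<otimes> p)) (trans_deriv g c d p \<xi>) u =
    trans_deriv2 g c d p \<xi> (frame_map c (snd c p) u) + trans_deriv g c d p (frame_deriv c (snd c p) \<xi> u)"
proof -
  let ?x = "\<lambda>s::real. snd c p + s *\<^sub>R \<xi>"
  have x: "(?x has_vector_derivative \<xi>) (at 0)" by (rule has_vector_derivative_line)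
  have p': "snd c p \<in> trans_dom g c d" using p by (auto intro: trans_domI)
  have "(trans_rep g c d differentiable at (?x 0))"
    using trans_rep_has_derivative[OF g c d p] by (auto simp: differentiable_def)
  from has_vector_derivative_frechet[where x = ?x and t = 0, OF this x]
  have "((\<lambda>s. trans_rep g c d (?x s)) has_vector_derivative trans_deriv g c d p \<xi>) (at 0)"
    by (simp add: trans_deriv_def)
  moreover have "(\<lambda>a. frame_map d a u) differentiable at (trans_rep g c d (?x 0))"
    using smooth_on_differentiable[OF frame_map_smooth[OF d]] p c by (auto simp: trans_rep_at)
  ultimately have "((\<lambda>s. frame_map d (trans_rep g c d (?x s)) u) has_vector_derivative
      frame_deriv d (snd d (g \<otimes> p)) (trans_deriv g c d p \<xi>) u) (at 0)"
    using has_vector_derivative_frechet[where f = "\<lambda>a. frame_map d a u" and x = "\<lambda>s. trans_rep g c d (?x s)" and t = 0]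
      p c by (simp add: frame_deriv_def trans_rep_at)
  moreover have "((\<lambda>s. frechet_derivative (trans_rep g c d) (at (?x s)) (frame_map c (?x s) u)) has_vector_derivative
      trans_deriv2 g c d p \<xi> (frame_map c (snd c p) u) + trans_deriv g c d p (frame_deriv c (snd c p) \<xi> u)) (at 0)"
  proof -
    have "(\<lambda>a. frame_map c a u) differentiable at (?x 0)"
      using smooth_on_differentiable[OF frame_map_smooth[OF c]] p by auto
    from has_vector_derivative_frechet[where x = ?x and t = 0, OF this x]
    have "((\<lambda>s. frame_map c (?x s) u) has_vector_derivative frame_deriv c (snd c p) \<xi> u) (at 0)"
      by (simp add: frame_deriv_def)
    from has_vector_derivative_trans_deriv[OF x _ this] show ?thesis by simp
  qed
  moreover have "\<forall>\<^sub>F s in nhds 0. frame_map d (trans_rep g c d (?x s)) u =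
      frechet_derivative (trans_rep g c d) (at (?x s)) (frame_map c (?x s) u)"
    using eventually_line[OF trans_rep_smooth(1)[OF g c d] p']
  proof (rule eventually_mono)
    fix s assume "?x s \<in> trans_dom g c d"
    then obtain q where q: "q \<in> fst c" "g \<otimes> q \<in> fst d" "?x s = snd c q"
      by (auto simp: trans_dom_def)
    show "frame_map d (trans_rep g c d (?x s)) u = frechet_derivative (trans_rep g c d) (at (?x s)) (frame_map c (?x s) u)"
      unfolding q(3) trans_rep_at[OF c q(1)] using frame_map_equivariant[OF g c d q(1,2)] by (simp add: trans_deriv_def)
  qed
  ultimately show ?thesis by (rule has_vector_derivative_unique_eventually)
qed

end

lemma linear_frame_deriv: "c \<in> A \<Longrightarrow> a \<in> snd c ` fst c \<Longrightarrow> linear (\<lambda>\<xi>. frame_deriv c a \<xi> u)"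
  unfolding frame_deriv_def by (rule linear_frechet_derivative[OF smooth_on_differentiable[OF frame_map_smooth]])

lemma frame_deriv_sum:
  assumes "c \<in> A" "a \<in> snd c ` fst c"
  shows "frame_deriv c a \<xi> u = (\<Sum>i\<in>UNIV. u $ i *\<^sub>R frame_deriv c a \<xi> (axis i 1))"
proof -
  have "((\<lambda>a. \<Sum>i\<in>UNIV. u $ i *\<^sub>R frame_map c a (axis i 1)) has_derivative
      (\<lambda>\<xi>. \<Sum>i\<in>UNIV. u $ i *\<^sub>R frame_deriv c a \<xi> (axis i 1))) (at a)"
    unfolding frame_deriv_def
    by (intro has_derivative_sum has_derivative_scaleR_right smooth_on_has_derivative[OF frame_map_smooth] assms)
  moreover have "(\<Sum>i\<in>UNIV. u $ i *\<^sub>R frame_map c a (axis i 1)) = frame_map c a u" for a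
    using linear_sum[OF linear_frame_map, of c a "\<lambda>i. u $ i *\<^sub>R axis i 1" UNIV]
    by (simp add: linear_scale[OF linear_frame_map] basis_expansion[of u, unfolded scalar_mult_eq_scaleR])
  ultimately show ?thesis
    using frechet_derivative_eqI[of "\<lambda>a. frame_map c a u"] by (fastforce simp: frame_deriv_def)
qed

lemma linear_frame_deriv_right:
  assumes "c \<in> A" "a \<in> snd c ` fst c" shows "linear (frame_deriv c a \<xi>)"
proof -
  have "linear (\<lambda>u. \<Sum>i\<in>UNIV. u $ i *\<^sub>R frame_deriv c a \<xi> (axis i 1))"
    by (rule linearI) (simp_all add: scaleR_add_left sum.distrib scaleR_sum_right)
  then show ?thesis by (simp flip: frame_deriv_sum[OF assms])
qed

lemma frame_deriv_eq:
  assumes "c \<in> A" "a \<in> snd c ` fst c"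
  shows "frame_deriv c a \<xi> u = (\<Sum>i\<in>UNIV. u $ i *\<^sub>R
    frechet_derivative (\<lambda>a. frame_field G A e i (chart_inv c a) c) (at a) \<xi>)"
proof -
  have "frame_map c a (axis i 1) = frame_field G A e i (chart_inv c a) c" for a i
    by (simp add: frame_map_def axis_def if_distrib[of "\<lambda>r. r *\<^sub>R _"] cong: if_cong)
  then show ?thesis by (subst frame_deriv_sum[OF assms]) (simp add: frame_deriv_def)
qed

text \<open>The structure constants of the Lie algebra, read off at the unit in one fixed
  chart.\<close>

definition bracket :: "real^'n \<Rightarrow> real^'n \<Rightarrow> real^'n" where
  "bracket u v = (let a = snd base_chart \<one> in inv_into UNIV (frame_map base_chart a)
    (frame_deriv base_chart a (frame_map base_chart a u) v - frame_deriv base_chart a (frame_map base_chart a v) u))"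

text \<open>Carried from the unit to \<open>p\<close> by left translation: the second derivative
  terms of \<open>frame_deriv_equivariant\<close> are symmetric in the two frame vectors and drop
  out of the difference.\<close>

lemma bracket_frame_map:
  assumes c: "c \<in> A" "a \<in> snd c ` fst c"
  shows "frame_deriv c a (frame_map c a u) v - frame_deriv c a (frame_map c a v) u = frame_map c a (bracket u v)"
proof -
  obtain p where p: "p \<in> fst c" "a = snd c p" using c by blast
  let ?k = base_chart and ?b = "snd base_chart \<one>"
  have pG: "p \<in> carrier G" using p c chart_subset by blast
  have p1: "p \<otimes> \<one> \<in> fst c" using p pG by simp
  have b: "?b \<in> snd ?k ` fst ?k" using base_chart by blast
  note F = frame_map_equivariant[OF pG base_chart(1) c(1) base_chart(2) p1]
  note dF = frame_deriv_equivariant[OF pG base_chart(1) c(1) base_chart(2) p1]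
  have lin: "linear (trans_deriv p ?k c \<one>)" using pG base_chart c p1 by (intro linear_trans_deriv) auto
  have "frame_map ?k ?b (bracket u v) = frame_deriv ?k ?b (frame_map ?k ?b u) v - frame_deriv ?k ?b (frame_map ?k ?b v) u"
    unfolding bracket_def Let_def by (rule surj_f_inv_f[OF frame_map_surj[OF base_chart(1) b]])
  then have "frame_map c a (bracket u v) =
      trans_deriv p ?k c \<one> (frame_deriv ?k ?b (frame_map ?k ?b u) v) - trans_deriv p ?k c \<one> (frame_deriv ?k ?b (frame_map ?k ?b v) u)"
    using F pG p by (simp add: linear_diff[OF lin])
  also have "\<dots> = frame_deriv c a (frame_map c a u) v - frame_deriv c a (frame_map c a v) u"
    using dF[of "frame_map ?k ?b u" v] dF[of "frame_map ?k ?b v" u] F[of u] F[of v] pG p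
      trans_deriv2_symmetric[OF pG base_chart(1) c(1) base_chart(2) p1, of "frame_map ?k ?b u" "frame_map ?k ?b v"]
    by simp
  finally show ?thesis by simp
qed

lemma bilinear_bracket: "bounded_bilinear bracket"
proof -
  let ?k = base_chart and ?b = "snd base_chart \<one>"
  have b: "?b \<in> snd ?k ` fst ?k" using base_chart by blast
  note lin = linear_add[OF linear_frame_deriv[OF base_chart(1) b]] linear_add[OF linear_frame_deriv_right[OF base_chart(1) b]]
     linear_scale[OF linear_frame_deriv[OF base_chart(1) b]] linear_scale[OF linear_frame_deriv_right[OF base_chart(1) b]]
     linear_add[OF linear_frame_map] linear_scale[OF linear_frame_map]
  note eqI = frame_map_inject[OF base_chart(1) b, THEN iffD1]
  have "bilinear bracket"
    unfolding bilinear_def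
    by (intro conjI allI linearI; rule eqI; simp add: lin algebra_simps flip: bracket_frame_map[OF base_chart(1) b])
  then show ?thesis by (rule bilinear_conv_bounded_bilinear[THEN iffD1])
qed

lemma lie_bracket_lin_comb: "lie_bracket G A (lin_comb u) (lin_comb v) = lin_comb (bracket u v)"
proof
  fix c
  show "lie_bracket G A (lin_comb u) (lin_comb v) c = lin_comb (bracket u v) c"
  proof (cases "c \<in> charts_at A \<one>")
    case True
    then have c: "c \<in> A" "\<one> \<in> fst c" by (auto simp: charts_at_def)
    then have c1: "snd c \<one> \<in> snd c ` fst c" by blast
    have eq: "frechet_derivative (\<lambda>a. left_invariant_field G A (lin_comb v) (chart_inv c a) c) (at (snd c \<one>))
      = frechet_derivative (\<lambda>a. frame_map c a v) (at (snd c \<one>))" for v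
    proof (rule frechet_derivative_cong_open[symmetric, OF open_chart_image[OF c(1)] c1])
      show "(\<lambda>a. frame_map c a v) differentiable at (snd c \<one>)"
        by (rule smooth_on_differentiable[OF frame_map_smooth[OF c(1)] c1])
      show "frame_map c a v = left_invariant_field G A (lin_comb v) (chart_inv c a) c" if "a \<in> snd c ` fst c" for a
        using that left_invariant_field_frame_map[OF c(1)] by (auto simp: chart_inv_chart[OF c(1)])
    qed
    show ?thesis
      using True bracket_frame_map[OF c(1) c1] frame_map_one[OF c]
      by (simp add: lie_bracket_def vf_bracket_def eq left_invariant_field_frame_map[OF c] frame_deriv_def)
  next
    case False
    then show ?thesis by (simp add: lin_comb_outside lie_bracket_def vf_bracket_def)
  qed
qed

end

section \<open>Left invariant sprays in the frame\<close>

context lie_charts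
begin

section \<open>Charts of the tangent bundle\<close>

lemma tangent_chart_simps:
  "fst (tangent_chart A c) = {(p, v). p \<in> fst c \<and> v \<in> tangent_space A p}"
  "snd (tangent_chart A c) = (\<lambda>(p, v). (snd c p, v c))"
  by (simp_all add: tangent_chart_def)

lemma tangent_chart_inv:
  assumes c: "c \<in> A" "p \<in> fst c"
  shows "chart_inv (tangent_chart A c) (snd c p, x) = (p, tvec_of c p x)"
proof -
  have "inj_on (snd (tangent_chart A c)) (fst (tangent_chart A c))"
  proof (rule inj_onI, clarsimp simp: tangent_chart_simps)
    fix p q v w
    assume *: "p \<in> fst c" "v \<in> tangent_space A p" "q \<in> fst c" "w \<in> tangent_space A q"
      "snd c p = snd c q" "v c = w c"
    then have "p = q" using inj_onD[OF chart_inj[OF c(1)]] by blast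
    with * show "p = q \<and> v = w" using tangent_space_eqI[OF _ _ c(1)] by blast
  qed
  from chart_inv_right[OF this, of "(p, tvec_of c p x)"] show ?thesis
    using c by (simp add: tangent_chart_simps tvec_of_tangent tvec_of_chart)
qed

lemma slit_iff: "(p, v) \<in> slit_tangent_bundle A \<longleftrightarrow>
    p \<in> carrier G \<and> v \<in> tangent_space A p \<and> v \<noteq> zero_tvec"
  using chart_cover by (auto simp: slit_tangent_bundle_def tangent_bundle_def)

lemma tangent_chart_slit_image:
  assumes c: "c \<in> A"
  shows "snd (tangent_chart A c) ` (fst (tangent_chart A c) \<inter> slit_tangent_bundle A)
    = (snd c ` fst c) \<times> - {0}" (is "?L = ?R")
proof (intro equalityI subsetI)
  fix z assume "z \<in> ?L"
  then show "z \<in> ?R"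
    using tvec_zero_iff[OF _ c] by (auto simp: tangent_chart_simps slit_iff)
next
  fix z assume "z \<in> ?R"
  then obtain p y where p: "p \<in> fst c" "y \<noteq> 0" "z = (snd c p, y)" by auto
  then have "(p, tvec_of c p y) \<in> fst (tangent_chart A c) \<inter> slit_tangent_bundle A"
    using tvec_zero_iff[OF tvec_of_tangent[OF c] c] tvec_of_tangent[OF c] tvec_of_chart[OF c]
      chart_subset[OF c]
    by (auto simp: tangent_chart_simps slit_iff)
  moreover have "z = snd (tangent_chart A c) (p, tvec_of c p y)"
    using p by (simp add: tangent_chart_simps tvec_of_chart[OF c])
  ultimately show "z \<in> ?L" by blast
qed

lemma charts_at_tangent_atlas:
  "v \<in> tangent_space A p \<Longrightarrow> charts_at (tangent_atlas A) (p, v) = tangent_chart A ` charts_at A p"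
  by (auto simp: charts_at_def tangent_atlas_def tangent_chart_simps)

lemma charts_at_tangent_atlasE:
  assumes "D \<in> charts_at (tangent_atlas A) (p, v)" "v \<in> tangent_space A p"
  obtains c where "c \<in> A" "p \<in> fst c" "D = tangent_chart A c"
  using assms(1) unfolding charts_at_tangent_atlas[OF assms(2)] by (force simp: charts_at_def)

lemma tangent_chart_at:
  "v \<in> tangent_space A p \<Longrightarrow> c \<in> A \<Longrightarrow> p \<in> fst c \<Longrightarrow>
    tangent_chart A c \<in> charts_at (tangent_atlas A) (p, v)"
  by (simp add: charts_at_def tangent_atlas_def tangent_chart_simps)

lemma tangent_lift_chart:
  assumes "v \<in> tangent_space A p" "c \<in> A" "p \<in> fst c"
  shows "tangent_lift A (p, v) f (tangent_chart A c) = f c"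
proof -
  have "tangent_chart A c \<in> charts_at (tangent_atlas A) (p, v)"
    using assms by (rule tangent_chart_at)
  moreover have "inv_into A (tangent_chart A) (tangent_chart A c) = c"
    by (rule inv_into_f_f[OF inj_on_subset[OF inj_tangent_chart] assms(2)]) simp
  ultimately show ?thesis by (simp add: tangent_lift_def)
qed

end

context lie_frame
begin

text \<open>The tangent map sends \<open>(x, v)\<close> to \<open>(L x, DL(x) v)\<close>, and this
  is its derivative. \<open>\<Phi>\<close> is only required to agree with it on the chart overlap,
  so that it can be instantiated both with a coordinate change of the tangent bundle and with a
  translated chart.\<close>

lemma frechet_derivative_tangent_map:
  assumes g: "g \<in> carrier G" and c: "c \<in> A" and d: "d \<in> A" and p: "p \<in> fst c" "g \<otimes> p \<in> fst d"
    and \<Phi>: "\<And>q v. q \<in> fst c \<Longrightarrow> g \<otimes> q \<in> fst d \<Longrightarrow> \<Phi> (snd c q, v) = (snd d (g \<otimes> q), trans_deriv g c d q v)"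
  shows "frechet_derivative \<Phi> (at (snd c p, v)) (\<xi>, \<zeta>) =
    (trans_deriv g c d p \<xi>, trans_deriv2 g c d p \<xi> v + trans_deriv g c d p \<zeta>)"
proof -
  let ?\<Psi> = "\<lambda>z. (trans_rep g c d (fst z), frechet_derivative (trans_rep g c d) (at (fst z)) (snd z))"
  let ?D = "trans_dom g c d \<times> (UNIV :: (real^'n) set)"
  have p': "snd c p \<in> trans_dom g c d" using p by (auto intro: trans_domI)
  have op: "open ?D" by (intro open_Times trans_rep_smooth[OF g c d] open_UNIV)
  have "smooth_on ?D ?\<Psi>"
    by (intro smooth_on_Pair op smooth_on_compose[OF trans_rep_smooth(2)[OF g c d]]
        smooth_on_frechet_derivative_apply[OF trans_rep_smooth(2)[OF g c d]]
        smooth_on_linear bounded_linear_fst bounded_linear_snd) auto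
  then have diff: "?\<Psi> differentiable at (snd c p, v)"
    using smooth_on_differentiable p' by blast
  have "frechet_derivative ?\<Psi> (at (snd c p, v)) = frechet_derivative \<Phi> (at (snd c p, v))"
  proof (rule frechet_derivative_cong_open[OF op _ _ diff])
    show "?\<Psi> z = \<Phi> z" if z: "z \<in> ?D" for z
    proof -
      obtain q where "q \<in> fst c" "g \<otimes> q \<in> fst d" "fst z = snd c q" using z by (auto simp: trans_dom_def)
      then show ?thesis using \<Phi>[of q "snd z"] by (cases z) (simp add: trans_rep_at[OF c] trans_deriv_def)
    qed
  qed (use p' in simp)
  moreover have "frechet_derivative ?\<Psi> (at (snd c p, v)) (\<xi>, \<zeta>) =
      (trans_deriv g c d p \<xi>, trans_deriv2 g c d p \<xi> v + trans_deriv g c d p \<zeta>)"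
  proof -
    let ?x = "\<lambda>s::real. snd c p + s *\<^sub>R \<xi>" and ?v = "\<lambda>s::real. v + s *\<^sub>R \<zeta>"
    have x: "(?x has_vector_derivative \<xi>) (at 0)" and v: "(?v has_vector_derivative \<zeta>) (at 0)"
      by (rule has_vector_derivative_line)+
    have "((\<lambda>s. ?\<Psi> (?x s, ?v s)) has_vector_derivative
        frechet_derivative ?\<Psi> (at (snd c p, v)) (\<xi>, \<zeta>)) (at 0)"
      using has_vector_derivative_frechet[where f = ?\<Psi> and x = "\<lambda>s. (?x s, ?v s)" and t = 0,
          OF _ has_vector_derivative_Pair[OF x v]] diff by simp
    moreover have "((\<lambda>s. ?\<Psi> (?x s, ?v s)) has_vector_derivative
        (trans_deriv g c d p \<xi>, trans_deriv2 g c d p \<xi> v + trans_deriv g c d p \<zeta>)) (at 0)"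
    proof -
      have "trans_rep g c d differentiable at (?x 0)"
        using trans_rep_has_derivative[OF g c d p] by (auto simp: differentiable_def)
      from has_vector_derivative_frechet[where x = ?x and t = 0, OF this x]
      have 1: "((\<lambda>s. trans_rep g c d (?x s)) has_vector_derivative trans_deriv g c d p \<xi>) (at 0)"
        by (simp add: trans_deriv_def)
      have 2: "((\<lambda>s. frechet_derivative (trans_rep g c d) (at (?x s)) (?v s)) has_vector_derivative
          trans_deriv2 g c d p \<xi> v + trans_deriv g c d p \<zeta>) (at 0)"
        using has_vector_derivative_trans_deriv[OF g c d p x _ v] by simp
      show ?thesis using has_vector_derivative_Pair[OF 1 2] by simp
    qed
    ultimately show ?thesis by (rule vector_derivative_unique_at)
  qed
  ultimately show ?thesis by simp
qed

end

locale lie_spray = lie_frame G A e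
  for G :: "('g, 'b) monoid_scheme" (structure) and A :: "('g, real^'n::finite) chart set"
    and e :: "'n \<Rightarrow> ('g, real^'n) tvec" +
  fixes S :: "'g \<times> ('g, real^'n) tvec \<Rightarrow>
              ('g \<times> ('g, real^'n) tvec, (real^'n) \<times> (real^'n)) tvec"
  assumes spray: "left_invariant_spray G A S"
begin

abbreviation coeff :: "('g, real^'n) chart \<Rightarrow> real^'n \<Rightarrow> real^'n \<Rightarrow> real^'n" where
  "coeff \<equiv> spray_coeff A S"

section \<open>Spray coefficients under translations and chart changes\<close>

lemma spray_chart:
  assumes c: "c \<in> A" "p \<in> fst c" and v: "v \<in> tangent_space A p" "v \<noteq> zero_tvec"
  shows "S (p, v) (tangent_chart A c) = (v c, - 2 *\<^sub>R coeff c (snd c p) (v c))"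
proof -
  have "v c \<noteq> 0" using tvec_zero_iff[OF v(1) c] v(2) by simp
  moreover have "chart_inv (tangent_chart A c) (snd c p, v c) = (p, v)"
    using tangent_chart_inv[OF c] tvec_of_self[OF v(1) c] by simp
  ultimately show ?thesis
    using spray c unfolding left_invariant_spray_def spray_structure_def by (metis imageI)
qed

lemma spray_tangent:
  "v \<in> tangent_space A p \<Longrightarrow> p \<in> carrier G \<Longrightarrow> v \<noteq> zero_tvec \<Longrightarrow>
    S (p, v) \<in> tangent_space (tangent_atlas A) (p, v)"
  using spray slit_iff
  unfolding left_invariant_spray_def spray_structure_def smooth_vector_field_def by blast

lemma coeff_smooth:
  assumes c: "c \<in> A"
  shows "smooth_on ((snd c ` fst c) \<times> - {0}) (\<lambda>z. coeff c (fst z) (snd z))"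
proof -
  let ?D = "(snd c ` fst c) \<times> - {0::real^'n}" and ?C = "tangent_chart A c"
  have op: "open ?D" by (intro open_Times open_chart_image[OF c] open_Compl) simp
  have "smooth_vector_field (tangent_atlas A) (slit_tangent_bundle A) S"
    using spray unfolding left_invariant_spray_def spray_structure_def by blast
  then have "smooth_on (snd ?C ` (fst ?C \<inter> slit_tangent_bundle A)) (\<lambda>a. S (chart_inv ?C a) ?C)"
    using c unfolding smooth_vector_field_def tangent_atlas_def by blast
  then have "smooth_on ?D (\<lambda>a. S (chart_inv ?C a) ?C)"
    by (simp add: tangent_chart_slit_image[OF c])
  then have "smooth_on ?D (\<lambda>a. (- (1/2)) *\<^sub>R snd (S (chart_inv ?C a) ?C))"
    by (intro smooth_on_cmul smooth_on_bounded_linear[OF bounded_linear_snd] op)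
  then show ?thesis by (simp add: spray_coeff_def)
qed

text \<open>The fibre part of the transformation law of the spray as a tangent vector of the tangent
  bundle; the spray coefficients pick up a second derivative of the translation.\<close>

definition coeff_rule :: "'g \<Rightarrow> ('g, real^'n) chart \<Rightarrow> ('g, real^'n) chart \<Rightarrow> 'g \<Rightarrow> real^'n \<Rightarrow> bool" where
  "coeff_rule g c d p y \<longleftrightarrow> - 2 *\<^sub>R coeff d (snd d (g \<otimes> p)) (trans_deriv g c d p y) =
    trans_deriv2 g c d p y y + trans_deriv g c d p (- 2 *\<^sub>R coeff c (snd c p) y)"

lemma coeff_rule_one:
  assumes c: "c \<in> A" "p \<in> fst c" and d: "d \<in> A" "p \<in> fst d" and v: "v \<in> tangent_space A p" "v \<noteq> zero_tvec"
  shows "coeff_rule \<one> c d p (v c)"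
proof -
  have pG: "p \<in> carrier G" using c chart_subset by blast
  let ?\<Phi> = "\<lambda>z. snd (tangent_chart A d) (chart_inv (tangent_chart A c) z)"
  have "S (p, v) (tangent_chart A d) =
      frechet_derivative ?\<Phi> (at (snd (tangent_chart A c) (p, v))) (S (p, v) (tangent_chart A c))"
  proof -
    have "\<forall>C\<in>charts_at (tangent_atlas A) (p, v). \<forall>D\<in>charts_at (tangent_atlas A) (p, v). S (p, v) D =
        frechet_derivative (\<lambda>a. snd D (chart_inv C a)) (at (snd C (p, v))) (S (p, v) C)"
      using spray_tangent[OF v(1) pG v(2)] unfolding tangent_space_def by blast
    from bspec[OF bspec[OF this tangent_chart_at[OF v(1) c]] tangent_chart_at[OF v(1) d]]
    show ?thesis .
  qed
  also have "\<dots> = (trans_deriv \<one> c d p (v c),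
      trans_deriv2 \<one> c d p (v c) (v c) + trans_deriv \<one> c d p (- 2 *\<^sub>R coeff c (snd c p) (v c)))"
    unfolding spray_chart[OF c v] using frechet_derivative_tangent_map[OF one_closed c(1) d(1) c(2), of ?\<Phi>] pG d
      tangent_chart_inv[OF c(1)] chart_subset[OF c(1)]
    by (simp add: tangent_chart_simps tvec_of_def charts_at_def)
  finally show ?thesis
    using tangent_space_chart[OF v(1) c(1) d(1) c(2) d(2)] pG
    unfolding spray_chart[OF d v] coeff_rule_def by simp
qed

text \<open>The chart \<open>c\<close> is the one which \<open>pushforward\<close> selects on the tangent bundle.\<close>

lemma coeff_rule_translation:
  assumes g: "g \<in> carrier G" and p: "p \<in> carrier G" and d: "d \<in> A" "g \<otimes> p \<in> fst d"
    and v: "v \<in> tangent_space A p" "v \<noteq> zero_tvec"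
  shows "\<exists>c\<in>A. p \<in> fst c \<and> coeff_rule g c d p (v c)"
proof -
  let ?F = "tangent_map A A (left_translation G g)" and ?w = "pushforward A A (left_translation G g) p v"
  define k where "k = (SOME k. k \<in> charts_at (tangent_atlas A) (p, v))"
  obtain c' where "c' \<in> A" "p \<in> fst c'" using chart_exists[OF p] by blast
  then have "tangent_chart A c' \<in> charts_at (tangent_atlas A) (p, v)"
    by (rule tangent_chart_at[OF v(1)])
  then have "k \<in> charts_at (tangent_atlas A) (p, v)"
    unfolding k_def by (rule someI[of "\<lambda>k. k \<in> charts_at (tangent_atlas A) (p, v)"])
  then obtain c where k: "k = tangent_chart A c" and c: "c \<in> A" "p \<in> fst c"
    by (rule charts_at_tangent_atlasE[OF _ v(1)])
  have F: "?F (q, x) = (g \<otimes> q, pushforward A A (left_translation G g) q x)" for q x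
    by (simp add: tangent_map_def left_translation_def)
  have wT: "?w \<in> tangent_space A (g \<otimes> p)" by (rule pushforward_tangent[OF g v(1) p])
  have wd: "?w d = trans_deriv g c d p (v c)"
    using d by (simp add: pushforward_translation[OF g v(1) c] charts_at_def)
  \<comment> \<open>\<open>spray_chart\<close> speaks of nonzero vectors only. The translated vector
    is nonzero because the inverse translation recovers \<open>v c\<close> from it.\<close>
  have "v c \<noteq> 0" using tvec_zero_iff[OF v(1) c] v(2) by simp
  then have "?w d \<noteq> 0"
    using trans_deriv_inverse[OF g c(1) d(1) c(2) d(2), of "v c"]
      linear_0[OF linear_trans_deriv[of "inv g" d c "g \<otimes> p"]] g p c d
    unfolding wd by (metis inv_closed inv_solve_left m_closed)
  then have w0: "?w \<noteq> zero_tvec" by (auto simp: zero_tvec_def)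
  let ?\<Phi> = "\<lambda>z. snd (tangent_chart A d) (?F (chart_inv k z))"
  have eq: "pushforward (tangent_atlas A) (tangent_atlas A) ?F (p, v) (S (p, v)) = S (?F (p, v))"
    using spray g v p slit_iff unfolding left_invariant_spray_def Let_def by blast
  have dF: "tangent_chart A d \<in> charts_at (tangent_atlas A) (?F (p, v))"
    unfolding F by (rule tangent_chart_at[OF wT d])
  have "S (g \<otimes> p, ?w) (tangent_chart A d) = S (?F (p, v)) (tangent_chart A d)" by (simp only: F)
  also have "\<dots> = frechet_derivative ?\<Phi> (at (snd k (p, v))) (S (p, v) k)"
    unfolding eq[symmetric] pushforward_def[of "tangent_atlas A"] k_def[symmetric] Let_def
    by (simp only: dF if_True)
  also have "\<dots> = (trans_deriv g c d p (v c),
      trans_deriv2 g c d p (v c) (v c) + trans_deriv g c d p (- 2 *\<^sub>R coeff c (snd c p) (v c)))"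
  proof -
    have "?\<Phi> (snd c q, x) = (snd d (g \<otimes> q), trans_deriv g c d q x)" if "q \<in> fst c" "g \<otimes> q \<in> fst d" for q x
      using that c d pushforward_translation[OF g tvec_of_tangent c(1)]
      by (simp add: k tangent_chart_inv F tangent_chart_simps charts_at_def tvec_of_chart)
    from frechet_derivative_tangent_map[OF g c(1) d(1) c(2) d(2), of ?\<Phi>, OF this]
    show ?thesis unfolding k spray_chart[OF c v] by (simp add: tangent_chart_simps)
  qed
  finally show ?thesis
    using c wd unfolding spray_chart[OF d wT w0] coeff_rule_def by auto
qed

text \<open>Solves \<open>spray_eq\<close> for \<open>h\<close> at a given point of a given chart.
  That the result depends on neither is what left invariance has to provide.\<close>

definition spray_u :: "('g, real^'n) chart \<Rightarrow> real^'n \<Rightarrow> real^'n \<Rightarrow> real^'n" where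
  "spray_u c a u = inv_into UNIV (frame_map c a) (2 *\<^sub>R coeff c a (frame_map c a u) + frame_deriv c a (frame_map c a u) u)"

lemma frame_map_spray_u:
  "c \<in> A \<Longrightarrow> a \<in> snd c ` fst c \<Longrightarrow>
    frame_map c a (spray_u c a u) = 2 *\<^sub>R coeff c a (frame_map c a u) + frame_deriv c a (frame_map c a u) u"
  unfolding spray_u_def by (rule surj_f_inv_f[OF frame_map_surj])

text \<open>The coefficients contribute minus the second derivative of the translation at the vector
  \<open>?Y\<close>, the derivative of the frame contributes the same term with a plus sign.\<close>

lemma spray_u_invariant:
  assumes g: "g \<in> carrier G" and c: "c \<in> A" and d: "d \<in> A" and p: "p \<in> fst c" "g \<otimes> p \<in> fst d"
    and rule: "coeff_rule g c d p (frame_map c (snd c p) u)"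
  shows "spray_u d (snd d (g \<otimes> p)) u = spray_u c (snd c p) u"
proof -
  have lin: "linear (trans_deriv g c d p)" by (rule linear_trans_deriv[OF g c d p])
  note F = frame_map_equivariant[OF g c d p]
  let ?Y = "frame_map c (snd c p) u" and ?d = "snd d (g \<otimes> p)"
  have imc: "snd c p \<in> snd c ` fst c" and imd: "?d \<in> snd d ` fst d" using p by blast+
  have "2 *\<^sub>R coeff d ?d (trans_deriv g c d p ?Y) = - (- 2 *\<^sub>R coeff d ?d (trans_deriv g c d p ?Y))" by simp
  also have "\<dots> = 2 *\<^sub>R trans_deriv g c d p (coeff c (snd c p) ?Y) - trans_deriv2 g c d p ?Y ?Y"
    using rule unfolding coeff_rule_def linear_scale[OF lin] by simp
  finally have "frame_map d ?d (spray_u d ?d u) =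
      2 *\<^sub>R trans_deriv g c d p (coeff c (snd c p) ?Y) + trans_deriv g c d p (frame_deriv c (snd c p) ?Y u)"
    unfolding frame_map_spray_u[OF d imd] F[of u] frame_deriv_equivariant[OF g c d p] by simp
  also have "\<dots> = frame_map d ?d (spray_u c (snd c p) u)"
    unfolding F frame_map_spray_u[OF c imc] linear_add[OF lin] linear_scale[OF lin] ..
  finally have "frame_map d ?d (spray_u d ?d u) = frame_map d ?d (spray_u c (snd c p) u)" .
  then show ?thesis using frame_map_inject[OF d] p by blast
qed

definition spray_field :: "real^'n \<Rightarrow> real^'n" where
  "spray_field = spray_u base_chart (snd base_chart \<one>)"

lemma lin_comb_nonzero: "u \<noteq> 0 \<Longrightarrow> lin_comb u \<noteq> zero_tvec"
  using lin_comb_inject[of u 0] linear_0[OF linear_lin_comb] by (auto simp: zero_tvec_def fun_eq_iff)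

text \<open>Two invariance steps: left translation connects \<open>p\<close> with the unit in some
  chart \<open>k\<close> not under control, and a coordinate change then connects \<open>k\<close>
  with \<open>base_chart\<close>.\<close>

lemma spray_frame_map:
  assumes c: "c \<in> A" "a \<in> snd c ` fst c" and u: "u \<noteq> 0"
  shows "2 *\<^sub>R coeff c a (frame_map c a u) = frame_map c a (spray_field u) - frame_deriv c a (frame_map c a u) u"
proof -
  obtain p where p: "p \<in> fst c" "a = snd c p" using c by blast
  have pG: "p \<in> carrier G" using p c chart_subset by blast
  have p1: "p \<otimes> \<one> \<in> fst c" using p pG by simp
  obtain k where k: "k \<in> A" "\<one> \<in> fst k" and rule: "coeff_rule p k c \<one> (lin_comb u k)"
    using coeff_rule_translation[OF pG one_closed c(1) p1 lin_comb_tangent lin_comb_nonzero[OF u]] by blast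
  have "spray_u c a u = spray_u k (snd k \<one>) u"
    using spray_u_invariant[OF pG k(1) c(1) k(2) p1] rule pG p by (simp add: frame_map_one[OF k])
  also have "\<dots> = spray_u base_chart (snd base_chart \<one>) u"
    using spray_u_invariant[of \<one> base_chart k \<one> u] base_chart k frame_map_one[OF base_chart]
      coeff_rule_one[OF base_chart k lin_comb_tangent lin_comb_nonzero[OF u]] by simp
  finally show ?thesis using frame_map_spray_u[OF c, of u] by (simp add: spray_field_def)
qed

text \<open>At the unit the frame matrix is constant, so this is a linear system with constant
  matrix and a right side that is smooth away from 0.\<close>

lemma spray_field_smooth: "smooth_on (- {0}) spray_field"
proof -
  let ?k = base_chart and ?a = "snd base_chart \<one>"
  let ?F = "frame_map ?k ?a"
  have a: "?a \<in> snd ?k ` fst ?k" using base_chart by blast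
  have op: "open (- {0::real^'n})" by (simp add: open_Compl)
  have blF: "bounded_linear ?F" using linear_frame_map linear_conv_bounded_linear by blast
  have smF: "smooth_on (- {0}) ?F" by (rule smooth_on_linear[OF blF])
  have inj: "inj ?F" using frame_map_inject[OF base_chart(1) a] by (auto simp: inj_def)
  show ?thesis
  proof (rule smooth_on_linear_solve[where M = "\<lambda>_. matrix ?F", OF op])
    show "det (matrix ?F) \<noteq> 0" using inj det_nz_iff_inj[OF linear_frame_map] by blast
    show "smooth_on (- {0}) (\<lambda>u. 2 *\<^sub>R coeff ?k ?a (?F u) + frame_deriv ?k ?a (?F u) u)"
    proof (intro smooth_on_add op smooth_on_cmul)
      have "smooth_on (- {0}) (\<lambda>u. (\<lambda>z. coeff ?k (fst z) (snd z)) (?a, ?F u))"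
        using a frame_map_inj[OF base_chart(1) a]
        by (intro smooth_on_compose[OF coeff_smooth[OF base_chart(1)]] smooth_on_Pair op smF smooth_on_const)
          auto
      then show "smooth_on (- {0}) (\<lambda>u. coeff ?k ?a (?F u))" by simp
      have "bounded_linear (\<lambda>\<xi>. frame_deriv ?k ?a \<xi> v)" for v
        using linear_frame_deriv[OF base_chart(1) a] linear_conv_bounded_linear by blast
      then have "smooth_on (- {0}) (\<lambda>u. \<Sum>i\<in>UNIV. u $ i *\<^sub>R frame_deriv ?k ?a (?F u) (axis i 1))"
        by (intro smooth_on_sum smooth_on_scaleR op smooth_on_vec_nth
            smooth_on_linear[OF bounded_linear_ident] smooth_on_bounded_linear[OF _ op smF])
      then show "smooth_on (- {0}) (\<lambda>u. frame_deriv ?k ?a (?F u) u)"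
        by (simp flip: frame_deriv_sum[OF base_chart(1) a])
    qed
    show "matrix ?F *v spray_field u = 2 *\<^sub>R coeff ?k ?a (?F u) + frame_deriv ?k ?a (?F u) u" for u
      by (simp add: matrix_works[OF linear_matrix_vector_mul_eq[THEN iffD2, OF linear_frame_map]]
         spray_field_def frame_map_spray_u[OF base_chart(1) a])
  qed (rule smooth_on_const)
qed

lemma framed:
  assumes c: "c \<in> A"
  shows "framed_spray (snd c ` fst c) (frame_map c) spray_field bracket (coeff c) (frame_deriv c)"
proof (rule framed_spray.intro)
  show "u = 0" if "a \<in> snd c ` fst c" "frame_map c a u = 0" for a u
    using frame_map_inj[OF c that] .
qed (rule frame_deriv_def open_chart_image[OF c] linear_frame_map frame_map_smooth[OF c] spray_field_smooth coeff_smooth[OF c]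
    bilinear_bracket spray_frame_map[OF c] bracket_frame_map[OF c]; assumption)+

section \<open>Identification of the functions \<open>H\<close> at the unit\<close>

lemma frame_field_one: "frame_field G A e i \<one> = e i"
proof
  fix c
  have "frame_field G A e i \<one> c =
      (if c \<in> charts_at A \<one> then trans_deriv \<one> base_chart c \<one> (e i base_chart) else 0)"
    using pushforward_translation[OF one_closed basis_tangent base_chart]
    by (simp add: frame_field_def left_invariant_field_def)
  also have "\<dots> = e i c"
    using tangent_space_chart[OF basis_tangent base_chart(1) _ base_chart(2)]
      tangent_space_outside[OF basis_tangent, of c] by (simp add: charts_at_def)
  finally show "frame_field G A e i \<one> c = e i c" .
qed

lemma lin_comb_apply: "lin_comb u c = (\<Sum>i\<in>UNIV. u $ i *\<^sub>R e i c)"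
  by (simp add: lin_comb_def)

lemma frame_coords_one: "frame_coords G A e (\<one>, lin_comb u) = u"
  by (simp add: frame_coords_def frame_field_one lin_comb_inject flip: lin_comb_def)

lemma spray_G0_chart:
  assumes c: "c \<in> A" "\<one> \<in> fst c"
  shows "spray_G0 G A e (\<one>, lin_comb u) (tangent_chart A c) =
    (lin_comb u c, frame_deriv c (snd c \<one>) (lin_comb u c) u)"
proof -
  have "snd c \<one> \<in> snd c ` fst c" using c by blast
  from frame_deriv_eq[OF c(1) this] show ?thesis
    by (intro prod_eqI) (simp_all add: spray_G0_def frame_coords_one complete_lift_def fst_sum snd_sum
      tangent_lift_chart[OF lin_comb_tangent c] frame_field_one flip: lin_comb_apply)
qed

lemma partial_u_chart:
  assumes c: "c \<in> A" "\<one> \<in> fst c"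
  shows "(\<Sum>i\<in>UNIV. h $ i *\<^sub>R partial_u G A e i (\<one>, lin_comb u) (tangent_chart A c)) = (0, lin_comb h c)"
  by (intro prod_eqI) (simp_all add: partial_u_def fst_sum snd_sum
      tangent_lift_chart[OF lin_comb_tangent c] frame_field_one flip: lin_comb_apply)

text \<open>In a chart, \<open>spray_frame_map\<close> says that the fibre part of the spray is that
  of \<open>spray_G0\<close> minus the frame combination of \<open>spray_field u\<close>, which is
  the defining equation of \<open>H\<close>. A single chart at the unit already determines the
  solution.\<close>

lemma spray_H_one:
  assumes u: "u \<noteq> 0" shows "spray_H G A e S (\<one>, lin_comb u) = spray_field u"
  unfolding spray_H_def
proof (rule the_equality)
  let ?\<xi> = "(\<one>, lin_comb u)"
  note S_chart = spray_chart[OF _ _ lin_comb_tangent lin_comb_nonzero[OF u]]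
  have coeff: "- 2 *\<^sub>R coeff c (snd c \<one>) (lin_comb u c) =
      frame_deriv c (snd c \<one>) (lin_comb u c) u - lin_comb (spray_field u) c"
    if "c \<in> A" "\<one> \<in> fst c" for c
    using spray_frame_map[OF that(1) _ u, of "snd c \<one>"] that by (simp add: frame_map_one)
  show "S ?\<xi> = (\<lambda>d. spray_G0 G A e ?\<xi> d - (\<Sum>i\<in>UNIV. spray_field u $ i *\<^sub>R partial_u G A e i ?\<xi> d))"
  proof
    fix D
    show "S ?\<xi> D = spray_G0 G A e ?\<xi> D - (\<Sum>i\<in>UNIV. spray_field u $ i *\<^sub>R partial_u G A e i ?\<xi> D)"
    proof (cases "D \<in> charts_at (tangent_atlas A) ?\<xi>")
      case True
      then obtain c where c: "c \<in> A" "\<one> \<in> fst c" and D: "D = tangent_chart A c"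
        by (rule charts_at_tangent_atlasE[OF _ lin_comb_tangent])
      show ?thesis
        unfolding D S_chart[OF c] spray_G0_chart[OF c] partial_u_chart[OF c] coeff[OF c] by simp
    next
      \<comment> \<open>Away from the charts at this point every term is 0 by the convention for
        tangent vectors.\<close>
      case False
      then have "S ?\<xi> D = 0"
        using spray_tangent[OF lin_comb_tangent one_closed lin_comb_nonzero[OF u]]
        unfolding tangent_space_def by blast
      then show ?thesis
        using False by (simp add: spray_G0_def partial_u_def complete_lift_def tangent_lift_def)
    qed
  qed
  fix h assume "S ?\<xi> = (\<lambda>d. spray_G0 G A e ?\<xi> d - (\<Sum>i\<in>UNIV. h $ i *\<^sub>R partial_u G A e i ?\<xi> d))"
  from fun_cong[OF this, of "tangent_chart A base_chart"]
  have "lin_comb (spray_field u) base_chart = lin_comb h base_chart"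
    unfolding S_chart[OF base_chart] spray_G0_chart[OF base_chart] partial_u_chart[OF base_chart]
      coeff[OF base_chart] by simp
  then show "h = spray_field u" by (simp add: lin_comb_inject_at[OF base_chart])
qed

lemma spray_vector_field_lin_comb:
  "u \<noteq> 0 \<Longrightarrow> spray_vector_field G A e S (lin_comb u) = lin_comb (spray_field u)"
  by (simp add: spray_vector_field_def spray_H_one flip: lin_comb_apply)

section \<open>Index formulas for the connection coefficients and the curvature\<close>

context
  fixes c assumes c: "c \<in> A"
begin

interpretation fr: framed_spray "snd c ` fst c" "frame_map c" spray_field bracket "coeff c" "frame_deriv c"
  by (rule framed[OF c])

context
  fixes x y :: "real^'n"
  assumes x: "x \<in> snd c ` fst c" and y: "y \<noteq> 0"
begin

lemma slit_point: "(x, y) \<in> (snd c ` fst c) \<times> - {0}"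
  using x y by simp

lemma pd_x_spray_comp: "pd_x k (spray_comp A S c i) x y = fr.DG (x, y) (axis k 1, 0) $ i"
  unfolding pd_x_def spray_comp_def fr.DG_def
  using frechet_derivative_eqI[OF partial_has_derivative(1)[OF coeff_smooth[OF c] slit_point]] by simp

lemma pd_y_spray_comp: "pd_y k (spray_comp A S c i) x y = fr.\<Gamma> (x, y) (axis k 1) $ i"
  unfolding pd_y_def spray_comp_def fr.DG_def fr.\<Gamma>_def
  using frechet_derivative_eqI[OF partial_has_derivative(2)[OF coeff_smooth[OF c] slit_point]] by simp

end

text \<open>The assumptions are repeated because closing the previous context generalises
  \<open>pd_y_spray_comp\<close> over \<open>x\<close> and \<open>y\<close>; second partial
  derivatives need it at all nearby points.\<close>

context
  fixes x y :: "real^'n"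
  assumes x: "x \<in> snd c ` fst c" and y: "y \<noteq> 0"
begin

lemma pd_x_pd_y_spray_comp: "pd_x j (pd_y k (spray_comp A S c i)) x y =
    frechet_derivative (\<lambda>z. fr.\<Gamma> z (axis k 1)) (at (x, y)) (axis j 1, 0) $ i"
  unfolding pd_x_def
  by (rule frechet_derivative_eqI, rule has_derivative_transform_within_open[OF
      partial_has_derivative(1)[OF fr.smooth_\<Gamma> slit_point[OF x y]] open_chart_image[OF c] x])
    (simp add: pd_y_spray_comp[OF _ y])

lemma pd_y_pd_y_spray_comp: "pd_y j (pd_y k (spray_comp A S c i)) x y =
    frechet_derivative (\<lambda>z. fr.\<Gamma> z (axis k 1)) (at (x, y)) (0, axis j 1) $ i"
  unfolding pd_y_def[of j]
  by (rule frechet_derivative_eqI, rule has_derivative_transform_within_open[OF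
      partial_has_derivative(2)[OF fr.smooth_\<Gamma> slit_point[OF x y]], where s = "- {0}"])
    (auto simp: pd_y_spray_comp[OF x] y open_Compl)

lemma spray_N_vec: "(\<chi> i. \<Sum>j\<in>UNIV. W $ j * spray_N A S c i j x y) = fr.\<Gamma> (x, y) W"
  by (subst linear_expand[OF fr.linear_\<Gamma>[OF x y]])
    (simp add: vec_eq_iff spray_N_def pd_y_spray_comp[OF x y])

text \<open>The two second order sums in the index formula are one directional derivative of
  \<open>\<Gamma>\<close>, in the direction \<open>(y, - 2 *\<^sub>R coeff c x y)\<close> of the
  spray. In this form \<open>curvature_U\<close> applies.\<close>

lemma riemann_vec: "(\<chi> i. \<Sum>k\<in>UNIV. riemann_comp A S c i k x y * W $ k) =
    2 *\<^sub>R fr.DG (x, y) (W, 0)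
    - frechet_derivative (\<lambda>z. fr.\<Gamma> z W) (at (x, y)) (y, - 2 *\<^sub>R coeff c x y)
    - fr.\<Gamma> (x, y) (fr.\<Gamma> (x, y) W)"
proof -
  let ?D = "\<lambda>W. frechet_derivative (\<lambda>z. fr.\<Gamma> z W) (at (x, y))"
  have op: "open ((snd c ` fst c) \<times> - {0::real^'n})"
    by (intro open_Times open_chart_image[OF c] open_Compl) simp
  have linD: "linear (?D W)" for W
    by (rule linear_frechet_derivative[OF smooth_on_differentiable[OF fr.smooth_\<Gamma> slit_point[OF x y]]])
  have Pair1: "linear (\<lambda>v. (v, 0) :: (real^'n) \<times> (real^'n))"
    and Pair2: "linear (\<lambda>v. (0, v) :: (real^'n) \<times> (real^'n))"
    by (auto intro: linearI)
  have lin1: "linear (\<lambda>v. ?D W (v, 0))" and lin2: "linear (\<lambda>v. ?D W (0, v))" for W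
    using linear_compose[OF Pair1 linD[of W]] linear_compose[OF Pair2 linD[of W]] by (simp_all add: o_def)
  have split: "?D W (v, v') = ?D W (v, 0) + ?D W (0, v')" for W v v'
    using linear_add[OF linD, of W "(v, 0)" "(0, v')"] by simp
  have linDG: "linear (\<lambda>v. fr.DG (x, y) (v, 0))"
    using linear_compose[OF Pair1 fr.linear_DG[OF x y]] by (simp add: o_def)
  note lin\<Gamma> = fr.linear_\<Gamma>[OF x y]
  define V where "V k = 2 *\<^sub>R fr.DG (x, y) (axis k 1, 0) - ?D (axis k 1) (y, - 2 *\<^sub>R coeff c x y)
    - fr.\<Gamma> (x, y) (fr.\<Gamma> (x, y) (axis k 1))" for k
  have comp: "riemann_comp A S c i k x y = V k $ i" for i k
  proof -
    have "?D (axis k 1) (y, - 2 *\<^sub>R coeff c x y) $ i =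
      (\<Sum>j\<in>UNIV. y $ j * pd_x j (pd_y k (spray_comp A S c i)) x y)
      - 2 * (\<Sum>j\<in>UNIV. spray_comp A S c j x y * pd_y j (pd_y k (spray_comp A S c i)) x y)"
      unfolding split[of "axis k 1" y "- 2 *\<^sub>R coeff c x y"] linear_expand[OF lin1, of _ y] linear_expand[OF lin2, of _ "- 2 *\<^sub>R coeff c x y"]
      by (simp add: pd_x_pd_y_spray_comp pd_y_pd_y_spray_comp spray_comp_def sum_negf sum_distrib_left mult.assoc)
    moreover have "fr.\<Gamma> (x, y) (fr.\<Gamma> (x, y) (axis k 1)) $ i =
      (\<Sum>j\<in>UNIV. pd_y j (spray_comp A S c i) x y * pd_y k (spray_comp A S c j) x y)"
      unfolding linear_expand[OF lin\<Gamma>, of "fr.\<Gamma> (x, y) (axis k 1)"]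
      by (simp add: pd_y_spray_comp[OF x y] mult.commute)
    ultimately show ?thesis
      unfolding riemann_comp_def V_def by (simp add: pd_x_spray_comp[OF x y])
  qed
  \<comment> \<open>\<open>\<Gamma> z\<close> is linear only for \<open>z\<close> in the chart image
    with nonzero fibre part, so the expansion in \<open>W\<close> is differentiated on that open
    set.\<close>
  have "?D W v = (\<Sum>k\<in>UNIV. W $ k *\<^sub>R ?D (axis k 1) v)" for v
  proof (rule frechet_derivative_eqI, rule has_derivative_transform_within_open[OF _ op slit_point[OF x y]])
    show "((\<lambda>z. \<Sum>k\<in>UNIV. W $ k *\<^sub>R fr.\<Gamma> z (axis k 1)) has_derivative
        (\<lambda>v. \<Sum>k\<in>UNIV. W $ k *\<^sub>R ?D (axis k 1) v)) (at (x, y))"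
      by (intro has_derivative_sum has_derivative_scaleR_right smooth_on_has_derivative[OF fr.smooth_\<Gamma> slit_point[OF x y]])
    show "(\<Sum>k\<in>UNIV. W $ k *\<^sub>R fr.\<Gamma> z (axis k 1)) = fr.\<Gamma> z W" if zO: "z \<in> (snd c ` fst c) \<times> - {0}" for z
    proof -
      obtain a b where z: "z = (a, b)" "a \<in> snd c ` fst c" "b \<noteq> 0" using zO by blast
      have "linear (fr.\<Gamma> z)" unfolding z(1) by (rule fr.linear_\<Gamma>[OF z(2,3)])
      then show ?thesis using linear_expand[of "fr.\<Gamma> z" W] by simp
    qed
  qed
  moreover have "fr.DG (x, y) (W, 0) = (\<Sum>k\<in>UNIV. W $ k *\<^sub>R fr.DG (x, y) (axis k 1, 0))"
    by (rule linear_expand[OF linDG])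
  moreover have "fr.\<Gamma> (x, y) (fr.\<Gamma> (x, y) W) = (\<Sum>k\<in>UNIV. W $ k *\<^sub>R fr.\<Gamma> (x, y) (fr.\<Gamma> (x, y) (axis k 1)))"
    using linear_expand[OF linear_compose[OF lin\<Gamma> lin\<Gamma>], of W] by (simp add: o_def)
  ultimately have "2 *\<^sub>R fr.DG (x, y) (W, 0) - ?D W (y, - 2 *\<^sub>R coeff c x y) - fr.\<Gamma> (x, y) (fr.\<Gamma> (x, y) W)
      = (\<Sum>k\<in>UNIV. W $ k *\<^sub>R V k)"
    by (simp add: V_def scaleR_diff_right sum_subtractf scaleR_sum_right mult.commute)
  then show ?thesis
    by (simp add: vec_eq_iff comp mult.commute)
qed

end

end

end

section \<open>Geodesics and parallel fields in the frame\<close>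

context framed_spray
begin

definition conn :: "'v \<Rightarrow> 'v \<Rightarrow> 'v" where
  "conn u w = (1/2) *\<^sub>R (dh u w - B u w)"

definition curv :: "'v \<Rightarrow> 'v \<Rightarrow> 'v" where
  "curv u w = dh u (B u w) + (1/2) *\<^sub>R (ddh u (h u) w - B (h u) w) - M u (M u w)"

text \<open>The source of the first claim: if \<open>w' = - M u w\<close>, then
  \<open>w' + dh u w\<close>, which is minus the bracket with the spray vector field, equals
  \<open>conn u w\<close>.\<close>

lemma conn_eq: "conn u w = dh u w - M u w"
proof -
  have "dh u w = (1/2) *\<^sub>R dh u w + (1/2) *\<^sub>R dh u w" by (simp flip: scaleR_add_left)
  then show ?thesis unfolding conn_def M_def scaleR_diff_right scaleR_add_right by (simp add: algebra_simps)
qed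

text \<open>The velocity \<open>v\<close> is differentiated in two ways, by the geodesic equation
  and by the product rule in the frame. \<open>spray_eq\<close> cancels the derivative of the frame,
  and injectivity of the frame removes \<open>U\<close>.\<close>

lemma geodesic_ode:
  assumes x: "(x has_vector_derivative v t) (at t)" "x t \<in> \<Omega>"
    and v: "(v has_vector_derivative - 2 *\<^sub>R G (x t) (v t)) (at t)"
    and u: "(u has_vector_derivative u') (at t)" "u t \<noteq> 0"
    and eq: "\<forall>\<^sub>F s in nhds t. v s = U (x s) (u s)"
  shows "u' = - h (u t)"
proof -
  have vt: "v t = U (x t) (u t)" using eq by (rule eventually_nhds_x_imp_x)
  have "- 2 *\<^sub>R G (x t) (v t) = P (x t) (v t) (u t) + U (x t) u'"
    by (rule has_vector_derivative_unique_eventually[OF v has_vector_derivative_U[OF x u(1)] eq])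
  then have "U (x t) u' = - U (x t) (h (u t))"
    using spray_eq[OF x(2) u(2)] unfolding vt by simp
  then have "U (x t) (u' + h (u t)) = 0"
    by (simp add: linear_add[OF linear_U])
  then show ?thesis using inj_U[OF x(2)] eq_neg_iff_add_eq_0 by blast
qed

lemma parallel_ode:
  assumes x: "(x has_vector_derivative U (x t) u) (at t)" "x t \<in> \<Omega>" and u: "u \<noteq> 0"
    and W: "(W has_vector_derivative - \<Gamma> (x t, U (x t) u) (W t)) (at t)"
    and w: "(w has_vector_derivative w') (at t)"
    and eq: "\<forall>\<^sub>F s in nhds t. W s = U (x s) (w s)"
  shows "w' = - M u (w t)"
proof -
  have Wt: "W t = U (x t) (w t)" using eq by (rule eventually_nhds_x_imp_x)
  have "- \<Gamma> (x t, U (x t) u) (W t) = P (x t) (U (x t) u) (w t) + U (x t) w'"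
    by (rule has_vector_derivative_unique_eventually[OF W has_vector_derivative_U[OF x w] eq])
  then have "U (x t) (w' + M u (w t)) = 0"
    unfolding Wt \<Gamma>_U[OF x(2) u] linear_add[OF linear_U] by (simp add: algebra_simps)
  then show ?thesis using inj_U[OF x(2)] eq_neg_iff_add_eq_0 by blast
qed

text \<open>The second claim in frame components: \<open>curv\<close> is minus the sum of the
  derivative of \<open>conn\<close> and \<open>dh\<close> applied to it. Once the ordinary
  differential equations for \<open>u\<close> and \<open>w\<close> are inserted, this is pure
  algebra.\<close>

lemma has_vector_derivative_conn:
  assumes u: "(u has_vector_derivative - h (u t)) (at t)" "u t \<noteq> 0"
    and w: "(w has_vector_derivative - M (u t) (w t)) (at t)"
  shows "((\<lambda>s. conn (u s) (w s)) has_vector_derivative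
    - curv (u t) (w t) - dh (u t) (conn (u t) (w t))) (at t)"
proof -
  let ?u = "u t" and ?w = "w t"
  let ?m = "M ?u ?w"
  note dh = linear_neg[OF linear_dh[OF u(2)]] linear_diff[OF linear_dh[OF u(2)]]
    linear_add[OF linear_dh[OF u(2)]] linear_scale[OF linear_dh[OF u(2)]]
  note bilinear = linear_neg[OF linear_ddh[OF u(2)]] linear_neg[OF linear_B] linear_neg[OF linear_B_left] dh
  have "((\<lambda>s. conn (u s) (w s)) has_vector_derivative
      (1/2) *\<^sub>R ((ddh ?u (- h ?u) ?w + dh ?u (- ?m)) - (B ?u (- ?m) + B (- h ?u) ?w))) (at t)"
    unfolding conn_def
    by (intro bounded_linear.has_vector_derivative[OF bounded_linear_scaleR_right]
        has_vector_derivative_diff has_vector_derivative_dh[OF u w]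
        bounded_bilinear.has_vector_derivative[OF bilinear_B u(1) w])
  moreover have "(1/2) *\<^sub>R ((ddh ?u (- h ?u) ?w + dh ?u (- ?m)) - (B ?u (- ?m) + B (- h ?u) ?w)) =
      - curv ?u ?w - dh ?u (conn ?u ?w)" (is "?L = ?R")
  proof (rule euclidean_eqI)
    fix b :: 'v assume "b \<in> Basis"
    have "dh ?u ?m = (1/2) *\<^sub>R (dh ?u (dh ?u ?w) + dh ?u (B ?u ?w))"
      by (simp add: M_def[of ?u ?w] dh)
    from arg_cong[OF this, of "\<lambda>z. z \<bullet> b"] show "?L \<bullet> b = ?R \<bullet> b"
      unfolding bilinear curv_def conn_def M_def[of ?u ?m]
        inner_add_left inner_diff_left inner_scaleR_left inner_minus_left by argo
  qed
  ultimately show ?thesis by simp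
qed

end

lemma smooth_on_has_vector_derivative:
  "smooth_on T f \<Longrightarrow> t \<in> T \<Longrightarrow> (f has_vector_derivative vector_derivative f (at t)) (at t)"
  using smooth_on_differentiable vector_derivative_works by blast

lemma smooth_on_vector_derivative:
  assumes "open T" "smooth_on T f" shows "smooth_on T (\<lambda>t. vector_derivative f (at t))"
  by (rule smooth_on_cong[OF smooth_on_frechet_derivative[OF assms(2), of 1] assms(1)])
    (simp add: frechet_derivative_eq_vector_derivative smooth_on_differentiable[OF assms(2)])

context lie_frame
begin

text \<open>No regularity of \<open>u\<close> is assumed; it comes from the smooth matrix of the
  frame through \<open>smooth_on_linear_solve\<close>.\<close>

lemma frame_components_smooth:
  fixes x v u :: "real \<Rightarrow> real^'n"
  assumes c: "c \<in> A" and T: "open T" and x: "smooth_on T x" "x ` T \<subseteq> snd c ` fst c"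
    and v: "smooth_on T v" and eq: "\<And>t. t \<in> T \<Longrightarrow> v t = frame_map c (x t) (u t)"
  shows "smooth_on T u"
proof (rule smooth_on_linear_solve[OF T _ v])
  have lin: "linear (frame_map c a)" for a by (rule linear_frame_map)
  show "smooth_on T (\<lambda>t. matrix (frame_map c (x t)) $ i $ j)" for i j
    unfolding matrix_def
    using smooth_on_vec_nth[OF T smooth_on_compose[OF frame_map_smooth[OF c, of "axis j 1"] x(1) T x(2)], of i]
    by simp
  show "det (matrix (frame_map c (x t))) \<noteq> 0" if "t \<in> T" for t
    unfolding det_nz_iff_inj[OF lin] using frame_map_inject[OF c, of "x t"] x(2) that
    by (auto simp: inj_def)
  show "matrix (frame_map c (x t)) *v u t = v t" if "t \<in> T" for t
    using eq[OF that] by (simp add: matrix_works[OF linear_matrix_vector_mul_eq[THEN iffD2, OF lin]])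
qed

text \<open>The coordinates of the left translated vector in the basis of the Lie algebra are the
  frame components of the original vector, with the same \<open>u\<close> in all charts.\<close>

lemma translate_to_one:
  assumes g: "g \<in> carrier G" and v: "v \<in> tangent_space A g"
  shows "\<exists>u. pushforward A A (left_translation G (inv g)) g v = lin_comb u \<and>
    (\<forall>c\<in>A. g \<in> fst c \<longrightarrow> v c = frame_map c (snd c g) u)"
proof -
  obtain k where k: "k \<in> A" "g \<in> fst k" using chart_exists[OF g] by blast
  then have "surj (frame_map k (snd k g))" by (intro frame_map_surj) auto
  then obtain u where u: "v k = frame_map k (snd k g) u" by (auto simp: surj_def)
  have "v c = frame_map c (snd c g) u" if "c \<in> A" "g \<in> fst c" for c
    using tangent_space_chart[OF v k(1) that(1) k(2) that(2)] frame_map_equivariant[OF one_closed k(1) that(1) k(2)] that g u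
    by simp
  moreover have "pushforward A A (left_translation G (inv g)) g v = lin_comb u"
  proof (rule tangent_space_eqI[OF _ lin_comb_tangent base_chart])
    show "pushforward A A (left_translation G (inv g)) g v \<in> tangent_space A \<one>"
      using pushforward_tangent[OF inv_closed[OF g] v g] g by simp
    show "pushforward A A (left_translation G (inv g)) g v base_chart = lin_comb u base_chart"
      using pushforward_translation[OF inv_closed[OF g] v k] g base_chart u frame_map_one[OF base_chart]
        frame_map_equivariant[OF inv_closed[OF g] k(1) base_chart(1) k(2), of u]
      by (simp add: charts_at_def)
  qed
  ultimately show ?thesis by blast
qed

end

context lie_spray
begin

text \<open>The choice of \<open>base_chart\<close> is harmless: \<open>dh\<close>,
  \<open>M\<close>, \<open>conn\<close> and \<open>curv\<close> are built from
  \<open>spray_field\<close> and \<open>bracket\<close> alone, so the interpretations for other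
  charts yield the same functions.\<close>

interpretation fr: framed_spray "snd base_chart ` fst base_chart" "frame_map base_chart" spray_field bracket
    "coeff base_chart" "frame_deriv base_chart"
  by (rule framed[OF base_chart(1)])

abbreviation \<eta> where "\<eta> \<equiv> spray_vector_field G A e S"

lemma has_vector_derivative_lin_comb:
  "(f has_vector_derivative f') F \<Longrightarrow> ((\<lambda>s. lin_comb (f s) d) has_vector_derivative lin_comb f' d) F"
  by (rule bounded_linear.has_vector_derivative[OF bounded_linear_lin_comb])

text \<open>The formula for \<open>\<eta>\<close> is available for nonzero vectors only, so the line
  through \<open>u\<close> is compared with it only near \<open>s = 0\<close>.\<close>

lemma has_vector_derivative_\<eta>:
  assumes u: "u \<noteq> 0"
  shows "((\<lambda>s. \<eta> (\<lambda>d. lin_comb u d + s *\<^sub>R lin_comb w d) c) has_vector_derivative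
    lin_comb (fr.dh u w) c) (at 0)"
proof -
  have "((\<lambda>s. lin_comb (spray_field (u + s *\<^sub>R w)) c) has_vector_derivative lin_comb (fr.dh u w) c) (at 0)"
    using has_vector_derivative_lin_comb[OF fr.has_vector_derivative_h[where u = "\<lambda>s. u + s *\<^sub>R w" and t = 0,
          OF has_vector_derivative_line]] u by simp
  moreover have "\<forall>\<^sub>F s in at 0. lin_comb (spray_field (u + s *\<^sub>R w)) c = \<eta> (\<lambda>d. lin_comb u d + s *\<^sub>R lin_comb w d) c"
  proof -
    have "\<forall>\<^sub>F s in nhds 0. u + s *\<^sub>R w \<in> - {0}"
      using u by (intro eventually_line) (auto simp: open_Compl)
    then have "\<forall>\<^sub>F s in at 0. u + s *\<^sub>R w \<in> - {0}"
      by (auto simp: eventually_at_filter elim: eventually_mono)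
    moreover have "(\<lambda>d. lin_comb u d + s *\<^sub>R lin_comb w d) = lin_comb (u + s *\<^sub>R w)" for s
      by (simp add: lin_comb_add lin_comb_scaleR)
    ultimately show ?thesis
      by (auto simp: spray_vector_field_lin_comb elim: eventually_mono)
  qed
  ultimately show ?thesis
    unfolding has_vector_derivative_def
    by (rule has_derivative_transform_eventually)
      (use spray_vector_field_lin_comb[OF u] in simp_all)
qed

lemma ddir_\<eta>:
  assumes u: "u \<noteq> 0"
  shows "ddir \<eta> (lin_comb u) (lin_comb w) = lin_comb (fr.dh u w)"
    and "ddir (\<lambda>z d. - \<eta> z d) (lin_comb u) (lin_comb w) = lin_comb (- fr.dh u w)"
  unfolding ddir_def
  using vector_derivative_at[OF has_vector_derivative_\<eta>[OF u, of w]]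
    vector_derivative_at[OF has_vector_derivative_minus[OF has_vector_derivative_\<eta>[OF u, of w]]]
  by (auto simp: linear_neg[OF linear_lin_comb])

lemma connection_lin_comb:
  "u \<noteq> 0 \<Longrightarrow> connection_operator G A \<eta> (lin_comb u) (lin_comb w) = lin_comb (fr.conn u w)"
  by (simp add: connection_operator_def ddir_\<eta> lie_bracket_lin_comb fr.conn_def fun_eq_iff
      linear_scale[OF linear_lin_comb] linear_diff[OF linear_lin_comb] scaleR_diff_right)

text \<open>The two signs combine: \<open>bracket_along\<close> subtracts the derivative of
  \<open>-\<eta>\<close>, which adds \<open>dh\<close>, and the outer minus sign then negates both
  terms.\<close>

lemma eta_bracket_lin_comb:
  assumes I: "open I" "t \<in> I" and y: "y t = lin_comb u" "u \<noteq> 0"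
    and v: "\<And>s. s \<in> I \<Longrightarrow> v s = lin_comb (f s)" and f: "(f has_vector_derivative f') (at t)"
  shows "eta_bracket \<eta> y v t = lin_comb (- f' - fr.dh u (f t))"
proof
  fix d
  have "((\<lambda>s. v s d) has_vector_derivative lin_comb f' d) (at t)"
    using has_vector_derivative_transform_within_open[OF has_vector_derivative_lin_comb[OF f] I] v by simp
  then show "eta_bracket \<eta> y v t d = lin_comb (- f' - fr.dh u (f t)) d"
    using v[OF I(2)] y
    by (simp add: eta_bracket_def bracket_along_def ddir_\<eta> vector_derivative_at
        linear_neg[OF linear_lin_comb] linear_diff[OF linear_lin_comb])
qed

lemma riemann_lin_comb:
  assumes u: "u \<noteq> 0"
  shows "riemann_curvature A S \<one> (lin_comb u) (lin_comb w) = lin_comb (fr.curv u w)"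
proof
  fix c
  show "riemann_curvature A S \<one> (lin_comb u) (lin_comb w) c = lin_comb (fr.curv u w) c"
  proof (cases "c \<in> charts_at A \<one>")
    case True
    then have c: "c \<in> A" "\<one> \<in> fst c" by (auto simp: charts_at_def)
    then have x: "snd c \<one> \<in> snd c ` fst c" by blast
    interpret c: framed_spray "snd c ` fst c" "frame_map c" spray_field bracket "coeff c" "frame_deriv c"
      by (rule framed[OF c(1)])
    have "frame_map c (snd c \<one>) u \<noteq> 0" using frame_map_inj[OF c(1) x] u by blast
    from riemann_vec[OF c(1) x this] c.curvature_U[OF x u] show ?thesis
      using True by (simp add: riemann_curvature_def frame_map_one[OF c] fr.curv_def)
  qed (simp add: riemann_curvature_def lin_comb_outside)
qed

text \<open>The hypotheses hold the same \<open>u\<close> and \<open>w\<close> in every chart, so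
  smoothness and the differential equations can be obtained in one chart around each parameter and
  then glued.\<close>

lemma geodesic_parallel_ode:
  assumes I: "open I" and geo: "geodesic A S I c" and par: "linearly_parallel A S I c W"
    and u: "\<And>t k. t \<in> I \<Longrightarrow> k \<in> A \<Longrightarrow> c t \<in> fst k \<Longrightarrow> velocity A c t k = frame_map k (snd k (c t)) (u t)"
    and w: "\<And>t k. t \<in> I \<Longrightarrow> k \<in> A \<Longrightarrow> c t \<in> fst k \<Longrightarrow> W t k = frame_map k (snd k (c t)) (w t)"
    and nz: "\<And>t. t \<in> I \<Longrightarrow> u t \<noteq> 0"
  shows "smooth_on I u \<and> smooth_on I w \<and> (\<forall>t\<in>I. (u has_vector_derivative - spray_field (u t)) (at t) \<and>
    (w has_vector_derivative - fr.M (u t) (w t)) (at t))"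
proof -
  have curve: "smooth_curve A I c" and nz': "\<And>t. t \<in> I \<Longrightarrow> velocity A c t \<noteq> zero_tvec"
    and int: "integral_curve (tangent_atlas A) S I (\<lambda>t. (c t, velocity A c t))"
    using geo by (auto simp: geodesic_def)
  have smW: "\<And>k. k \<in> A \<Longrightarrow> smooth_on (I \<inter> c -` fst k) (\<lambda>t. W t k)"
    and cov: "\<And>t. t \<in> I \<Longrightarrow> covariant_derivative A S c W t = zero_tvec"
    using par by (auto simp: linearly_parallel_def smooth_field_along_def)
  have local: "\<exists>T. open T \<and> t \<in> T \<and> T \<subseteq> I \<and> smooth_on T u \<and> smooth_on T w \<and>
      (u has_vector_derivative - spray_field (u t)) (at t) \<and>
      (w has_vector_derivative - fr.M (u t) (w t)) (at t)" if t: "t \<in> I" for t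
  proof -
    have "c t \<in> carrier G" using curve t chart_cover by (auto simp: smooth_curve_def)
    then obtain k where k: "k \<in> A" "c t \<in> fst k" using chart_exists by blast
    interpret k: framed_spray "snd k ` fst k" "frame_map k" spray_field bracket "coeff k" "frame_deriv k"
      by (rule framed[OF k(1)])
    define T where "T = I \<inter> c -` fst k"
    define x where "x = (\<lambda>s. snd k (c s))"
    define v where "v = (\<lambda>s. velocity A c s k)"
    define V where "V = (\<lambda>s. W s k)"
    have T: "open T" "t \<in> T" and smx: "smooth_on T x"
      using curve k t unfolding smooth_curve_def T_def x_def by auto
    have imx: "x ` T \<subseteq> snd k ` fst k" by (auto simp: x_def T_def)
    have v_eq: "v s = vector_derivative x (at s)" if "s \<in> T" for s
      using that k by (simp add: v_def velocity_def charts_at_def x_def T_def)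
    have smv: "smooth_on T v"
      by (rule smooth_on_cong[OF smooth_on_vector_derivative[OF T(1) smx] T(1)]) (simp add: v_eq)
    have smV: "smooth_on T V" using smW[OF k(1)] by (simp add: T_def V_def)
    have vu: "v s = frame_map k (x s) (u s)" and Vw: "V s = frame_map k (x s) (w s)" if "s \<in> T" for s
      using that u[of s k] w[of s k] k by (auto simp: v_def V_def x_def T_def)
    have smu: "smooth_on T u" by (rule frame_components_smooth[OF k(1) T(1) smx imx smv vu])
    have smw: "smooth_on T w" by (rule frame_components_smooth[OF k(1) T(1) smx imx smV Vw])
    have evT: "\<forall>\<^sub>F s in nhds t. s \<in> T" using T by (rule eventually_nhds_in_open)
    have xt: "x t \<in> snd k ` fst k" using imx T by blast
    have dx: "(x has_vector_derivative v t) (at t)"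
      using smooth_on_has_vector_derivative[OF smx T(2)] v_eq[OF T(2)] by simp
    note du = smooth_on_has_vector_derivative[OF smu T(2)]
    note dw = smooth_on_has_vector_derivative[OF smw T(2)]
    note dv = smooth_on_has_vector_derivative[OF smv T(2)]
    have v0: "v t \<noteq> 0" using k.U_nonzero[OF xt nz[OF t]] vu[OF T(2)] by simp
    have velT: "velocity A c t \<in> tangent_space A (c t)"
      using int t by (auto simp: integral_curve_def smooth_curve_def tangent_atlas_def tangent_chart_simps)
    have "velocity (tangent_atlas A) (\<lambda>t. (c t, velocity A c t)) t (tangent_chart A k) =
        S (c t, velocity A c t) (tangent_chart A k)"
      using int t by (simp add: integral_curve_def)
    \<comment> \<open>In a tangent bundle chart the lifted curve is \<open>(x, v)\<close>; the
      second component of the integral curve equation is the geodesic equation.\<close>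
    then have "vector_derivative (\<lambda>s. (x s, v s)) (at t) = (v t, - 2 *\<^sub>R coeff k (x t) (v t))"
      using spray_chart[OF k velT nz'[OF t]] tangent_chart_at[OF velT k]
      by (simp add: velocity_def[of "tangent_atlas A"] tangent_chart_simps x_def v_def)
    then have dv': "(v has_vector_derivative - 2 *\<^sub>R coeff k (x t) (v t)) (at t)"
      using vector_derivative_at[OF has_vector_derivative_Pair[OF dx dv]] dv by simp
    have "vector_derivative u (at t) = - spray_field (u t)"
      by (rule k.geodesic_ode[OF dx xt dv' du nz[OF t]]) (rule eventually_mono[OF evT vu])
    moreover have "vector_derivative w (at t) = - fr.M (u t) (w t)"
    proof (rule k.parallel_ode[where x = x and W = V and w = w and u = "u t" and t = t, OF _ xt nz[OF t] _ dw])
      show "(x has_vector_derivative frame_map k (x t) (u t)) (at t)" using dx vu[OF T(2)] by simp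
      have "vector_derivative V (at t) + k.\<Gamma> (x t, v t) (V t) = 0"
        using fun_cong[OF cov[OF t], of k] k spray_N_vec[OF k(1) xt v0, of "V t"]
        by (simp add: covariant_derivative_def zero_tvec_def charts_at_def x_def v_def V_def)
      then have "vector_derivative V (at t) = - k.\<Gamma> (x t, frame_map k (x t) (u t)) (V t)"
        using vu[OF T(2)] by (simp add: eq_neg_iff_add_eq_0)
      then show "(V has_vector_derivative - k.\<Gamma> (x t, frame_map k (x t) (u t)) (V t)) (at t)"
        using smooth_on_has_vector_derivative[OF smV T(2)] by simp
      show "\<forall>\<^sub>F s in nhds t. V s = frame_map k (x s) (w s)" by (rule eventually_mono[OF evT Vw])
    qed
    ultimately show ?thesis
      using T smu smw du dw by (intro exI[of _ T]) (auto simp: T_def)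
  qed
  have "smooth_on I u" "smooth_on I w"
    by (rule smooth_on_local, use local in blast)+
  then show ?thesis using local by blast
qed

lemma smooth_dh_apply:
  assumes "open I" "smooth_on I u" "smooth_on I w" "\<And>t. t \<in> I \<Longrightarrow> u t \<noteq> 0"
  shows "smooth_on I (\<lambda>t. fr.dh (u t) (w t))"
  unfolding fr.dh_def
  by (rule smooth_on_frechet_derivative_apply[OF spray_field_smooth assms(1-3)]) (use assms(4) in auto)

theorem parallel_connection_curvature:
  fixes c :: "real \<Rightarrow> 'g" and y W w N R :: "real \<Rightarrow> ('g, real^'n) tvec"
  assumes I: "open I" and geo: "geodesic A S I c" and par: "linearly_parallel A S I c W"
    and y: "\<And>t. t \<in> I \<Longrightarrow> y t = pushforward A A (left_translation G (inv (c t))) (c t) (velocity A c t)"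
    and w: "\<And>t. t \<in> I \<Longrightarrow> w t = pushforward A A (left_translation G (inv (c t))) (c t) (W t)"
    and N: "\<And>t. t \<in> I \<Longrightarrow> N t = connection_operator G A \<eta> (y t) (w t)"
    and R: "\<And>t. t \<in> I \<Longrightarrow> R t = riemann_curvature A S \<one> (y t) (w t)"
  shows "lie_algebra_field G A I N \<and> lie_algebra_field G A I R \<and>
    (\<forall>t\<in>I. N t = (\<lambda>d. - eta_bracket \<eta> y w t d)) \<and>
    (\<forall>t\<in>I. R t = eta_bracket \<eta> y N t) \<and>
    (\<forall>t\<in>I. eta_bracket \<eta> y N t = (\<lambda>d. - eta_bracket \<eta> y (eta_bracket \<eta> y w) t d))"
proof -
  have cG: "c t \<in> carrier G" and velT: "velocity A c t \<in> tangent_space A (c t)"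
    and WT: "W t \<in> tangent_space A (c t)" and vel0: "velocity A c t \<noteq> zero_tvec" if "t \<in> I" for t
    using geo par that chart_cover
    by (auto simp: geodesic_def integral_curve_def smooth_curve_def tangent_atlas_def tangent_chart_simps
        linearly_parallel_def smooth_field_along_def)
  obtain u where u: "\<And>t. t \<in> I \<Longrightarrow> y t = lin_comb (u t)"
      "\<And>t k. t \<in> I \<Longrightarrow> k \<in> A \<Longrightarrow> c t \<in> fst k \<Longrightarrow> velocity A c t k = frame_map k (snd k (c t)) (u t)"
    using translate_to_one[OF cG velT] y by metis
  obtain v where v: "\<And>t. t \<in> I \<Longrightarrow> w t = lin_comb (v t)"
      "\<And>t k. t \<in> I \<Longrightarrow> k \<in> A \<Longrightarrow> c t \<in> fst k \<Longrightarrow> W t k = frame_map k (snd k (c t)) (v t)"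
    using translate_to_one[OF cG WT] w by metis
  have nz: "u t \<noteq> 0" if t: "t \<in> I" for t
  proof
    assume 0: "u t = 0"
    obtain k where k: "k \<in> A" "c t \<in> fst k" using chart_exists[OF cG[OF t]] by blast
    have "velocity A c t k = 0" using u(2)[OF t k] 0 linear_0[OF linear_frame_map] by simp
    then show False using tvec_zero_iff[OF velT[OF t] k] vel0[OF t] by simp
  qed
  have smu: "smooth_on I u" and smv: "smooth_on I v"
    and du: "\<And>t. t \<in> I \<Longrightarrow> (u has_vector_derivative - spray_field (u t)) (at t)"
    and dv: "\<And>t. t \<in> I \<Longrightarrow> (v has_vector_derivative - fr.M (u t) (v t)) (at t)"
    using geodesic_parallel_ode[OF I geo par u(2) v(2) nz] by auto
  define \<nu> where "\<nu> t = fr.conn (u t) (v t)" for t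
  have N_eq: "N t = lin_comb (\<nu> t)" if "t \<in> I" for t
    using N[OF that] u(1)[OF that] v(1)[OF that] connection_lin_comb[OF nz[OF that]] by (simp add: \<nu>_def)
  have R_eq: "R t = lin_comb (fr.curv (u t) (v t))" if "t \<in> I" for t
    using R[OF that] u(1)[OF that] v(1)[OF that] riemann_lin_comb[OF nz[OF that]] by simp
  have d\<nu>: "(\<nu> has_vector_derivative - fr.curv (u t) (v t) - fr.dh (u t) (\<nu> t)) (at t)" if "t \<in> I" for t
    using fr.has_vector_derivative_conn[OF du[OF that] nz[OF that] dv[OF that]] by (simp add: \<nu>_def[abs_def])
  have bracket_w: "eta_bracket \<eta> y w t = lin_comb (- \<nu> t)" if "t \<in> I" for t
    using eta_bracket_lin_comb[where y = y and u = "u t" and t = t and v = w and f = v, OF I that u(1)[OF that] nz[OF that] v(1) dv[OF that]]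
    by (simp add: \<nu>_def fr.conn_eq)
  have bracket_N: "eta_bracket \<eta> y N t = lin_comb (fr.curv (u t) (v t))" if "t \<in> I" for t
    using eta_bracket_lin_comb[where y = y and u = "u t" and t = t and v = N and f = \<nu>, OF I that u(1)[OF that] nz[OF that] N_eq d\<nu>[OF that]] by simp
  have bracket_bracket: "eta_bracket \<eta> y (eta_bracket \<eta> y w) t = lin_comb (- fr.curv (u t) (v t))" if "t \<in> I" for t
    using eta_bracket_lin_comb[where y = y and u = "u t" and t = t and f = "\<lambda>t. - \<nu> t", OF I that u(1)[OF that] nz[OF that] bracket_w has_vector_derivative_minus[OF d\<nu>[OF that]]]
    by (simp add: linear_neg[OF fr.linear_dh[OF nz[OF that]]])
  have sm\<nu>: "smooth_on I \<nu>"
    unfolding \<nu>_def[abs_def] fr.conn_def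
    by (intro smooth_on_cmul smooth_on_diff I smooth_dh_apply smu smv nz
        smooth_on_bilinear[OF bilinear_bracket])
  \<comment> \<open>The smoothness is taken from the second claim itself: \<open>curv\<close> equals
    an expression in \<open>\<nu>\<close> and its derivative, both already smooth, which avoids the
    second derivative of \<open>spray_field\<close>.\<close>
  have smcurv: "smooth_on I (\<lambda>t. fr.curv (u t) (v t))"
  proof (rule smooth_on_cong[OF _ I])
    show "smooth_on I (\<lambda>t. - vector_derivative \<nu> (at t) - fr.dh (u t) (\<nu> t))"
      by (intro smooth_on_diff smooth_on_uminus smooth_on_vector_derivative I smooth_dh_apply smu sm\<nu> nz)
    show "- vector_derivative \<nu> (at t) - fr.dh (u t) (\<nu> t) = fr.curv (u t) (v t)" if "t \<in> I" for t
      using vector_derivative_at[OF d\<nu>[OF that]] by simp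
  qed
  have field: "lie_algebra_field G A I X"
    if X: "\<And>t. t \<in> I \<Longrightarrow> X t = lin_comb (f t)" and f: "smooth_on I f" for X f
    unfolding lie_algebra_field_def lie_algebra_def
  proof (intro conjI ballI)
    fix d show "smooth_on I (\<lambda>t. X t d)"
      by (rule smooth_on_cong[OF smooth_on_bounded_linear[OF bounded_linear_lin_comb I f] I]) (simp add: X)
  qed (simp add: X lin_comb_tangent)
  show ?thesis
    using field[OF N_eq sm\<nu>] field[OF R_eq smcurv]
    by (auto simp: N_eq R_eq bracket_w bracket_N bracket_bracket linear_neg[OF linear_lin_comb])
qed

end

theorem theorem1p2:
  fixes G :: "('g, 'b) monoid_scheme"
    and A :: "('g, real^'n::finite) chart set"
    and e :: "'n \<Rightarrow> ('g, real^'n) tvec"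
    and S :: "'g \<times> ('g, real^'n) tvec \<Rightarrow>
              ('g \<times> ('g, real^'n) tvec, (real^'n) \<times> (real^'n)) tvec"
    and \<eta> :: "('g, real^'n) tvec \<Rightarrow> ('g, real^'n) tvec"
    and I :: "real set" and c :: "real \<Rightarrow> 'g"
    and y W w N R :: "real \<Rightarrow> ('g, real^'n) tvec"
  assumes "lie_group G A"
    and "connected_space (manifold_topology A)"
    and "lie_algebra_basis G A e"
    and "left_invariant_spray G A S"
    and "\<eta> = spray_vector_field G A e S"
    and "open I" and "is_interval I"
    and "geodesic A S I c"
    and "linearly_parallel A S I c W"
    and "\<And>t. t \<in> I \<Longrightarrow>
          y t = pushforward A A (left_translation G (inv\<^bsub>G\<^esub> (c t))) (c t) (velocity A c t)"
    and "\<And>t. t \<in> I \<Longrightarrow>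
          w t = pushforward A A (left_translation G (inv\<^bsub>G\<^esub> (c t))) (c t) (W t)"
    and "\<And>t. t \<in> I \<Longrightarrow> N t = connection_operator G A \<eta> (y t) (w t)"
    and "\<And>t. t \<in> I \<Longrightarrow> R t = riemann_curvature A S \<one>\<^bsub>G\<^esub> (y t) (w t)"
  shows "lie_algebra_field G A I N \<and> lie_algebra_field G A I R \<and>
    (\<forall>t\<in>I. N t = (\<lambda>d. - eta_bracket \<eta> y w t d)) \<and>
    (\<forall>t\<in>I. R t = eta_bracket \<eta> y N t) \<and>
    (\<forall>t\<in>I. eta_bracket \<eta> y N t = (\<lambda>d. - eta_bracket \<eta> y (eta_bracket \<eta> y w) t d))"
proof -
  interpret lie_spray G A e S
    by unfold_locales (use assms in auto)
  show ?thesis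
    unfolding assms(5)
    by (rule parallel_connection_curvature[OF assms(6,8,9)]) (use assms in auto)
qed

end
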